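(* Let $\mathbb{F}$ be a field of characteristic zero. If $L$ is a finite-dimensional Lie algebra over $\mathbb{F}$ whose lattice of ideals $\mathcal{L}_{\mathrm{id}}(L)$ is complemented, then $L=S\oplus A$, where $S$ is a semisimple ideal of $L$ (possibly $0$) and $A$ is an abelian ideal of $L$, so that $A=Z(L)$. Moreover, for a finite-dimensional Lie algebra $L$ over $\mathbb{F}$ the following assertions are equivalent: (a) $\mathcal{L}_{\mathrm{id}}(L)$ is a boolean lattice. (b) $\mathcal{L}_{\mathrm{id}}(L)$ is finite and complemented. (c) $\mathcal{L}_{\mathrm{id}}(L)$ is (isomorphic to) the $n$-cube lattice $Q_n$ for some $n\geq 0$. (d) The Jacobson radical of $L$ is trivial and $Z(L)$ has dimension at most $1$. (e) $L$ is either $0$ or one of the following Lie algebras: a one-dimensional Lie algebra $\mathbb{F}z$, a semisimple Lie algebra $S$, or a direct sum as ideals of $\mathbb{F}z$ and $S$. In this case, $L$ has exactly $2^n$ ideals, where $n$ is either $r$ or $r+1$ and $r$ is the number of simple components of $S$ ($r=0$ is also possible).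
   Context: $\mathcal{L}_{\mathrm{id}}(L)$ denotes the set of ideals of $L$ ordered by inclusion; it is a bounded lattice with join the sum, meet the intersection, least element $0$ and greatest element $L$. A bounded lattice is complemented if each element $a$ has some $b$ with $a\vee b=1$ and $a\wedge b=0$; it is distributive if $a\wedge(b\vee c)=(a\wedge b)\vee(a\wedge c)$ for all $a,b,c$; it is boolean if it is complemented and distributive. $Q_n$ is the lattice of all subsets of $\{1,\dots,n\}$. The Jacobson radical of $L$ is the intersection of all maximal ideals of $L$ (it is $0$ if $L=0$). $Z(L)$ is the centre of $L$. In the final sentence, $S$ is the semisimple part of $L$ in (e) (with $S=0$, $r=0$ when $L=0$ or $L=\mathbb{F}z$). *)

theory Defs
  imports Complex_Main "HOL-Algebra.Lattice"
begin

section \<open>Complemented, distributive and boolean lattices\<close>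

definition complemented_lattice :: "('a, 'b) gorder_scheme \<Rightarrow> bool" where
  "complemented_lattice P \<longleftrightarrow> bounded_lattice P \<and>
     (\<forall>a\<in>carrier P. \<exists>b\<in>carrier P. a \<squnion>\<^bsub>P\<^esub> b = \<top>\<^bsub>P\<^esub> \<and> a \<sqinter>\<^bsub>P\<^esub> b = \<bottom>\<^bsub>P\<^esub>)"

definition distributive_lattice :: "('a, 'b) gorder_scheme \<Rightarrow> bool" where
  "distributive_lattice P \<longleftrightarrow> Lattice.lattice P \<and>
     (\<forall>a\<in>carrier P. \<forall>b\<in>carrier P. \<forall>c\<in>carrier P.
        a \<sqinter>\<^bsub>P\<^esub> (b \<squnion>\<^bsub>P\<^esub> c) = (a \<sqinter>\<^bsub>P\<^esub> b) \<squnion>\<^bsub>P\<^esub> (a \<sqinter>\<^bsub>P\<^esub> c))"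

definition boolean_lattice :: "('a, 'b) gorder_scheme \<Rightarrow> bool" where
  "boolean_lattice P \<longleftrightarrow> complemented_lattice P \<and> distributive_lattice P"

definition lattice_isomorphic :: "('a, 'c) gorder_scheme \<Rightarrow> ('b, 'd) gorder_scheme \<Rightarrow> bool" where
  "lattice_isomorphic P Q \<longleftrightarrow>
     (\<exists>f. bij_betw f (carrier P) (carrier Q) \<and> join_pres P Q f \<and> meet_pres P Q f)"

definition cube_lattice :: "nat \<Rightarrow> nat set gorder" where
  "cube_lattice n = \<lparr>carrier = Pow {1..n}, eq = (=), le = (\<subseteq>)\<rparr>"


section \<open>Lie algebras\<close>

text \<open>
  The whole type \<open>'a\<close> carries the Lie algebra. Every notion below takes a set \<open>M\<close>, meant to be a
  subalgebra and regarded as a Lie algebra in its own right: \<open>M = UNIV\<close> gives the notion for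
  the Lie algebra itself, and a proper \<open>M\<close> gives, for instance, the ideals or the semisimplicity
  of an ideal \<open>M\<close>, without reference to the elements outside \<open>M\<close>.
\<close>

locale lie_algebra = vector_space scale
  for scale :: "'k::field \<Rightarrow> 'a::ab_group_add \<Rightarrow> 'a" (infixr \<open>*s\<close> 75) +
  fixes bracket :: "'a \<Rightarrow> 'a \<Rightarrow> 'a"
  assumes bracket_add_left: "bracket (x + y) z = bracket x z + bracket y z"
    and bracket_add_right: "bracket x (y + z) = bracket x y + bracket x z"
    and bracket_scale_left: "bracket (c *s x) y = c *s bracket x y"
    and bracket_scale_right: "bracket x (c *s y) = c *s bracket x y"
    and bracket_self: "bracket x x = 0"
    and jacobi: "bracket x (bracket y z) + bracket y (bracket z x) + bracket z (bracket x y) = 0"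

locale finite_dim_lie_algebra = lie_algebra +
  assumes finite_dim: "\<exists>B. finite B \<and> span B = UNIV"

context lie_algebra
begin

definition lie_subalgebra :: "'a set \<Rightarrow> bool" where
  "lie_subalgebra M \<longleftrightarrow> subspace M \<and> (\<forall>x\<in>M. \<forall>y\<in>M. bracket x y \<in> M)"

definition lie_ideal :: "'a set \<Rightarrow> 'a set \<Rightarrow> bool" where
  "lie_ideal M I \<longleftrightarrow> subspace I \<and> I \<subseteq> M \<and> (\<forall>x\<in>M. \<forall>y\<in>I. bracket x y \<in> I)"

text \<open>
  The lattice operations of HOL-Algebra are derived from the order; the lemmas below
  identify them as sum and intersection.
\<close>

definition ideal_lattice :: "'a set \<Rightarrow> 'a set gorder" where
  "ideal_lattice M = \<lparr>carrier = {I. lie_ideal M I}, eq = (=), le = (\<subseteq>)\<rparr>"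

definition lie_centre :: "'a set \<Rightarrow> 'a set" where
  "lie_centre M = {x \<in> M. \<forall>y\<in>M. bracket x y = 0}"

definition abelian :: "'a set \<Rightarrow> bool" where
  "abelian M \<longleftrightarrow> (\<forall>x\<in>M. \<forall>y\<in>M. bracket x y = 0)"

definition derived_algebra :: "'a set \<Rightarrow> 'a set" where
  "derived_algebra M = span {bracket x y | x y. x \<in> M \<and> y \<in> M}"

definition solvable :: "'a set \<Rightarrow> bool" where
  "solvable M \<longleftrightarrow> (\<exists>n. (derived_algebra ^^ n) M = {0})"

text \<open>The radical is the sum of all solvable ideals.\<close>

definition lie_radical :: "'a set \<Rightarrow> 'a set" where
  "lie_radical M = span (\<Union>{I. lie_ideal M I \<and> solvable I})"

text \<open>The zero algebra counts as semisimple.\<close>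

definition semisimple :: "'a set \<Rightarrow> bool" where
  "semisimple M \<longleftrightarrow> lie_radical M = {0}"

definition simple :: "'a set \<Rightarrow> bool" where
  "simple M \<longleftrightarrow> \<not> abelian M \<and> (\<forall>I. lie_ideal M I \<longrightarrow> I = {0} \<or> I = M)"

definition maximal_ideal :: "'a set \<Rightarrow> 'a set \<Rightarrow> bool" where
  "maximal_ideal M I \<longleftrightarrow> lie_ideal M I \<and> I \<noteq> M \<and>
     (\<forall>J. lie_ideal M J \<and> I \<subseteq> J \<longrightarrow> J = I \<or> J = M)"

text \<open>For \<open>M = {0}\<close> there are no maximal ideals, and the outer intersection gives \<open>{0}\<close>.\<close>

definition jacobson_radical :: "'a set \<Rightarrow> 'a set" where
  "jacobson_radical M = M \<inter> \<Inter>{I. maximal_ideal M I}"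

definition direct_sum_of_ideals :: "'a set \<Rightarrow> 'a set \<Rightarrow> 'a set \<Rightarrow> bool" where
  "direct_sum_of_ideals M I J \<longleftrightarrow> lie_ideal M I \<and> lie_ideal M J \<and>
     M = {x + y | x y. x \<in> I \<and> y \<in> J} \<and> I \<inter> J = {0}"

text \<open>
  \<open>T\<close> is a set of simple components of \<open>M\<close>: the finitely many members of \<open>T\<close> are simple ideals
  of \<open>M\<close>, and \<open>M\<close> is their (internal) direct sum. For \<open>M = {0}\<close> this is \<open>T = {}\<close>.
\<close>

definition simple_components :: "'a set \<Rightarrow> 'a set set \<Rightarrow> bool" where
  "simple_components M T \<longleftrightarrow> finite T \<and> (\<forall>I\<in>T. lie_ideal M I \<and> simple I) \<and>
     M = span (\<Union>T) \<and> (\<forall>I\<in>T. I \<inter> span (\<Union>(T - {I})) = {0})"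

text \<open>
  \<open>S\<close> is the semisimple part of \<open>M\<close>, where \<open>M\<close> is semisimple or the direct sum of a
  one-dimensional ideal and a semisimple one. The case \<open>M = {0}\<close> falls under the
  first disjunct and the case of a one-dimensional \<open>M\<close> under the second, both with \<open>S = {0}\<close>.
\<close>

definition semisimple_part :: "'a set \<Rightarrow> 'a set \<Rightarrow> bool" where
  "semisimple_part M S \<longleftrightarrow> semisimple S \<and>
     (M = S \<or> (\<exists>z. z \<noteq> 0 \<and> direct_sum_of_ideals M (span {z}) S))"

lemma bracket_zero_right: "bracket x 0 = 0"
  using bracket_add_right[of x 0 0] by simp

lemma lie_subalgebra_UNIV: "lie_subalgebra UNIV"
  by (simp add: lie_subalgebra_def)

lemma lie_ideal_zero: "lie_subalgebra M \<Longrightarrow> lie_ideal M {0}"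
  by (auto simp: lie_ideal_def lie_subalgebra_def subspace_0 bracket_zero_right subspace_def)

lemma lie_ideal_self: "lie_subalgebra M \<Longrightarrow> lie_ideal M M"
  by (auto simp: lie_ideal_def lie_subalgebra_def)

lemma lie_ideal_Int: "lie_ideal M I \<Longrightarrow> lie_ideal M J \<Longrightarrow> lie_ideal M (I \<inter> J)"
  by (auto simp: lie_ideal_def subspace_inter)

lemma lie_ideal_sum:
  assumes "lie_subalgebra M" "lie_ideal M I" "lie_ideal M J"
  shows "lie_ideal M {x + y | x y. x \<in> I \<and> y \<in> J}"
proof -
  have "subspace {x + y | x y. x \<in> I \<and> y \<in> J}"
    using assms by (intro subspace_sums) (auto simp: lie_ideal_def)
  moreover have "{x + y | x y. x \<in> I \<and> y \<in> J} \<subseteq> M"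
    using assms by (auto simp: lie_ideal_def lie_subalgebra_def intro!: subspace_add)
  moreover have "bracket x (y + z) \<in> {x + y | x y. x \<in> I \<and> y \<in> J}"
    if "x \<in> M" "y \<in> I" "z \<in> J" for x y z
  proof -
    have "bracket x y \<in> I" "bracket x z \<in> J"
      using assms that by (auto simp: lie_ideal_def)
    then show ?thesis
      by (auto simp: bracket_add_right)
  qed
  ultimately show ?thesis
    unfolding lie_ideal_def by auto
qed

lemma ideal_lattice_least_sum:
  assumes M: "lie_subalgebra M" and I: "lie_ideal M I" and J: "lie_ideal M J"
  shows "least (ideal_lattice M) {x + y | x y. x \<in> I \<and> y \<in> J} (Upper (ideal_lattice M) {I, J})"
proof -
  have "I \<subseteq> {x + y | x y. x \<in> I \<and> y \<in> J}"
  proof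
    fix x assume "x \<in> I"
    moreover have "x = x + 0" "0 \<in> J"
      using J by (simp_all add: lie_ideal_def subspace_0)
    ultimately show "x \<in> {x + y | x y. x \<in> I \<and> y \<in> J}"
      by blast
  qed
  moreover have "J \<subseteq> {x + y | x y. x \<in> I \<and> y \<in> J}"
  proof
    fix y assume "y \<in> J"
    moreover have "y = 0 + y" "0 \<in> I"
      using I by (simp_all add: lie_ideal_def subspace_0)
    ultimately show "y \<in> {x + y | x y. x \<in> I \<and> y \<in> J}"
      by blast
  qed
  moreover have "{x + y | x y. x \<in> I \<and> y \<in> J} \<subseteq> K"
    if "lie_ideal M K" "I \<subseteq> K" "J \<subseteq> K" for K
    using that by (auto simp: lie_ideal_def intro!: subspace_add)
  ultimately show ?thesis
    using lie_ideal_sum[OF assms] I J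
    unfolding least_def Upper_def ideal_lattice_def by auto
qed

lemma ideal_lattice_greatest_Int:
  assumes "lie_ideal M I" "lie_ideal M J"
  shows "greatest (ideal_lattice M) (I \<inter> J) (Lower (ideal_lattice M) {I, J})"
  using assms lie_ideal_Int[OF assms]
  unfolding greatest_def Lower_def ideal_lattice_def by auto

lemma ideal_lattice_bounded:
  assumes M: "lie_subalgebra M"
  shows "bounded_lattice (ideal_lattice M)"
proof -
  have po: "partial_order (ideal_lattice M)"
    by unfold_locales (auto simp: ideal_lattice_def)
  interpret partial_order "ideal_lattice M"
    by (fact po)
  have "least (ideal_lattice M) {0} (carrier (ideal_lattice M))"
    using lie_ideal_zero[OF M] by (auto simp: least_def ideal_lattice_def lie_ideal_def subspace_0)
  moreover have "greatest (ideal_lattice M) M (carrier (ideal_lattice M))"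
    using lie_ideal_self[OF M] by (auto simp: greatest_def ideal_lattice_def lie_ideal_def)
  moreover have "\<exists>s. least (ideal_lattice M) s (Upper (ideal_lattice M) {I, J})"
    if "I \<in> carrier (ideal_lattice M)" "J \<in> carrier (ideal_lattice M)" for I J
    using ideal_lattice_least_sum[OF M] that by (auto simp: ideal_lattice_def)
  moreover have "\<exists>s. greatest (ideal_lattice M) s (Lower (ideal_lattice M) {I, J})"
    if "I \<in> carrier (ideal_lattice M)" "J \<in> carrier (ideal_lattice M)" for I J
    using ideal_lattice_greatest_Int that by (auto simp: ideal_lattice_def)
  ultimately show ?thesis
    by unfold_locales blast+
qed

lemma ideal_lattice_ops:
  assumes M: "lie_subalgebra M"
  shows ideal_lattice_join: "lie_ideal M I \<Longrightarrow> lie_ideal M J \<Longrightarrow>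
           I \<squnion>\<^bsub>ideal_lattice M\<^esub> J = {x + y | x y. x \<in> I \<and> y \<in> J}"
    and ideal_lattice_meet: "lie_ideal M I \<Longrightarrow> lie_ideal M J \<Longrightarrow>
           I \<sqinter>\<^bsub>ideal_lattice M\<^esub> J = I \<inter> J"
    and ideal_lattice_bottom: "\<bottom>\<^bsub>ideal_lattice M\<^esub> = {0}"
    and ideal_lattice_top: "\<top>\<^bsub>ideal_lattice M\<^esub> = M"
proof -
  interpret bounded_lattice "ideal_lattice M"
    by (rule ideal_lattice_bounded[OF M])
  have car: "I \<in> carrier (ideal_lattice M) \<longleftrightarrow> lie_ideal M I" for I
    by (simp add: ideal_lattice_def)
  have le: "I \<sqsubseteq>\<^bsub>ideal_lattice M\<^esub> J \<longleftrightarrow> I \<subseteq> J" for I J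
    by (simp add: ideal_lattice_def)
  show "I \<squnion>\<^bsub>ideal_lattice M\<^esub> J = {x + y | x y. x \<in> I \<and> y \<in> J}"
    if "lie_ideal M I" "lie_ideal M J"
  proof (rule joinI)
    fix s assume "least (ideal_lattice M) s (Upper (ideal_lattice M) {I, J})"
    with ideal_lattice_least_sum[OF M that] show "s = {x + y | x y. x \<in> I \<and> y \<in> J}"
      using least_unique by blast
  qed (simp_all add: car that)
  show "I \<sqinter>\<^bsub>ideal_lattice M\<^esub> J = I \<inter> J" if "lie_ideal M I" "lie_ideal M J"
  proof (rule meetI)
    fix s assume "greatest (ideal_lattice M) s (Lower (ideal_lattice M) {I, J})"
    with ideal_lattice_greatest_Int[OF that] show "s = I \<inter> J"
      using greatest_unique by blast
  qed (simp_all add: car that)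
  show "\<bottom>\<^bsub>ideal_lattice M\<^esub> = {0}"
    using bottom_eq[of "{0}"] lie_ideal_zero[OF M]
    by (auto simp: car le lie_ideal_def subspace_0)
  show "\<top>\<^bsub>ideal_lattice M\<^esub> = M"
    using top_eq[of M] lie_ideal_self[OF M] by (auto simp: car le lie_ideal_def)
qed

end

end

theory Submission
  imports Defs "HOL-Library.Function_Algebras" "HOL-Algebra.Algebraic_Closure_Type"
begin

text \<open>
  The only deep ingredient is Cartan's criterion: a nonzero Lie algebra with vanishing Killing form
  is not perfect. Over an algebraically closed field, decompose along the generalized eigenspaces
  of \<open>ad x\<close> and let the derivation \<open>D\<close> act on the eigenspace of \<open>a\<close> as the rational scalar \<open>q a\<close>, for a
  \<open>\<rat>\<close>-linear functional \<open>q\<close>. If the algebra is perfect with zero Killing form, the trace of \<open>ad x \<circ> D\<close>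
  vanishes, and applying \<open>q\<close> to it gives a vanishing sum of squares \<open>(q a)\<^sup>2\<close>. So every \<open>ad x\<close> is nilpotent,
  which contradicts Engel's theorem. The general case follows by extending scalars to the algebraic
  closure. Hence \<open>I \<inter> I\<^sup>\<bottom>\<close> is solvable for each ideal \<open>I\<close>, and ideals of a semisimple algebra are complemented.

  Complementedness and a centre of dimension at most 1 together give \<open>L = S\<close> or \<open>L = \<F>z \<oplus> S\<close>.
  The ideals of such an \<open>L\<close> are exactly the sums of subfamilies of the simple components together with
  \<open>\<F>z\<close>, so they form a cube. Conversely, a centre of dimension at least 2 contains infinitely many ideals
  and violates distributivity.
\<close>

section \<open>Traces and generalized eigenbases\<close>

text \<open>Since the functional is additive and brackets add eigenvalues ([V_a, V_b] lies in
  V_(a+b)), \<open>D\<close> satisfies the Leibniz rule. Hence ad v D - D ad v = - ad (D v), and by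
  cyclicity the trace of [ad u, ad v] D is minus a Killing product, although \<open>D\<close> need
  not be inner.

  Solvability of isotropic ideals rests on one compatibility: the Killing form of an ideal is the
  restriction of the ambient one. So a nonzero isotropic ideal is not perfect, its derived algebra
  is a smaller isotropic ideal, and induction on the dimension applies.

  Quotients are avoided throughout. Engel's theorem speaks of a pair of submodules, and triangular
  bases are built along an invariant hyperplane rather than modulo an eigenvector.

  Triviality of the Jacobson radical is equivalent to complementedness by lattice and dimension
  arguments alone; no structure theory of Lie algebras enters there.\<close>

text \<open>
  A separate locale, since definitions made in \<open>vector_space\<close> itself are also interpreted
  for the class of real vector spaces, where they would take precedence.
\<close>

locale trace_space = vector_space scale
  for scale :: "'k::field \<Rightarrow> 'v::ab_group_add \<Rightarrow> 'v" (infixr \<open>*s\<close> 75)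
begin

text \<open>\<open>representation\<close> is zero outside the span, so \<open>f\<close> is meant to
  map \<open>B\<close> into \<open>span B\<close>. The trace on an invariant subspace is then
  available without restricting \<open>f\<close>.\<close>

definition trace_on :: "'v set \<Rightarrow> ('v \<Rightarrow> 'v) \<Rightarrow> 'k" where
  "trace_on B f = (\<Sum>b\<in>B. representation B (f b) b)"

lemma trace_on_cong: "(\<And>b. b \<in> B \<Longrightarrow> f b = g b) \<Longrightarrow> trace_on B f = trace_on B g"
  by (simp add: trace_on_def)

lemma trace_on_add:
  assumes "independent B" "\<And>b. b \<in> B \<Longrightarrow> f b \<in> span B" "\<And>b. b \<in> B \<Longrightarrow> g b \<in> span B"
  shows "trace_on B (\<lambda>x. f x + g x) = trace_on B f + trace_on B g"
  using assms by (simp add: trace_on_def representation_add sum.distrib)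

lemma trace_on_diff:
  assumes "independent B" "\<And>b. b \<in> B \<Longrightarrow> f b \<in> span B" "\<And>b. b \<in> B \<Longrightarrow> g b \<in> span B"
  shows "trace_on B (\<lambda>x. f x - g x) = trace_on B f - trace_on B g"
  using assms by (simp add: trace_on_def representation_diff sum_subtractf)

lemma trace_on_scale:
  assumes "independent B" "\<And>b. b \<in> B \<Longrightarrow> f b \<in> span B"
  shows "trace_on B (\<lambda>x. c *s f x) = c * trace_on B f"
  using assms by (simp add: trace_on_def representation_scale sum_distrib_left)

text \<open>Both sides expand to the same double sum over \<open>B\<close> and \<open>C\<close>.
  Allowing two different bases yields independence of the basis as the case where one of the maps is
  the identity.\<close>

lemma trace_on_comm:
  assumes B: "independent B" "finite B" and C: "independent C" "finite C"
    and f: "Vector_Spaces.linear scale scale f" "\<And>x. x \<in> C \<Longrightarrow> f x \<in> span B"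
    and g: "Vector_Spaces.linear scale scale g" "\<And>x. x \<in> B \<Longrightarrow> g x \<in> span C"
  shows "trace_on B (\<lambda>x. f (g x)) = trace_on C (\<lambda>x. g (f x))"
proof -
  interpret f: Vector_Spaces.linear scale scale f by fact
  interpret g: Vector_Spaces.linear scale scale g by fact
  have 1: "representation B (f (g b)) b
      = (\<Sum>c\<in>C. representation C (g b) c * representation B (f c) b)" if "b \<in> B" for b
  proof -
    have "g b = (\<Sum>c\<in>C. representation C (g b) c *s c)"
      using sum_representation_eq[OF C(1), of "g b" C] g(2)[OF that] C by auto
    then have "f (g b) = (\<Sum>c\<in>C. representation C (g b) c *s f c)"
      by (metis (no_types, lifting) f.scale f.sum sum.cong)
    then show ?thesis
      using f(2) by (simp add: representation_sum[OF B(1)] span_scale representation_scale[OF B(1)])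
  qed
  have 2: "representation C (g (f c)) c
      = (\<Sum>b\<in>B. representation B (f c) b * representation C (g b) c)" if "c \<in> C" for c
  proof -
    have "f c = (\<Sum>b\<in>B. representation B (f c) b *s b)"
      using sum_representation_eq[OF B(1), of "f c" B] f(2)[OF that] B by auto
    then have "g (f c) = (\<Sum>b\<in>B. representation B (f c) b *s g b)"
      by (metis (no_types, lifting) g.scale g.sum sum.cong)
    then show ?thesis
      using g(2) by (simp add: representation_sum[OF C(1)] span_scale representation_scale[OF C(1)])
  qed
  show ?thesis
    unfolding trace_on_def
    by (simp add: 1 2 sum.swap[of _ C B] mult.commute)
qed

lemma linear_ident': "Vector_Spaces.linear scale scale (\<lambda>x. x)"
  using vector_space_axioms by (simp add: Vector_Spaces.linear_iff)

lemma trace_on_basis: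
  assumes B: "independent B" "finite B" and C: "independent C" "finite C" and "span B = span C"
    and f: "Vector_Spaces.linear scale scale f" "\<And>x. x \<in> C \<Longrightarrow> f x \<in> span B"
  shows "trace_on B f = trace_on C f"
proof -
  have "\<And>x. x \<in> B \<Longrightarrow> x \<in> span C"
    using assms(5) span_base by blast
  from trace_on_comm[OF B C f linear_ident' this] show ?thesis by simp
qed

text \<open>
  A labelled basis listed from the last vector to the first: modulo the earlier vectors
  with the same label \<open>a\<close>, each vector is an eigenvector for \<open>a\<close>.
\<close>

primrec eigenflag :: "('v \<Rightarrow> 'v) \<Rightarrow> ('v \<times> 'k) list \<Rightarrow> bool" where
  "eigenflag T [] = True"
| "eigenflag T (p # ps) = (eigenflag T ps \<and> fst p \<notin> span (fst ` set ps) \<and>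
     T (fst p) - snd p *s fst p \<in> span {e. (e, snd p) \<in> set ps})"

lemma label_span_subset: "span {e. (e, c) \<in> set ps} \<subseteq> span (fst ` set ps)"
  by (intro span_mono) force

lemma eigenflag_independent: "eigenflag T ps \<Longrightarrow> independent (fst ` set ps)"
  by (induction ps) (auto simp: independent_insertI independent_empty)

lemma eigenflag_distinct: "eigenflag T ps \<Longrightarrow> distinct (map fst ps)"
  by (induction ps) (auto dest: span_base[OF imageI, of _ _ fst])

text \<open>Leaving \<open>e\<close> itself out of the spanning set is what makes the diagonal
  coefficient at \<open>e\<close> of the difference vanish, so that traces can be read off the
  labels.\<close>

lemma eigenflag_member:
  assumes "eigenflag T ps" "(e, a) \<in> set ps"
  shows "T e - a *s e \<in> span ({e'. (e', a) \<in> set ps} - {e})"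
  using assms
proof (induction ps)
  case (Cons p ps)
  show ?case
  proof (cases "(e, a) = p")
    case True
    have flag: "e \<notin> span (fst ` set ps)" "T e - a *s e \<in> span {e'. (e', a) \<in> set ps}"
      using Cons.prems(1) unfolding True[symmetric] by simp_all
    then have "e \<notin> fst ` set ps"
      using span_base by blast
    then have "{e'. (e', a) \<in> set ps} \<subseteq> {e'. (e', a) \<in> set (p # ps)} - {e}"
      by force
    from subsetD[OF span_mono[OF this] flag(2)] show ?thesis .
  next
    case False
    then have "T e - a *s e \<in> span ({e'. (e', a) \<in> set ps} - {e})"
      using Cons by auto
    then show ?thesis
      by (rule subsetD[OF span_mono, rotated]) auto
  qed
qed simp

lemma eigenflag_member_diff:
  assumes "eigenflag T ps" "(e, a) \<in> set ps"
  shows "T e - a *s e \<in> span {e'. (e', a) \<in> set ps}"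
  using eigenflag_member[OF assms] span_mono[of "{e'. (e', a) \<in> set ps} - {e}" "{e'. (e', a) \<in> set ps}"]
  by auto

lemma linear_span_invariant:
  assumes T: "Vector_Spaces.linear scale scale T" and "\<And>x. x \<in> B \<Longrightarrow> T x \<in> span C" "w \<in> span B"
  shows "T w \<in> span C"
proof -
  interpret T: Vector_Spaces.linear scale scale T by fact
  show ?thesis
    using assms(3)
    by (induction rule: span_induct_alt) (auto simp: T.add T.scale T.zero span_zero intro!: span_add span_scale assms(2))
qed

lemma eigenflag_label_invariant:
  assumes T: "Vector_Spaces.linear scale scale T" and "eigenflag T ps"
    and "w \<in> span {e. (e, a) \<in> set ps}"
  shows "T w \<in> span {e. (e, a) \<in> set ps}"
proof (rule linear_span_invariant[OF T _ assms(3)])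
  fix x assume x: "x \<in> {e. (e, a) \<in> set ps}"
  then have "T x = (T x - a *s x) + a *s x" "T x - a *s x \<in> span {e. (e, a) \<in> set ps}"
    using eigenflag_member_diff[OF assms(2)] by auto
  then show "T x \<in> span {e. (e, a) \<in> set ps}"
    using x by (metis span_add span_base span_scale)
qed

lemma eigenflag_invariant:
  assumes T: "Vector_Spaces.linear scale scale T" and "eigenflag T ps" and "w \<in> span (fst ` set ps)"
  shows "T w \<in> span (fst ` set ps)"
proof (rule linear_span_invariant[OF T _ assms(3)])
  fix x assume "x \<in> fst ` set ps"
  then obtain a where "(x, a) \<in> set ps" by force
  then have "T x \<in> span {e. (e, a) \<in> set ps}"
    by (intro eigenflag_label_invariant[OF T assms(2)]) (simp add: span_base)
  then show "T x \<in> span (fst ` set ps)"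
    by (rule subsetD[OF label_span_subset])
qed

text \<open>On the part of the flag with labels other than \<open>c\<close> the operator T - c is
  injective, so nothing from there can be mapped into the span of label \<open>c\<close>. This
  criterion later locates brackets of generalized eigenvectors.\<close>

lemma eigenflag_pull:
  assumes T: "Vector_Spaces.linear scale scale T"
    and "eigenflag T ps" "w \<in> span (fst ` set ps)" "T w - c *s w \<in> span {e. (e, c) \<in> set ps}"
  shows "w \<in> span {e. (e, c) \<in> set ps}"
  using assms(2-)
proof (induction ps arbitrary: w)
  case Nil
  then show ?case by simp
next
  case (Cons p ps)
  interpret T: Vector_Spaces.linear scale scale T by fact
  let ?W = "span (fst ` set ps)" and ?V = "span {e. (e, c) \<in> set ps}"
  obtain e a where p: "p = (e, a)" by (cases p)
  have flag: "eigenflag T ps" and e: "e \<notin> ?W" and Te: "T e - a *s e \<in> span {e'. (e', a) \<in> set ps}"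
    using Cons.prems by (auto simp: p)
  obtain \<alpha> where "w - \<alpha> *s e \<in> ?W"
    using Cons.prems(2) by (auto simp: p span_insert)
  define w' where "w' = w - \<alpha> *s e"
  have w': "w' \<in> ?W" and w: "w = \<alpha> *s e + w'"
    using \<open>w - \<alpha> *s e \<in> ?W\<close> by (auto simp: w'_def)
  have Tw': "T w' - c *s w' \<in> ?W"
    using eigenflag_invariant[OF T flag w'] w' by (simp add: span_diff span_scale)
  have eq: "T w - c *s w = \<alpha> *s (T e - a *s e) + (\<alpha> * (a - c)) *s e + (T w' - c *s w')"
    by (simp add: w T.add T.scale algebra_simps)
  have TeW: "T e - a *s e \<in> ?W"
    using Te by (rule subsetD[OF label_span_subset])
  have noE: "k = 0" if "k *s e \<in> ?W" for k
    using that e span_scale[of "k *s e" "fst ` set ps" "inverse k"] by (cases "k = 0") auto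
  show ?case
  proof (cases "a = c")
    case False
    have Veq: "{e'. (e', c) \<in> set (p # ps)} = {e'. (e', c) \<in> set ps}"
      using False by (auto simp: p)
    have "T w - c *s w \<in> ?W"
      using Cons.prems(3) unfolding Veq by (rule subsetD[OF label_span_subset])
    \<comment> \<open>All other terms lie in \<open>?W\<close>, so the coefficient of
      \<open>e\<close> must vanish; as \<open>a\<close> differs from \<open>c\<close>, this kills
      \<alpha>.\<close>
    moreover have "(\<alpha> * (a - c)) *s e = (T w - c *s w) - \<alpha> *s (T e - a *s e) - (T w' - c *s w')"
      by (simp only: eq) simp
    ultimately have "(\<alpha> * (a - c)) *s e \<in> ?W"
      using TeW Tw' by (metis span_diff span_scale)
    then have "\<alpha> = 0"
      using noE False by fastforce
    then have "w = w'" by (simp add: w)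
    then show ?thesis
      using Cons.IH[OF flag w'] Cons.prems(3) unfolding Veq by simp
  next
    case True
    have Veq: "{e'. (e', c) \<in> set (p # ps)} = insert e {e'. (e', c) \<in> set ps}"
      using True by (auto simp: p)
    \<comment> \<open>\<open>k\<close> is the coefficient of \<open>e\<close> in a vector that turns
      out to lie in \<open>?W\<close>, hence it is zero.\<close>
    obtain k where k: "T w - c *s w - k *s e \<in> ?V"
      using Cons.prems(3) unfolding Veq by (auto simp: span_insert)
    have eq': "T w - c *s w = \<alpha> *s (T e - a *s e) + (T w' - c *s w')"
      using eq True by simp
    have "T w - c *s w \<in> ?W"
      unfolding eq' by (metis TeW Tw' span_add span_scale)
    from span_diff[OF this subsetD[OF label_span_subset k]] have "k *s e \<in> ?W"
      by simp
    then have "k = 0" by (rule noE)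
    then have "T w - c *s w \<in> ?V" using k by simp
    moreover have "T w' - c *s w' = (T w - c *s w) - \<alpha> *s (T e - a *s e)"
      by (simp only: eq') simp
    ultimately have "T w' - c *s w' \<in> ?V"
      using Te True by (metis span_diff span_scale)
    then have "w' \<in> ?V"
      by (rule Cons.IH[OF flag w'])
    then show ?thesis
      unfolding Veq w
      by (intro span_add span_scale) (auto intro: span_base subsetD[OF span_mono])
  qed
qed

text \<open>T - a is invertible on the labels other than \<open>a\<close>, so it is surjective
  modulo the span of label \<open>a\<close>. This supplies the correction of a new basis vector in
  \<open>eigenflag_exists\<close>.\<close>

lemma eigenflag_solve:
  assumes T: "Vector_Spaces.linear scale scale T"
    and "eigenflag T ps" "h \<in> span (fst ` set ps)"
  shows "\<exists>g\<in>span (fst ` set ps). h - (T g - a *s g) \<in> span {e. (e, a) \<in> set ps}"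
  using assms(2-)
proof (induction ps arbitrary: h)
  case Nil
  interpret T: Vector_Spaces.linear scale scale T by fact
  from Nil show ?case by simp
next
  case (Cons p ps)
  interpret T: Vector_Spaces.linear scale scale T by fact
  let ?W = "span (fst ` set ps)" and ?V = "span {e. (e, a) \<in> set ps}"
  obtain e b where p: "p = (e, b)" by (cases p)
  have flag: "eigenflag T ps" and Te: "T e - b *s e \<in> span {e'. (e', b) \<in> set ps}"
    using Cons.prems by (auto simp: p)
  have sub: "?V \<subseteq> span {e'. (e', a) \<in> set (p # ps)}" and subW: "?W \<subseteq> span (fst ` set (p # ps))"
    by (auto intro!: span_mono)
  obtain \<alpha> where "h - \<alpha> *s e \<in> ?W"
    using Cons.prems(2) by (auto simp: p span_insert)
  then obtain h' where h': "h' \<in> ?W" and h: "h = \<alpha> *s e + h'"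
    by (metis add.commute diff_add_cancel)
  show ?case
  proof (cases "b = a")
    case True
    obtain g where g: "g \<in> ?W" "h' - (T g - a *s g) \<in> ?V"
      using Cons.IH[OF flag h'] by blast
    have "h - (T g - a *s g) = \<alpha> *s e + (h' - (T g - a *s g))"
      by (simp add: h)
    moreover have "\<alpha> *s e \<in> span {e'. (e', a) \<in> set (p # ps)}"
      using True by (intro span_scale span_base) (simp add: p)
    ultimately have "h - (T g - a *s g) \<in> span {e'. (e', a) \<in> set (p # ps)}"
      using subsetD[OF sub g(2)] by (simp only: span_add)
    then show ?thesis
      using subsetD[OF subW g(1)] by blast
  next
    case False
    \<comment> \<open>T - a sends \<gamma> e to \<alpha> e plus \<gamma> (T e - b e). The second
      term is an error in earlier vectors, which \<open>h''\<close> hands to the induction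
      hypothesis.\<close>
    define \<gamma> where "\<gamma> = \<alpha> / (b - a)"
    define h'' where "h'' = h' - \<gamma> *s (T e - b *s e)"
    have "T e - b *s e \<in> ?W"
      using Te by (rule subsetD[OF label_span_subset])
    then have "h'' \<in> ?W"
      unfolding h''_def by (metis h' span_diff span_scale)
    then obtain g where g: "g \<in> ?W" "h'' - (T g - a *s g) \<in> ?V"
      using Cons.IH[OF flag] by blast
    have "\<gamma> * (b - a) = \<alpha>"
      using False by (simp add: \<gamma>_def)
    then have "\<gamma> * b - \<gamma> * a = \<alpha>"
      by (simp only: right_diff_distrib)
    then have "\<alpha> *s e = (\<gamma> * b) *s e - (\<gamma> * a) *s e"
      by (metis scale_left_diff_distrib)
    moreover have "(x - y) + z - ((u + v) - (y + t)) = (z - (u - x)) - (v - t)" for x y z u v t :: 'v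
      by (simp add: algebra_simps)
    ultimately have "h - (T (\<gamma> *s e + g) - a *s (\<gamma> *s e + g)) = h'' - (T g - a *s g)"
      by (simp only: h h''_def T.add T.scale scale_right_distrib scale_right_diff_distrib
          scale_scale mult.commute[of a])
    moreover have "\<gamma> *s e + g \<in> span (fst ` set (p # ps))"
      using g subW by (intro span_add span_scale) (auto simp: p intro: span_base)
    ultimately show ?thesis
      using subsetD[OF sub g(2)] by (intro bexI[of _ "\<gamma> *s e + g"]) (simp_all only:)
  qed
qed

text \<open>T is triangular in the listed basis with the labels on its diagonal, while
  \<open>D\<close> is diagonal there.\<close>

lemma trace_on_eigenflag:
  assumes "eigenflag T ps" "Vector_Spaces.linear scale scale T"
    and D: "\<And>e a. (e, a) \<in> set ps \<Longrightarrow> D e = f a *s e"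
  shows "trace_on (fst ` set ps) (\<lambda>x. T (D x)) = (\<Sum>(e, a)\<leftarrow>ps. a * f a)"
proof -
  interpret T: Vector_Spaces.linear scale scale T by fact
  let ?E = "fst ` set ps"
  have ind: "independent ?E" and dist: "distinct (map fst ps)"
    using assms eigenflag_independent eigenflag_distinct by auto
  have key: "representation ?E (T (D e)) e = a * f a" if "(e, a) \<in> set ps" for e a
  proof -
    have e: "e \<in> ?E" using that by force
    have Te: "T e - a *s e \<in> span ({e'. (e', a) \<in> set ps} - {e})"
      using eigenflag_member[OF assms(1) that] .
    have sub: "{e'. (e', a) \<in> set ps} - {e} \<subseteq> ?E - {e}" by force
    have "representation ?E (T e - a *s e) = representation (?E - {e}) (T e - a *s e)"
      using Te span_mono[OF sub] by (intro representation_extend[OF ind]) auto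
    then have r0: "representation ?E (T e - a *s e) e = 0"
      using representation_ne_zero[of "?E - {e}" "T e - a *s e" e] by auto
    have "T (D e) = f a *s ((T e - a *s e) + a *s e)"
      using D[OF that] by (simp add: T.scale)
    moreover have "T e - a *s e \<in> span ?E"
      using Te span_mono[OF sub] span_mono[of "?E - {e}" ?E] by auto
    ultimately have "representation ?E (T (D e)) e = f a * (0 + a * 1)"
      using r0 e representation_basis[OF ind e]
      by (simp only: representation_scale[OF ind] representation_add[OF ind] span_add span_scale span_base) simp
    then show ?thesis by simp
  qed
  have "trace_on ?E (\<lambda>x. T (D x)) = sum_list (map (\<lambda>e. representation ?E (T (D e)) e) (map fst ps))"
    unfolding trace_on_def sum_list_distinct_conv_sum_set[OF dist] by simp
  also have "map (\<lambda>e. representation ?E (T (D e)) e) (map fst ps) = map (\<lambda>(e, a). a * f a) ps"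
    unfolding map_map by (rule map_cong) (auto simp: key)
  finally show ?thesis .
qed

lemma independent_image_card_surj:
  assumes B: "independent B" "finite B" and "independent C" "C \<subseteq> span B" "card C = card B" 
  shows "span C = span B"
proof (rule ccontr)
  assume "span C \<noteq> span B"
  moreover have "span C \<subseteq> span B"
    using assms(4) by (simp add: span_minimal)
  ultimately obtain x where x: "x \<in> span B" "x \<notin> span C" by blast
  have "finite C" using independent_span_bound[OF B(2) assms(3,4)] by simp
  have "independent (insert x C)"
    using x assms by (intro independent_insertI)
  moreover have "insert x C \<subseteq> span B" using x assms by auto
  ultimately have "card (insert x C) \<le> card B"
    using independent_span_bound[OF B(2)] by blast
  moreover have "x \<notin> C" using x span_base by blast
  ultimately show False using assms(5) \<open>finite C\<close> by simp
qed

lemma linear_inj_on_span_surj: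
  assumes T: "Vector_Spaces.linear scale scale T" and B: "finite B" "independent B"
    and inv: "\<And>x. x \<in> span B \<Longrightarrow> T x \<in> span B"
    and inj: "\<And>x. x \<in> span B \<Longrightarrow> T x = 0 \<Longrightarrow> x = 0"
  shows "T ` span B = span B"
proof -
  interpret T: Vector_Spaces.linear scale scale T by fact
  interpret vp: vector_space_pair scale scale by unfold_locales
  have inj: "inj_on T (span B)"
    by (rule inj_onI) (metis inj T.diff eq_iff_diff_eq_0 span_diff)
  have "independent (T ` B)"
    using T.independent_injective_image[OF B(2) inj] .
  moreover have "card (T ` B) = card B"
    using inj by (intro card_image) (meson inj_on_subset span_superset)
  moreover have "T ` B \<subseteq> span B"
    by (intro image_subsetI inv span_base)
  ultimately have "span (T ` B) = span B"
    by (intro independent_image_card_surj[OF B(2,1)])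
  then show ?thesis unfolding T.span_image .
qed

end

section \<open>Dimension arguments and polynomials in an operator\<close>

context trace_space
begin

lemma dim_strict_mono:
  assumes "finite B" "subspace N" "subspace N'" "N \<subset> N'" "N' \<subseteq> span B"
  shows "dim N < dim N'"
proof -
  obtain C where C: "C \<subseteq> N" "independent C" "N \<subseteq> span C"
    using maximal_independent_subset[of N] by blast
  obtain C' where C': "C \<subseteq> C'" "C' \<subseteq> N'" "independent C'" "N' \<subseteq> span C'"
    using maximal_independent_subset_extend[of C N'] C assms(4) by blast
  have "finite C'"
    using independent_span_bound[OF assms(1) C'(3)] C'(2) assms(5) by blast
  moreover have "C \<noteq> C'"
  proof
    assume "C = C'"
    then have "N' \<subseteq> span C" using C'(4) by simp
    also have "span C \<subseteq> N" using C(1) assms(2) by (rule span_minimal)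
    finally show False using assms(4) by blast
  qed
  ultimately have "card C < card C'"
    using C'(1) by (intro psubset_card_mono) auto
  then show ?thesis
    using basis_card_eq_dim[OF C(1,3,2)] basis_card_eq_dim[OF C'(2,4,3)] by simp
qed

text \<open>Dimensions are bounded by \<open>card B\<close>, so a candidate of greatest dimension
  exists, and it is maximal for inclusion. The lemma supplies maximal proper subalgebras and maximal
  ideals.\<close>

lemma obtain_max_subspace:
  assumes "finite B" "P N0" "\<And>N. P N \<Longrightarrow> subspace N \<and> N \<subseteq> span B"
  obtains N where "P N" "\<And>N'. P N' \<Longrightarrow> N \<subseteq> N' \<Longrightarrow> N' = N"
proof -
  have "\<exists>N. P N \<and> (\<forall>N'. P N' \<longrightarrow> dim N' \<le> dim N)"
    using assms dim_le_card[of _ B] by (intro ex_has_greatest_nat[of _ N0 _ "Suc (card B)"]) (auto simp: less_Suc_eq_le)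
  then obtain N where N: "P N" "\<And>N'. P N' \<Longrightarrow> dim N' \<le> dim N" by blast
  have "N' = N" if "P N'" "N \<subseteq> N'" for N'
    using dim_strict_mono[OF assms(1), of N N'] N that assms(3)[of N] assms(3)[of N']
    by (metis leD psubsetI)
  then show thesis using N(1) that by blast
qed

lemma obtain_basis:
  assumes "subspace N" "N \<subseteq> span B" "finite B"
  obtains C where "finite C" "independent C" "span C = N"
proof -
  obtain C where C: "C \<subseteq> N" "independent C" "N \<subseteq> span C"
    using maximal_independent_subset[of N] by blast
  have "finite C"
    using independent_span_bound[OF assms(3) C(2)] C(1) assms(2) by blast
  moreover have "span C = N"
    using C span_minimal[OF C(1) assms(1)] by blast
  ultimately show thesis using that C(2) by blast
qed

text \<open>The vector p(T) w, evaluated by Horner's scheme directly on vectors, so that no ring of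
  operators is required.\<close>

definition poly_orbit :: "('v \<Rightarrow> 'v) \<Rightarrow> 'v \<Rightarrow> 'k poly \<Rightarrow> 'v" where
  "poly_orbit T w p = fold_coeffs (\<lambda>a v. a *s w + T v) p 0"

context
  fixes T assumes T: "Vector_Spaces.linear scale scale T"
begin

interpretation T: Vector_Spaces.linear scale scale T by (rule T)

lemma poly_orbit_0 [simp]: "poly_orbit T w 0 = 0"
  by (simp add: poly_orbit_def)

lemma poly_orbit_pCons [simp]: "poly_orbit T w (pCons a p) = a *s w + T (poly_orbit T w p)"
  by (cases "p = 0 \<and> a = 0") (auto simp: poly_orbit_def)

lemma poly_orbit_add: "poly_orbit T w (p + q) = poly_orbit T w p + poly_orbit T w q"
  by (induction p q rule: poly_induct2) (simp_all add: T.add scale_left_distrib ac_simps)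

lemma poly_orbit_smult: "poly_orbit T w (smult c p) = c *s poly_orbit T w p"
  by (induction p) (simp_all add: T.scale scale_right_distrib)

lemma poly_orbit_diff: "poly_orbit T w (p - q) = poly_orbit T w p - poly_orbit T w q"
  using poly_orbit_add[of w "p - q" q] by simp

lemma poly_orbit_linear_factor:
  "poly_orbit T w ([:- a, 1:] * q) = T (poly_orbit T w q) - a *s poly_orbit T w q"
proof -
  have "[:- a, 1:] * q = pCons 0 q - smult a q" by simp
  then show ?thesis
    by (simp only: poly_orbit_diff poly_orbit_smult poly_orbit_pCons) simp
qed

lemma poly_orbit_monom: "poly_orbit T w (monom 1 n) = (T ^^ n) w"
  by (induction n) (simp_all add: monom_0 monom_Suc T.zero)

lemma poly_orbit_in_subspace:
  assumes "subspace V" "w \<in> V" "\<And>x. x \<in> V \<Longrightarrow> T x \<in> V"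
  shows "poly_orbit T w p \<in> V"
  by (induction p) (auto intro!: subspace_add subspace_scale assms subspace_0)

text \<open>The alternative \<open>p = 0\<close> covers \<open>m = 0\<close>, where no polynomial
  satisfies the degree bound.\<close>

lemma span_orbit_poly:
  assumes "x \<in> span ((\<lambda>i. (T ^^ i) w) ` {..<m})"
  shows "\<exists>p. (p = 0 \<or> degree p < m) \<and> x = poly_orbit T w p"
  using assms
proof (induction rule: span_induct_alt)
  case base
  then show ?case by (intro exI[of _ 0]) simp
next
  case (step c x y)
  obtain i where i: "i < m" "x = (T ^^ i) w"
    using step(1) by blast
  obtain p where p: "p = 0 \<or> degree p < m" "y = poly_orbit T w p"
    using step by blast
  have "degree (smult c (monom 1 i) + p) < m"
    using i p(1) degree_monom_le[of "1::'k" i] degree_smult_le[of c "monom 1 i"]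
    by (intro degree_add_less) auto
  moreover have "c *s x + y = poly_orbit T w (smult c (monom 1 i) + p)"
    by (simp add: i p poly_orbit_add poly_orbit_smult poly_orbit_monom)
  ultimately show ?case by blast
qed

text \<open>Otherwise any number of iterates of \<open>w\<close> would be independent, since a
  relation among them is an annihilating polynomial; but at most \<open>card B\<close> vectors of
  \<open>span B\<close> are independent.\<close>

lemma annihilating_poly_exists:
  assumes B: "finite B" and w: "w \<in> span B" and inv: "\<And>x. x \<in> span B \<Longrightarrow> T x \<in> span B"
  shows "\<exists>p. p \<noteq> 0 \<and> poly_orbit T w p = 0"
proof (rule ccontr)
  assume none: "\<not> ?thesis"
  let ?S = "\<lambda>m. (\<lambda>i. (T ^^ i) w) ` {..<m}"
  have "independent (?S m) \<and> card (?S m) = m" for m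
  proof (induction m)
    case 0
    then show ?case by (simp add: independent_empty)
  next
    case (Suc m)
    have notin: "(T ^^ m) w \<notin> span (?S m)"
    proof
      assume "(T ^^ m) w \<in> span (?S m)"
      from span_orbit_poly[OF this] obtain p
        where p: "p = 0 \<or> degree p < m" "(T ^^ m) w = poly_orbit T w p" by blast
      have "poly_orbit T w (monom 1 m - p) = 0"
        using p(2) by (simp add: poly_orbit_diff poly_orbit_monom)
      moreover have "monom 1 m \<noteq> p"
        using p(1) by (auto simp: degree_monom_eq)
      ultimately show False using none by (metis right_minus_eq)
    qed
    have ins: "?S (Suc m) = insert ((T ^^ m) w) (?S m)"
      by (simp add: lessThan_Suc)
    have "(T ^^ m) w \<notin> ?S m"
      using notin by (rule contrapos_nn) (rule span_base)
    moreover have "finite (?S m)" by simp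
    ultimately have "card (insert ((T ^^ m) w) (?S m)) = Suc m"
      using Suc by (metis card_insert_disjoint)
    then show ?case
      unfolding ins using independent_insertI[OF notin] Suc by blast
  qed
  note this[of "Suc (card B)"]
  moreover have "(T ^^ i) w \<in> span B" for i
    by (induction i) (simp_all add: w inv)
  then have "?S (Suc (card B)) \<subseteq> span B" by blast
  ultimately have "Suc (card B) \<le> card B"
    using independent_span_bound[OF B] by metis
  then show False by simp
qed

end

end

section \<open>Triangular bases over an algebraically closed field\<close>

locale alg_closed_space = trace_space scale
  for scale :: "'k::alg_closed_field \<Rightarrow> 'v::ab_group_add \<Rightarrow> 'v" (infixr \<open>*s\<close> 75)
begin

text \<open>Linear factors are split off the annihilating polynomial one at a time. The first time
  the remaining factor no longer kills \<open>w\<close>, its value is an eigenvector for the root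
  just removed. Algebraic closedness enters here, through the existence of that root.\<close>

lemma poly_orbit_eigenvector:
  assumes T: "Vector_Spaces.linear scale scale T"
    and "w \<noteq> 0" "p \<noteq> 0" "poly_orbit T w p = 0"
  shows "\<exists>q a. poly_orbit T w q \<noteq> 0 \<and> T (poly_orbit T w q) = a *s poly_orbit T w q"
  using assms(3,4)
proof (induction "degree p" arbitrary: p rule: less_induct)
  case less
  interpret T: Vector_Spaces.linear scale scale T by fact
  show ?case
  proof (cases "degree p = 0")
    case True
    then obtain c where "p = [:c:]" using degree_eq_zeroE by blast
    then show ?thesis
      using less.prems \<open>w \<noteq> 0\<close> by (simp add: poly_orbit_pCons[OF T] poly_orbit_0[OF T] T.zero)
  next
    case False
    then obtain a where "poly p a = 0"
      using alg_closed_imp_poly_has_root[of p] by blast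
    then obtain q where q: "p = [:- a, 1:] * q"
      by (auto simp: poly_eq_0_iff_dvd dvd_def)
    have "q \<noteq> 0" using q less.prems by auto
    have "degree q < degree p"
      using degree_mult_eq[of "[:- a, 1:]" q] \<open>q \<noteq> 0\<close> unfolding q by simp
    show ?thesis
    proof (cases "poly_orbit T w q = 0")
      case True
      then show ?thesis
        using less.hyps[OF \<open>degree q < degree p\<close> \<open>q \<noteq> 0\<close>] by blast
    next
      case False
      moreover have "T (poly_orbit T w q) - a *s poly_orbit T w q = 0"
        using less.prems poly_orbit_linear_factor[OF T] q by metis
      ultimately show ?thesis by (metis eq_iff_diff_eq_0)
    qed
  qed
qed

lemma eigenvector_exists:
  assumes T: "Vector_Spaces.linear scale scale T" and "finite B"
    and "\<And>x. x \<in> span B \<Longrightarrow> T x \<in> span B" "w \<in> span B" "w \<noteq> 0"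
  shows "\<exists>v a. v \<in> span B \<and> v \<noteq> 0 \<and> T v = a *s v"
  using poly_orbit_eigenvector[OF T \<open>w \<noteq> 0\<close>]
    annihilating_poly_exists[OF T \<open>finite B\<close> \<open>w \<in> span B\<close> assms(3)]
    poly_orbit_in_subspace[OF T subspace_span \<open>w \<in> span B\<close> assms(3)]
  by blast

text \<open>An eigenvector makes S = T - a singular, so its image is a proper subspace. Every
  subspace containing that image is invariant under T, and a hyperplane is chosen among them by
  dropping one vector \<open>e\<close> from a basis that extends a basis of the image.\<close>

lemma invariant_hyperplane_exists:
  assumes T: "Vector_Spaces.linear scale scale T" and B: "finite B" "independent B" "B \<noteq> {}"
    and inv: "\<And>x. x \<in> span B \<Longrightarrow> T x \<in> span B"
  shows "\<exists>C e a. finite C \<and> independent (insert e C) \<and> e \<notin> C \<and> span (insert e C) = span B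
    \<and> (\<forall>x\<in>span B. T x - a *s x \<in> span C)"
proof -
  interpret T: Vector_Spaces.linear scale scale T by fact
  interpret vector_space_pair scale scale by unfold_locales
  obtain w where w: "w \<in> B" using B by blast
  then have "w \<noteq> 0" using B(2) dependent_zero by blast
  then obtain v a where v: "v \<in> span B" "v \<noteq> 0" "T v = a *s v"
    using eigenvector_exists[OF T B(1) inv span_base[OF w]] by blast
  define S where "S = (\<lambda>x. T x - a *s x)"
  have linS: "Vector_Spaces.linear scale scale S"
    unfolding S_def using T linear_ident' 
    by (intro linear_compose_sub linear_scale_self module_hom_scale)
  interpret S: Vector_Spaces.linear scale scale S by (rule linS)
  have SB: "S ` span B \<subseteq> span B"
    using inv by (auto simp: S_def intro!: span_diff span_scale)
  have "S ` span B \<noteq> span B"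
  proof
    \<comment> \<open>Extend \<open>v\<close> to a basis \<open>C\<close>. Since S kills
      \<open>v\<close>, the images of the other vectors would span everything with fewer than
      \<open>card B\<close> elements.\<close>
    assume eq: "S ` span B = span B"
    have "independent {v}" using v(2) by simp
    then obtain C where C: "{v} \<subseteq> C" "C \<subseteq> span B" "independent C" "span B \<subseteq> span C"
      using maximal_independent_subset_extend[of "{v}" "span B"] v(1) by blast
    have C2: "finite C" "card C \<le> card B"
      using independent_span_bound[OF B(1) C(3,2)] by auto
    have "span C = span B"
      using C(4) span_minimal[OF C(2) subspace_span] by blast
    then have "span B = span (S ` C)"
      using eq S.span_image by metis
    also have "S ` C = insert 0 (S ` (C - {v}))"
    proof -
      have "S v = 0" by (simp add: S_def v(3))
      moreover have "C = insert v (C - {v})" using C(1) by blast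
      ultimately show ?thesis by (metis image_insert)
    qed
    finally have "span B = span (S ` (C - {v}))"
      by (simp only: span_insert_0)
    with span_superset[of B] have "B \<subseteq> span (S ` (C - {v}))"
      by (rule subset_trans[OF _ equalityD1])
    from independent_span_bound[OF _ B(2) this] C2(1)
    have "card B \<le> card (S ` (C - {v}))" by simp
    also have "\<dots> \<le> card (C - {v})" using C2(1) by (intro card_image_le) simp
    also have "\<dots> < card C" using C(1) C2(1) by (intro psubset_card_mono) auto
    finally show False using C2(2) by simp
  qed
  note ne = this
  obtain C0 where C0: "C0 \<subseteq> S ` span B" "independent C0" "S ` span B \<subseteq> span C0"
    using maximal_independent_subset[of "S ` span B"] by blast
  obtain C1 where C1: "C0 \<subseteq> C1" "C1 \<subseteq> span B" "independent C1" "span B \<subseteq> span C1"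
    using maximal_independent_subset_extend[of C0 "span B"] C0 SB by blast
  have "span C0 \<subseteq> S ` span B"
    using C0(1) S.subspace_image[OF subspace_span] by (rule span_minimal)
  then have "C0 \<noteq> C1" using ne SB C1(4) C0(3) by auto
  then obtain e where e: "e \<in> C1" "e \<notin> C0" using C1(1) by blast
  have "finite C1" using independent_span_bound[OF B(1) C1(3,2)] by simp
  have "span C1 = span B"
    using C1(4) span_minimal[OF C1(2) subspace_span] by blast
  moreover have "span C0 \<subseteq> span (C1 - {e})"
    using C1(1) e by (intro span_mono) auto
  ultimately show ?thesis
    using e C1(3) C0(3) \<open>finite C1\<close>
    by (intro exI[of _ "C1 - {e}"] exI[of _ e] exI[of _ a])
       (auto simp: insert_absorb S_def)
qed

text \<open>Induction over an invariant hyperplane. The extra vector \<open>e\<close> satisfies T e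
  = a e only modulo the whole hyperplane; replacing it by \<open>e - g\<close>, with
  \<open>g\<close> from \<open>eigenflag_solve\<close>, removes the contributions of all labels
  other than \<open>a\<close>.\<close>

lemma eigenflag_exists:
  assumes T: "Vector_Spaces.linear scale scale T" and "finite B" "independent B"
    and "\<And>x. x \<in> span B \<Longrightarrow> T x \<in> span B"
  shows "\<exists>ps. eigenflag T ps \<and> span (fst ` set ps) = span B"
  using assms(2-)
proof (induction "card B" arbitrary: B)
  case 0
  then show ?case by (intro exI[of _ "[]"]) simp
next
  case (Suc n)
  interpret T: Vector_Spaces.linear scale scale T by fact
  have "B \<noteq> {}" using Suc.hyps(2) by auto
  from invariant_hyperplane_exists[OF T Suc.prems(1,2) this Suc.prems(3)]
  obtain C e a where C: "finite C" "independent (insert e C)" "e \<notin> C" "span (insert e C) = span B"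
    and TC: "\<And>x. x \<in> span B \<Longrightarrow> T x - a *s x \<in> span C" by blast
  have sub: "span C \<subseteq> span B" using span_mono[of C "insert e C"] C(4) by blast
  have indC: "independent C" and e: "e \<notin> span C"
    using C(2,3) by (auto simp: independent_insert)
  have "card (insert e C) = card B"
    using C(2,4) Suc.prems(2) by (metis dim_span_eq_card_independent)
  then have "n = card C" using Suc.hyps(2) C(1,3) by simp
  moreover have "T x \<in> span C" if "x \<in> span C" for x
  proof -
    have "T x - a *s x \<in> span C" using TC that sub by blast
    from span_add[OF this span_scale[OF that, of a]] show ?thesis by simp
  qed
  ultimately obtain ps where ps: "eigenflag T ps" "span (fst ` set ps) = span C"
    using Suc.hyps(1)[of C] C(1) indC by blast
  have "e \<in> span B" using C(4) span_base by blast
  then have "T e - a *s e \<in> span (fst ` set ps)" using TC ps by simp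
  from eigenflag_solve[OF T ps(1) this, of a] obtain g
    where g: "g \<in> span C" "T e - a *s e - (T g - a *s g) \<in> span {e. (e, a) \<in> set ps}"
    unfolding ps(2) by blast
  have eq: "T (e - g) - a *s (e - g) = T e - a *s e - (T g - a *s g)"
    by (simp add: T.diff scale_right_diff_distrib)
  have notin: "e - g \<notin> span C"
    using e g(1) span_add[of "e - g" C g] by auto
  have sp: "span (insert (e - g) (fst ` set ps)) = span (insert e C)"
  proof (rule span_subspace)
    have "fst ` set ps \<subseteq> span (insert e C)"
      using ps(2) span_superset[of "fst ` set ps"] span_mono[of C "insert e C"] by blast
    moreover have "e - g \<in> span (insert e C)"
      using g(1) span_mono[of C "insert e C"] by (intro span_diff) (auto intro: span_base)
    ultimately show "insert (e - g) (fst ` set ps) \<subseteq> span (insert e C)" by blast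
    have 1: "span C \<subseteq> span (insert (e - g) (fst ` set ps))"
      using ps(2) span_mono[of "fst ` set ps" "insert (e - g) (fst ` set ps)"] by blast
    have "e - g \<in> span (insert (e - g) (fst ` set ps))" by (simp add: span_base)
    from span_add[OF this subsetD[OF 1 g(1)]] have "e \<in> span (insert (e - g) (fst ` set ps))"
      by simp
    then show "span (insert e C) \<subseteq> span (insert (e - g) (fst ` set ps))"
      using 1 span_superset[of C] by (intro span_minimal) auto
  qed simp
  have "eigenflag T ((e - g, a) # ps)"
    unfolding eigenflag.simps fst_conv snd_conv eq ps(2) using ps(1) notin g(2) by blast
  moreover have "span (fst ` set ((e - g, a) # ps)) = span B"
    unfolding list.set image_insert fst_conv sp C(4) ..
  ultimately show ?case by blast
qed

end

section \<open>Engel's theorem\<close>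

sublocale lie_algebra \<subseteq> trace_space scale
  by unfold_locales

context lie_algebra
begin

lemma linear_bracket: "Vector_Spaces.linear scale scale (bracket x)"
  using vector_space_axioms
  by (simp add: Vector_Spaces.linear_iff bracket_add_right bracket_scale_right)

lemma linear_bracket_left: "Vector_Spaces.linear scale scale (\<lambda>x. bracket x y)"
  using vector_space_axioms
  by (simp add: Vector_Spaces.linear_iff bracket_add_left bracket_scale_left)

lemma bracket_zero_left: "bracket 0 x = 0"
  using bracket_add_left[of 0 0 x] by simp

lemma bracket_minus_right: "bracket x (- y) = - bracket x y"
  using bracket_add_right[of x y "- y"] by (simp add: bracket_zero_right eq_neg_iff_add_eq_0 add.commute)

lemma bracket_diff_right: "bracket x (y - z) = bracket x y - bracket x z"
  using bracket_add_right[of x "y - z" z] by (simp add: algebra_simps)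

lemma bracket_diff_left: "bracket (x - y) z = bracket x z - bracket y z"
  using bracket_add_left[of "x - y" y z] by (simp add: algebra_simps)

lemma bracket_swap: "bracket y x = - bracket x y"
proof -
  have "bracket y x + bracket x y = 0"
    using bracket_self[of "x + y"] bracket_self[of x] bracket_self[of y]
    by (simp add: bracket_add_left bracket_add_right add.commute)
  then show ?thesis by (simp only: eq_neg_iff_add_eq_0)
qed

lemma bracket_derivation:
  "bracket x (bracket y z) = bracket (bracket x y) z + bracket y (bracket x z)"
  using jacobi[of x y z] bracket_swap[of z "bracket x y"] bracket_swap[of "x" z] bracket_minus_right
  by (metis add.commute add.left_commute add_diff_cancel_right' diff_conv_add_uminus eq_neg_iff_add_eq_0 minus_minus)

lemma subspace_bracket_into: "subspace U \<Longrightarrow> subspace {v. bracket n v \<in> U}"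
  by (auto simp: subspace_def bracket_zero_right bracket_add_right bracket_scale_right)

lemma subspace_into_bracket: "subspace U \<Longrightarrow> subspace {n. bracket n v \<in> U}"
  by (auto simp: subspace_def bracket_zero_left bracket_add_left bracket_scale_left)

text \<open>The pair \<open>U \<subset> V\<close> stands for the quotient module \<open>V / U\<close>.\<close>

lemma engel_vector_exists:
  assumes B: "finite B" and MB: "M \<subseteq> span B"
    and nil: "\<And>x v. x \<in> M \<Longrightarrow> v \<in> M \<Longrightarrow> \<exists>n. (bracket x ^^ n) v = 0"
    and "lie_subalgebra N" "N \<subseteq> M"
    and "subspace U" "subspace V" "U \<subset> V" "V \<subseteq> M"
    and "\<And>n v. n \<in> N \<Longrightarrow> v \<in> V \<Longrightarrow> bracket n v \<in> V"
    and "\<And>n v. n \<in> N \<Longrightarrow> v \<in> U \<Longrightarrow> bracket n v \<in> U"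
  shows "\<exists>v\<in>V - U. \<forall>n\<in>N. bracket n v \<in> U"
  using assms(4-)
proof (induction "dim N" arbitrary: N U V rule: less_induct)
  case less
  have subN: "subspace N" and Nclosed: "\<And>x y. x \<in> N \<Longrightarrow> y \<in> N \<Longrightarrow> bracket x y \<in> N"
    using less.prems(1) by (auto simp: lie_subalgebra_def)
  show ?case
  proof (cases "N = {0}")
    case True
    then show ?thesis
      using less.prems(3,5) by (auto simp: bracket_zero_left subspace_0)
  next
    case False
    have "lie_subalgebra {0} \<and> {0} \<subset> N"
      using False subspace_0[OF subN] by (auto simp: lie_subalgebra_def bracket_zero_right)
    then obtain N' where N'_conj: "lie_subalgebra N' \<and> N' \<subset> N"
      and max_conj: "\<And>K. lie_subalgebra K \<and> K \<subset> N \<Longrightarrow> N' \<subseteq> K \<Longrightarrow> K = N'"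
    proof (rule obtain_max_subspace[OF B, where P = "\<lambda>K. lie_subalgebra K \<and> K \<subset> N"])
      show "subspace K \<and> K \<subseteq> span B" if "lie_subalgebra K \<and> K \<subset> N" for K
        using that less.prems(2) MB by (auto simp: lie_subalgebra_def)
    qed (rule that)
    note N' = N'_conj[THEN conjunct1] N'_conj[THEN conjunct2] and max = max_conj[OF conjI]
    have subN': "subspace N'" and N'closed: "\<And>x y. x \<in> N' \<Longrightarrow> y \<in> N' \<Longrightarrow> bracket x y \<in> N'"
      using N'(1) by (auto simp: lie_subalgebra_def)
    have dim: "dim N' < dim N"
      using dim_strict_mono[OF B subN' subN N'(2)] less.prems(2) MB by blast
    \<comment> \<open>The induction hypothesis for \<open>N'\<close> acting on
      \<open>N / N'\<close>. The resulting \<open>y\<close> normalizes \<open>N'\<close>, so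
      \<open>N'\<close> and \<open>y\<close> span a subalgebra, which by maximality of
      \<open>N'\<close> is \<open>N\<close>.\<close>
    have "\<exists>y\<in>N - N'. \<forall>n\<in>N'. bracket n y \<in> N'"
      using less.hyps[OF dim N'(1) _ subN' subN N'(2) less.prems(2)] N'(2) less.prems(2) Nclosed N'closed
      by blast
    then obtain y where y: "y \<in> N" "y \<notin> N'" "\<And>n. n \<in> N' \<Longrightarrow> bracket n y \<in> N'" by blast
    define N'' where "N'' = span (insert y N')"
    have N''_iff: "x \<in> N'' \<longleftrightarrow> (\<exists>c. x - c *s y \<in> N')" for x
      unfolding N''_def span_insert by (simp add: span_eq_iff[THEN iffD2, OF subN'])
    have y': "bracket y n \<in> N'" if "n \<in> N'" for n
      using y(3)[OF that] bracket_swap[of y n] subspace_neg[OF subN'] by simp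
    have "bracket u v \<in> N''" if "u \<in> N''" "v \<in> N''" for u v
    proof -
      obtain c d where c: "u - c *s y \<in> N'" and d: "v - d *s y \<in> N'"
        using \<open>u \<in> N''\<close> \<open>v \<in> N''\<close> N''_iff by blast
      have "bracket u v = bracket ((u - c *s y) + c *s y) ((v - d *s y) + d *s y)" by simp
      also have "\<dots> = bracket (u - c *s y) (v - d *s y) + d *s bracket (u - c *s y) y
          + c *s bracket y (v - d *s y)"
        unfolding bracket_add_left bracket_add_right bracket_scale_left bracket_scale_right bracket_self
        by simp
      also have "\<dots> \<in> N'"
        using N'closed[OF c d] y(3)[OF c] y'[OF d]
        by (intro subspace_add[OF subN'] subspace_scale[OF subN'])
      finally show ?thesis by (simp add: N''_def span_base span_superset[THEN subsetD])
    qed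
    then have "lie_subalgebra N''"
      by (simp add: lie_subalgebra_def N''_def)
    moreover have "N'' \<subseteq> N"
      unfolding N''_def using y(1) N'(2) subN by (intro span_minimal) auto
    moreover have "N' \<subseteq> N''" "y \<in> N''"
      using span_superset[of "insert y N'"] unfolding N''_def by simp_all
    ultimately have N: "N = N''" using max[of N''] y(2) by blast
    \<comment> \<open>By the induction hypothesis for \<open>N'\<close> on \<open>V / U\<close>,
      this space contains a vector outside \<open>U\<close>; it is stable under \<open>y\<close>
      because \<open>y\<close> normalizes \<open>N'\<close>.\<close>
    define V' where "V' = {v \<in> V. \<forall>n\<in>N'. bracket n v \<in> U}"
    have "\<exists>v\<in>V - U. \<forall>n\<in>N'. bracket n v \<in> U"
      using less.hyps[OF dim N'(1) _ less.prems(3-6)] N'(2) less.prems(2,7,8) by blast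
    then obtain v0 where v0: "v0 \<in> V'" "v0 \<notin> U" unfolding V'_def by blast
    have V'y: "bracket y v \<in> V'" if "v \<in> V'" for v
    proof -
      have "bracket n (bracket y v) \<in> U" if "n \<in> N'" for n
      proof -
        have "bracket (bracket n y) v \<in> U" "bracket y (bracket n v) \<in> U"
          using \<open>v \<in> V'\<close> that y less.prems(8) unfolding V'_def by auto
        then show ?thesis
          unfolding bracket_derivation[of n y v] by (intro subspace_add[OF less.prems(3)])
      qed
      then show ?thesis using \<open>v \<in> V'\<close> less.prems(7) y(1) unfolding V'_def by blast
    qed
    have pow: "(bracket y ^^ k) v0 \<in> V'" for k
      by (induction k) (simp_all add: v0 V'y)
    obtain n where "(bracket y ^^ n) v0 = 0"
      using nil[of y v0] y(1) v0(1) less.prems(2,6) unfolding V'_def by blast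
    then have ex: "(bracket y ^^ n) v0 \<in> U" using less.prems(3) by (simp add: subspace_0)
    \<comment> \<open>Nilpotency of \<open>y\<close> brings the iterates of \<open>v0\<close> into
      \<open>U\<close>. The iterate just before the first one inside \<open>U\<close> is the
      required vector; \<open>k\<close> is positive since \<open>v0\<close> is outside
      \<open>U\<close>.\<close>
    define k where "k = (LEAST k. (bracket y ^^ k) v0 \<in> U)"
    have kU: "(bracket y ^^ k) v0 \<in> U"
      unfolding k_def using ex by (rule LeastI)
    obtain j where k: "k = Suc j"
      using kU v0(2) by (cases k) auto
    define v where "v = (bracket y ^^ j) v0"
    have "v \<notin> U"
      using not_less_Least[of j "\<lambda>k. (bracket y ^^ k) v0 \<in> U"] k unfolding k_def v_def by simp
    moreover have v: "v \<in> V'" unfolding v_def by (rule pow)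
    moreover have yv: "bracket y v \<in> U" using kU by (simp add: v_def k)
    moreover have "bracket n v \<in> U" if "n \<in> N" for n
    proof -
      obtain c where c: "n - c *s y \<in> N'" using \<open>n \<in> N\<close> N N''_iff by blast
      have "bracket n v = bracket ((n - c *s y) + c *s y) v" by simp
      also have "\<dots> = bracket (n - c *s y) v + c *s bracket y v"
        unfolding bracket_add_left bracket_scale_left ..
      also have "\<dots> \<in> U"
        using v c yv unfolding V'_def by (intro subspace_add subspace_scale less.prems(3)) auto
      finally show ?thesis .
    qed
    ultimately show ?thesis unfolding V'_def by blast
  qed
qed

text \<open>Apply Engel to M acting on M / U for a maximal proper ideal \<open>U\<close>. The
  invariant vector \<open>v\<close> together with \<open>U\<close> spans an ideal, hence all of M,
  and every bracket then falls into \<open>U\<close>.\<close>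

lemma engel_not_perfect:
  assumes B: "finite B" and MB: "M \<subseteq> span B" and M: "lie_subalgebra M" "M \<noteq> {0}"
    and nil: "\<And>x v. x \<in> M \<Longrightarrow> v \<in> M \<Longrightarrow> \<exists>n. (bracket x ^^ n) v = 0"
  shows "\<not> M \<subseteq> derived_algebra M"
proof
  assume perf: "M \<subseteq> derived_algebra M"
  have subM: "subspace M" and Mclosed: "\<And>x y. x \<in> M \<Longrightarrow> y \<in> M \<Longrightarrow> bracket x y \<in> M"
    using M by (auto simp: lie_subalgebra_def)
  have "lie_ideal M {0} \<and> {0} \<noteq> M" using M lie_ideal_zero by auto
  then obtain U where U_conj: "lie_ideal M U \<and> U \<noteq> M"
    and max: "\<And>K. lie_ideal M K \<and> K \<noteq> M \<Longrightarrow> U \<subseteq> K \<Longrightarrow> K = U"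
  proof (rule obtain_max_subspace[OF B, where P = "\<lambda>K. lie_ideal M K \<and> K \<noteq> M"])
    show "subspace K \<and> K \<subseteq> span B" if "lie_ideal M K \<and> K \<noteq> M" for K
      using that MB by (auto simp: lie_ideal_def)
  qed (rule that)
  note U = U_conj[THEN conjunct1] U_conj[THEN conjunct2]
  have subU: "subspace U" and UM: "U \<subset> M" and Uinv: "\<And>n v. n \<in> M \<Longrightarrow> v \<in> U \<Longrightarrow> bracket n v \<in> U"
    using U by (auto simp: lie_ideal_def)
  have "\<exists>v\<in>M - U. \<forall>n\<in>M. bracket n v \<in> U"
    using Uinv Mclosed by (intro engel_vector_exists[OF B MB nil M(1) _ subU subM UM]) auto
  then obtain v where v: "v \<in> M" "v \<notin> U" "\<And>n. n \<in> M \<Longrightarrow> bracket n v \<in> U" by blast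
  define K where "K = span (insert v U)"
  have K_iff: "x \<in> K \<longleftrightarrow> (\<exists>c. x - c *s v \<in> U)" for x
    unfolding K_def span_insert by (simp add: span_eq_iff[THEN iffD2, OF subU])
  have into: "bracket n x \<in> U" if "n \<in> M" "x \<in> K" for n x
  proof -
    obtain c where c: "x - c *s v \<in> U" using \<open>x \<in> K\<close> K_iff by blast
    have "bracket n x = bracket n ((x - c *s v) + c *s v)" by simp
    also have "\<dots> = bracket n (x - c *s v) + c *s bracket n v"
      unfolding bracket_add_right bracket_scale_right ..
    also have "\<dots> \<in> U"
      using c v(3) Uinv \<open>n \<in> M\<close> by (intro subspace_add subspace_scale subU) auto
    finally show ?thesis .
  qed
  have "U \<subseteq> K" "v \<in> K" unfolding K_def using span_superset[of "insert v U"] by auto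
  moreover have "K \<subseteq> M" unfolding K_def using v(1) UM subM by (intro span_minimal) auto
  ultimately have "lie_ideal M K"
    using into unfolding lie_ideal_def by (auto simp: K_def)
  then have "K = M" using max[of K] \<open>U \<subseteq> K\<close> \<open>v \<in> K\<close> v(2) by blast
  then have "derived_algebra M \<subseteq> U"
    unfolding derived_algebra_def using into by (intro span_minimal subU) blast
  then show False using perf UM by blast
qed

text \<open>With T = ad x, the Leibniz rule gives (T - a - b)[e, e'] = [(T - a) e, e'] +
  [e, (T - b) e'], where each summand replaces one factor by earlier basis vectors of the same
  label. The sublists \<open>qs\<close> and \<open>rs\<close> carry this double induction while
  \<open>ps\<close> stays fixed, and \<open>eigenflag_pull\<close> concludes.\<close>

lemma eigenflag_bracket_basis:
  assumes "eigenflag (bracket x) ps" "lie_subalgebra (span (fst ` set ps))"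
    and "eigenflag (bracket x) qs" "set qs \<subseteq> set ps" "(e, a) \<in> set qs"
    and "eigenflag (bracket x) rs" "set rs \<subseteq> set ps" "(e', b) \<in> set rs"
  shows "bracket e e' \<in> span {u. (u, a + b) \<in> set ps}"
  using assms(3-)
proof (induction qs arbitrary: e a rs e' b)
  case Nil
  then show ?case by simp
next
  case (Cons q qs)
  note outer = this
  show ?case
  proof (cases "(e, a) = q")
    case False
    show ?thesis using outer(1)[OF _ _ _ outer(5-7)] outer(2-4) False by auto
  next
    case True
    have Te: "bracket x e - a *s e \<in> span {u. (u, a) \<in> set qs}"
      using outer(2) True by auto
    show ?thesis
      using outer(5-7)
    proof (induction rs arbitrary: e' b)
      case Nil
      then show ?case by simp
    next
      case (Cons r rs)
      show ?case
      proof (cases "(e', b) = r")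
        case False
        then show ?thesis using Cons by auto
      next
        case r: True
        have Te': "bracket x e' - b *s e' \<in> span {u. (u, b) \<in> set rs}"
          using Cons.prems(1) r by auto
        let ?V = "span {u. (u, a + b) \<in> set ps}"
        have "{u. (u, a) \<in> set qs} \<subseteq> {n. bracket n e' \<in> ?V}"
          using outer(1)[OF _ _ _ Cons.prems] outer(2,3) by auto
        then have 1: "bracket (bracket x e - a *s e) e' \<in> ?V"
          using span_minimal[OF _ subspace_into_bracket[OF subspace_span]] Te by blast
        have "{u. (u, b) \<in> set rs} \<subseteq> {v. bracket e v \<in> ?V}"
          using Cons.IH Cons.prems(1,2) by auto
        then have 2: "bracket e (bracket x e' - b *s e') \<in> ?V"
          using span_minimal[OF _ subspace_bracket_into[OF subspace_span]] Te' by blast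
        have "bracket x (bracket e e') - (a + b) *s bracket e e'
          = bracket (bracket x e - a *s e) e' + bracket e (bracket x e' - b *s e')"
          unfolding bracket_derivation[of x e e'] bracket_diff_left bracket_diff_right
            bracket_scale_left bracket_scale_right scale_left_distrib
          by (simp add: algebra_simps)
        also have "\<dots> \<in> ?V" using 1 2 by (rule span_add)
        finally have "bracket x (bracket e e') - (a + b) *s bracket e e' \<in> ?V" .
        moreover have "e \<in> fst ` set ps" "e' \<in> fst ` set ps"
          using outer(3,4) Cons.prems(2,3) by force+
        then have "bracket e e' \<in> span (fst ` set ps)"
          using assms(2) span_base unfolding lie_subalgebra_def by blast
        ultimately show ?thesis
          by (rule eigenflag_pull[OF linear_bracket assms(1), rotated])
      qed
    qed
  qed
qed

end

section \<open>Cartan's criterion\<close>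

text \<open>The field is a vector space over \<open>\<rat>\<close>, and the assignment of 1 to
  \<open>a\<close> extends linearly from the independent set \<open>{a}\<close>. The values are
  rational, where a sum of squares vanishes only if every square does.\<close>

lemma rational_functional_exists:
  fixes a :: "'k::field_char_0"
  assumes "a \<noteq> 0"
  shows "\<exists>q :: 'k \<Rightarrow> rat. q a = 1 \<and> (\<forall>x y. q (x + y) = q x + q y) \<and> (\<forall>r x. q (of_rat r * x) = r * q x)"
proof -
  interpret R: vector_space "\<lambda>r (x :: 'k). of_rat r * x"
    by unfold_locales (simp_all add: of_rat_add of_rat_mult algebra_simps)
  interpret Q: vector_space "(*) :: rat \<Rightarrow> rat \<Rightarrow> rat"
    by unfold_locales (simp_all add: algebra_simps)
  interpret vector_space_pair "\<lambda>r (x :: 'k). of_rat r * x" "(*) :: rat \<Rightarrow> rat \<Rightarrow> rat" ..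
  have "R.independent {a}" using assms by simp
  from linear_independent_extend[OF this, of "\<lambda>_. 1"] show ?thesis
    unfolding Vector_Spaces.linear_iff by auto
qed

context lie_algebra
begin

text \<open>A bracket of vectors with labels \<open>a\<close> and \<open>b\<close> lies in the span
  of label \<open>a + b\<close>, on which \<open>D\<close> is the scalar f a + f b; this is the
  Leibniz rule on the basis.\<close>

lemma eigenflag_derivation:
  assumes flag: "eigenflag (bracket x) ps" and sub: "lie_subalgebra (span (fst ` set ps))"
    and f: "\<And>a b. f (a + b) = f a + f b"
  shows "\<exists>D. Vector_Spaces.linear scale scale D \<and> (\<forall>(e, a)\<in>set ps. D e = f a *s e) \<and>
    (\<forall>u\<in>span (fst ` set ps). \<forall>v\<in>span (fst ` set ps).
        D u \<in> span (fst ` set ps) \<and> D (bracket u v) = bracket (D u) v + bracket u (D v))"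
proof -
  interpret vp: vector_space_pair scale scale by unfold_locales
  let ?E = "fst ` set ps"
  have ind: "independent ?E" by (rule eigenflag_independent[OF flag])
  define D where "D = vp.construct ?E (\<lambda>e. f (the (map_of ps e)) *s e)"
  have lin: "Vector_Spaces.linear scale scale D"
    unfolding D_def by (rule vp.linear_construct[OF ind])
  interpret D: Vector_Spaces.linear scale scale D by (rule lin)
  have De: "D e = f a *s e" if "(e, a) \<in> set ps" for e a
  proof -
    have "map_of ps e = Some a"
      using eigenflag_distinct[OF flag] that by (rule map_of_is_SomeI)
    moreover have "e \<in> ?E" using that by force
    ultimately show ?thesis
      unfolding D_def vp.construct_basis[OF ind \<open>e \<in> ?E\<close>] by simp
  qed
  have Dlabel: "D u = f a *s u" if "u \<in> span {e. (e, a) \<in> set ps}" for u a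
    using that
    by (induction rule: span_induct_alt)
       (simp_all add: D.zero D.add D.scale De scale_right_distrib scale_left_commute)
  have DM: "D u \<in> span ?E" if "u \<in> span ?E" for u
    using that
  proof (induction rule: span_induct_alt)
    case base
    then show ?case by (simp add: D.zero span_zero)
  next
    case (step c e y)
    then obtain a where "(e, a) \<in> set ps" by auto
    then have "D e \<in> span ?E"
      using De step(1) span_base[of e ?E] by (simp add: span_scale)
    then show ?case using step(2) by (simp add: D.add D.scale span_add span_scale)
  qed
  have basis: "D (bracket e e') = bracket (D e) e' + bracket e (D e')"
    if "(e, a) \<in> set ps" "(e', b) \<in> set ps" for e a e' b
  proof -
    have "bracket e e' \<in> span {u. (u, a + b) \<in> set ps}"
      by (rule eigenflag_bracket_basis[OF flag sub flag _ that(1) flag _ that(2)]) simp_all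
    from Dlabel[OF this] show ?thesis
      unfolding De[OF that(1)] De[OF that(2)] f
      by (simp add: bracket_scale_left bracket_scale_right scale_left_distrib)
  qed
  have right: "D (bracket e v) = bracket (D e) v + bracket e (D v)"
    if "(e, a) \<in> set ps" "v \<in> span ?E" for e a v
    using that(2)
  proof (induction rule: span_induct_alt)
    case base
    then show ?case by (simp add: D.zero bracket_zero_right)
  next
    case (step c e' y)
    then obtain b where "(e', b) \<in> set ps" by auto
    from basis[OF that(1) this] step(2) show ?case
      by (simp add: bracket_add_right bracket_scale_right D.add D.scale scale_right_distrib)
  qed
  have "D (bracket u v) = bracket (D u) v + bracket u (D v)"
    if "u \<in> span ?E" "v \<in> span ?E" for u v
    using that(1)
  proof (induction rule: span_induct_alt)
    case base
    then show ?case by (simp add: D.zero bracket_zero_left)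
  next
    case (step c e y)
    then obtain a where "(e, a) \<in> set ps" by auto
    from right[OF this that(2)] step(2) show ?case
      by (simp add: bracket_add_left bracket_scale_left D.add D.scale scale_right_distrib)
  qed
  with lin De DM show ?thesis by (intro exI[of _ D]) auto
qed

text \<open>By cyclicity tr([ad u, ad v] D) = tr(ad u [ad v, D]), and [ad v, D] = - ad (D v) as
  \<open>D\<close> is a derivation. So the trace is a negated Killing product and vanishes; linear
  combinations of such brackets exhaust the derived algebra.\<close>

lemma trace_ad_derivation:
  assumes B: "finite B" "independent B" and sub: "lie_subalgebra (span B)"
    and kill: "\<And>x y. x \<in> span B \<Longrightarrow> y \<in> span B \<Longrightarrow> trace_on B (\<lambda>z. bracket x (bracket y z)) = 0"
    and D: "Vector_Spaces.linear scale scale D" "\<And>u. u \<in> span B \<Longrightarrow> D u \<in> span B"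
      "\<And>u v. u \<in> span B \<Longrightarrow> v \<in> span B \<Longrightarrow> D (bracket u v) = bracket (D u) v + bracket u (D v)"
    and x: "x \<in> derived_algebra (span B)"
  shows "trace_on B (\<lambda>z. bracket x (D z)) = 0"
proof -
  have cl: "\<And>u v. u \<in> span B \<Longrightarrow> v \<in> span B \<Longrightarrow> bracket u v \<in> span B"
    using sub by (simp add: lie_subalgebra_def)
  note Bin = span_base[of _ B]
  have comm: "trace_on B (\<lambda>z. bracket (bracket u v) (D z)) = 0" if u: "u \<in> span B" and v: "v \<in> span B" for u v
  proof -
    have 1: "bracket (bracket u v) (D z) = bracket u (bracket v (D z)) - bracket v (bracket u (D z))" for z
      using bracket_derivation[of u v "D z"] by (simp add: algebra_simps)
    have lin: "Vector_Spaces.linear scale scale (\<lambda>z. bracket u (D z))"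
      using Vector_Spaces.linear_compose[OF D(1) linear_bracket] by (simp add: comp_def)
    have "trace_on B (\<lambda>z. bracket v (bracket u (D z))) = trace_on B (\<lambda>z. bracket u (D (bracket v z)))"
      using D(2) u v Bin
      by (intro trace_on_comm[OF B(2,1) B(2,1) linear_bracket _ lin]) (auto intro: cl)
    then have "trace_on B (\<lambda>z. bracket (bracket u v) (D z))
        = trace_on B (\<lambda>z. bracket u (bracket v (D z))) - trace_on B (\<lambda>z. bracket u (D (bracket v z)))"
      unfolding 1 using D(2) u v Bin by (subst trace_on_diff[OF B(2)]) (auto intro: cl)
    also have "\<dots> = trace_on B (\<lambda>z. bracket u (bracket v (D z)) - bracket u (D (bracket v z)))"
      using D(2) u v Bin by (subst trace_on_diff[OF B(2)]) (auto intro: cl)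
    also have "\<dots> = trace_on B (\<lambda>z. (- 1) *s bracket u (bracket (D v) z))"
      using D(3)[OF v Bin] by (intro trace_on_cong) (simp add: bracket_add_right)
    also have "\<dots> = - 1 * trace_on B (\<lambda>z. bracket u (bracket (D v) z))"
      using D(2) u v Bin by (intro trace_on_scale[OF B(2)]) (auto intro: cl)
    finally show ?thesis using kill[OF u D(2)[OF v]] by simp
  qed
  have "x \<in> span B \<and> trace_on B (\<lambda>z. bracket x (D z)) = 0"
    using x unfolding derived_algebra_def
  proof (induction rule: span_induct_alt)
    case base
    then show ?case using B(2) by (simp add: bracket_zero_left span_zero trace_on_def representation_zero)
  next
    case (step c w y)
    then obtain u v where w: "w = bracket u v" "u \<in> span B" "v \<in> span B" by blast
    have wB: "w \<in> span B" and w0: "trace_on B (\<lambda>z. bracket w (D z)) = 0"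
      using comm w cl by simp_all
    have "trace_on B (\<lambda>z. bracket (c *s w + y) (D z))
        = trace_on B (\<lambda>z. c *s bracket w (D z)) + trace_on B (\<lambda>z. bracket y (D z))"
      unfolding bracket_add_left bracket_scale_left
      using wB step(2) D(2) Bin by (intro trace_on_add[OF B(2)]) (auto intro: cl span_scale)
    also have "trace_on B (\<lambda>z. c *s bracket w (D z)) = c * trace_on B (\<lambda>z. bracket w (D z))"
      using wB D(2) Bin by (intro trace_on_scale[OF B(2)]) (auto intro: cl)
    finally show ?case
      using wB step(2) w0 by (simp add: span_add span_scale)
  qed
  then show ?thesis by simp
qed

lemma eigenflag_nilpotent:
  assumes T: "Vector_Spaces.linear scale scale T" and "eigenflag T ps" "\<forall>(e, a)\<in>set ps. a = 0"
    and "v \<in> span (fst ` set ps)"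
  shows "\<exists>n. (T ^^ n) v = 0"
  using assms(2-)
proof (induction ps arbitrary: v)
  case Nil
  then show ?case by (intro exI[of _ 0]) simp
next
  case (Cons p ps)
  interpret T: Vector_Spaces.linear scale scale T by fact
  obtain e where p: "p = (e, 0)" using Cons.prems(2) by (cases p) auto
  obtain c where c: "v - c *s e \<in> span (fst ` set ps)"
    using Cons.prems(3) by (auto simp: p span_insert)
  have flag: "eigenflag T ps" and Te: "T e \<in> span {e'. (e', 0) \<in> set ps}"
    using Cons.prems(1) by (auto simp: p)
  have "T v = T (v - c *s e) + c *s T e" by (simp add: T.diff T.scale)
  also have "\<dots> \<in> span (fst ` set ps)"
    using eigenflag_invariant[OF T flag c] subsetD[OF label_span_subset Te]
    by (intro span_add span_scale)
  finally obtain n where "(T ^^ n) (T v) = 0"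
    using Cons.IH[OF flag] Cons.prems(2) by auto
  then show ?case by (intro exI[of _ "Suc n"]) (simp add: funpow_swap1)
qed

end

locale alg_closed_lie_algebra = lie_algebra scale bracket
  for scale :: "'k::{alg_closed_field, field_char_0} \<Rightarrow> 'a::ab_group_add \<Rightarrow> 'a" (infixr \<open>*s\<close> 75)
    and bracket :: "'a \<Rightarrow> 'a \<Rightarrow> 'a"

sublocale alg_closed_lie_algebra \<subseteq> alg_closed_space scale
  by unfold_locales

context alg_closed_lie_algebra
begin

lemma killing_zero_locally_nilpotent:
  assumes B: "finite B" "independent B" and sub: "lie_subalgebra (span B)"
    and perf: "span B \<subseteq> derived_algebra (span B)"
    and kill: "\<And>x y. x \<in> span B \<Longrightarrow> y \<in> span B \<Longrightarrow> trace_on B (\<lambda>z. bracket x (bracket y z)) = 0"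
    and x: "x \<in> span B" and v: "v \<in> span B"
  shows "\<exists>n. (bracket x ^^ n) v = 0"
proof -
  have cl: "\<And>u v. u \<in> span B \<Longrightarrow> v \<in> span B \<Longrightarrow> bracket u v \<in> span B"
    using sub by (simp add: lie_subalgebra_def)
  obtain ps where flag: "eigenflag (bracket x) ps" and E: "span (fst ` set ps) = span B"
    using eigenflag_exists[OF linear_bracket B cl[OF x]] by blast
  have ind: "independent (fst ` set ps)" by (rule eigenflag_independent[OF flag])
  have "\<forall>(e, a)\<in>set ps. a = 0"
  proof (rule ccontr)
    assume "\<not> ?thesis"
    then obtain e0 a0 where a0: "(e0, a0) \<in> set ps" "a0 \<noteq> 0" by auto
    \<comment> \<open>Normalizing \<open>q\<close> at the offending label makes the eventual sum of
      squares at least 1.\<close>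
    obtain q :: "'k \<Rightarrow> rat" where q: "q a0 = 1" "\<And>x y. q (x + y) = q x + q y"
      "\<And>r x. q (of_rat r * x) = r * q x"
      using rational_functional_exists[OF a0(2)] by blast
    have "of_rat (q (a + b)) = of_rat (q a) + (of_rat (q b) :: 'k)" for a b
      by (simp add: q(2) of_rat_add)
    from eigenflag_derivation[OF flag, of "\<lambda>a. of_rat (q a)", OF _ this] obtain D
      where D: "Vector_Spaces.linear scale scale D" "\<And>e a. (e, a) \<in> set ps \<Longrightarrow> D e = of_rat (q a) *s e"
        "\<And>u. u \<in> span B \<Longrightarrow> D u \<in> span B"
        "\<And>u v. u \<in> span B \<Longrightarrow> v \<in> span B \<Longrightarrow> D (bracket u v) = bracket (D u) v + bracket u (D v)"
      using sub unfolding E by blast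
    have lin: "Vector_Spaces.linear scale scale (\<lambda>z. bracket x (D z))"
      using Vector_Spaces.linear_compose[OF D(1) linear_bracket] by (simp add: comp_def)
    have "trace_on B (\<lambda>z. bracket x (D z)) = 0"
      using trace_ad_derivation[OF B sub kill D(1,3,4)] perf x by blast
    moreover have "bracket x (D z) \<in> span B" if "z \<in> fst ` set ps" for z
      using that E span_base[of z "fst ` set ps"] by (intro cl x D(3)) simp
    then have "trace_on B (\<lambda>z. bracket x (D z)) = trace_on (fst ` set ps) (\<lambda>z. bracket x (D z))"
      by (intro trace_on_basis[OF B(2,1) ind _ E[symmetric] lin]) simp_all
    moreover have "\<dots> = (\<Sum>(e, a)\<leftarrow>ps. a * of_rat (q a))"
      by (rule trace_on_eigenflag[OF flag linear_bracket D(2)])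
    ultimately have "q (\<Sum>(e, a)\<leftarrow>ps. a * of_rat (q a)) = 0"
      using q(3)[of 0 0] by simp
    moreover have "q (\<Sum>(e, a)\<leftarrow>ps'. a * of_rat (q a)) = (\<Sum>(e, a)\<leftarrow>ps'. (q a)\<^sup>2)" for ps' :: "('a \<times> 'k) list"
    proof (induction ps')
      case Nil
      then show ?case using q(3)[of 0 0] by simp
    next
      case (Cons p ps')
      have "q (a * of_rat (q a)) = (q a)\<^sup>2" for a
        using q(3)[of "q a" a] by (simp add: mult.commute power2_eq_square)
      with Cons show ?case by (simp add: q(2) split: prod.splits)
    qed
    ultimately have "(\<Sum>(e, a)\<leftarrow>ps. (q a)\<^sup>2) = 0" by simp
    moreover have "(\<Sum>(e, a)\<leftarrow>ps. (q a)\<^sup>2) \<ge> (q a0)\<^sup>2"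
      using a0(1) by (intro member_le_sum_list) (auto intro: image_eqI[of _ _ "(e0, a0)"])
    ultimately show False using q(1) by simp
  qed
  then show ?thesis
    using eigenflag_nilpotent[OF linear_bracket flag] v E by blast
qed

lemma killing_zero_not_perfect:
  assumes B: "finite B" "independent B" and sub: "lie_subalgebra (span B)"
    and kill: "\<And>x y. x \<in> span B \<Longrightarrow> y \<in> span B \<Longrightarrow> trace_on B (\<lambda>z. bracket x (bracket y z)) = 0"
    and perf: "span B \<subseteq> derived_algebra (span B)"
  shows "span B = {0}"
proof (rule ccontr)
  assume "span B \<noteq> {0}"
  from engel_not_perfect[OF B(1) order.refl sub this killing_zero_locally_nilpotent[OF B sub perf kill]] perf
  show False by blast
qed

end

section \<open>Extension of scalars to the algebraic closure\<close>

locale lie_algebra_char_0 = lie_algebra scale bracket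
  for scale :: "'k::field_char_0 \<Rightarrow> 'a::ab_group_add \<Rightarrow> 'a" (infixr \<open>*s\<close> 75)
    and bracket :: "'a \<Rightarrow> 'a \<Rightarrow> 'a"

text \<open>
  Extension of scalars: a vector is the function of its coordinates with respect to \<open>B\<close>, and \<open>c\<close> holds
  the structure constants. Coordinates outside \<open>B\<close> are ignored by the bracket, which makes the whole
  function type a Lie algebra.
\<close>

definition ext_scale :: "'c::field \<Rightarrow> ('a \<Rightarrow> 'c) \<Rightarrow> 'a \<Rightarrow> 'c" where
  "ext_scale c f = (\<lambda>x. c * f x)"

definition ext_bracket :: "'a set \<Rightarrow> ('a \<Rightarrow> 'a \<Rightarrow> 'a \<Rightarrow> 'c::field) \<Rightarrow> ('a \<Rightarrow> 'c) \<Rightarrow> ('a \<Rightarrow> 'c) \<Rightarrow> 'a \<Rightarrow> 'c" where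
  "ext_bracket B c f g = (\<lambda>d. \<Sum>a\<in>B. \<Sum>b\<in>B. f a * g b * c a b d)"

lemma vector_space_ext_scale: "vector_space (ext_scale :: 'c::field \<Rightarrow> ('a \<Rightarrow> 'c) \<Rightarrow> 'a \<Rightarrow> 'c)"
  by unfold_locales (auto simp: ext_scale_def fun_eq_iff algebra_simps)

text \<open>The three argument coefficients are moved in front of the sum over \<open>m\<close>.
  What remains inside is a coordinate of a double bracket of basis vectors, so both Jacobi and the
  Killing form reduce to the basis.\<close>

lemma ext_bracket_nested:
  "ext_bracket B c f (ext_bracket B c g h) d
    = (\<Sum>a\<in>B. \<Sum>b\<in>B. \<Sum>e\<in>B. f a * g b * h e * (\<Sum>m\<in>B. c b e m * c a m d))"
proof -
  have "(\<Sum>m\<in>B. f a * (\<Sum>b\<in>B. \<Sum>e\<in>B. g b * h e * c b e m) * c a m d)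
      = (\<Sum>b\<in>B. \<Sum>e\<in>B. f a * g b * h e * (\<Sum>m\<in>B. c b e m * c a m d))" for a
  proof -
    have "(\<Sum>m\<in>B. f a * (\<Sum>b\<in>B. \<Sum>e\<in>B. g b * h e * c b e m) * c a m d)
      = (\<Sum>m\<in>B. \<Sum>b\<in>B. \<Sum>e\<in>B. f a * g b * h e * (c b e m * c a m d))"
      by (simp add: sum_distrib_left sum_distrib_right mult.assoc)
    also have "\<dots> = (\<Sum>b\<in>B. \<Sum>m\<in>B. \<Sum>e\<in>B. f a * g b * h e * (c b e m * c a m d))"
      by (rule sum.swap)
    also have "\<dots> = (\<Sum>b\<in>B. \<Sum>e\<in>B. \<Sum>m\<in>B. f a * g b * h e * (c b e m * c a m d))"
      by (intro sum.cong refl sum.swap)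
    finally show ?thesis by (simp add: sum_distrib_left)
  qed
  then show ?thesis by (simp add: ext_bracket_def)
qed

definition unit_fun :: "'a \<Rightarrow> 'a \<Rightarrow> 'c::field" where
  "unit_fun b = (\<lambda>x. if x = b then 1 else 0)"

lemma unit_fun_expansion:
  assumes "finite B" "\<And>x. x \<notin> B \<Longrightarrow> f x = 0"
  shows "f = (\<Sum>b\<in>B. ext_scale (f b) (unit_fun b))"
proof
  fix x
  have "(\<Sum>b\<in>B. ext_scale (f b) (unit_fun b)) x = (\<Sum>b\<in>B. ext_scale (f b) (unit_fun b) x)"
    by (induction B rule: infinite_finite_induct) simp_all
  also have "\<dots> = (\<Sum>b\<in>B. if x = b then f b else 0)"
    by (intro sum.cong) (auto simp: ext_scale_def unit_fun_def)
  also have "\<dots> = f x" using assms by simp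
  finally show "f x = (\<Sum>b\<in>B. ext_scale (f b) (unit_fun b)) x" by simp
qed

context lie_algebra_char_0
begin

context
  fixes B :: "'a set"
  assumes B: "finite B" "independent B" and sub: "lie_subalgebra (span B)"
begin

abbreviation structure_const :: "'a \<Rightarrow> 'a \<Rightarrow> 'a \<Rightarrow> 'k alg_closure" where
  "structure_const a b d \<equiv> to_ac (representation B (bracket a b) d)"

abbreviation coord :: "'a \<Rightarrow> 'a \<Rightarrow> 'k alg_closure" where
  "coord u \<equiv> (\<lambda>d. to_ac (representation B u d))"

lemma bracket_in_span: "u \<in> span B \<Longrightarrow> v \<in> span B \<Longrightarrow> bracket u v \<in> span B"
  using sub by (simp add: lie_subalgebra_def)

lemma representation_linear:
  assumes T: "Vector_Spaces.linear scale scale T" and "\<And>b. b \<in> B \<Longrightarrow> T b \<in> span B" and u: "u \<in> span B"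
  shows "representation B (T u) d = (\<Sum>m\<in>B. representation B u m * representation B (T m) d)"
proof -
  interpret T: Vector_Spaces.linear scale scale T by fact
  have "u = (\<Sum>m\<in>B. representation B u m *s m)"
    using sum_representation_eq[OF B(2) u B(1) order.refl] by simp
  then have "T u = (\<Sum>m\<in>B. representation B u m *s T m)"
    by (metis (no_types, lifting) T.sum T.scale sum.cong)
  then show ?thesis
    using assms(2) by (simp add: representation_sum[OF B(2)] representation_scale[OF B(2)] span_scale)
qed

lemma coord_bracket:
  assumes "u \<in> span B" "v \<in> span B"
  shows "coord (bracket u v) = ext_bracket B structure_const (coord u) (coord v)"
proof
  fix d
  have "representation B (bracket u v) d = (\<Sum>a\<in>B. representation B u a * representation B (bracket a v) d)"
    using assms
    by (intro representation_linear[OF linear_bracket_left]) (simp_all add: bracket_in_span span_base)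
  also have "\<dots> = (\<Sum>a\<in>B. representation B u a * (\<Sum>b\<in>B. representation B v b * representation B (bracket a b) d))"
    using assms
    by (intro sum.cong refl arg_cong2[where f = "(*)"] representation_linear[OF linear_bracket])
       (simp_all add: bracket_in_span span_base)
  finally show "coord (bracket u v) d = ext_bracket B structure_const (coord u) (coord v) d"
    by (simp add: ext_bracket_def to_ac_sum sum_distrib_left mult.assoc)
qed

lemma structure_const_nested:
  assumes "a \<in> B" "b \<in> B" "e \<in> B"
  shows "(\<Sum>m\<in>B. structure_const b e m * structure_const a m d) = coord (bracket a (bracket b e)) d"
  using assms representation_linear[OF linear_bracket, of a "bracket b e" d]
  by (simp add: bracket_in_span span_base to_ac_sum)

text \<open>The bracket is multilinear in the coordinates indexed by \<open>B\<close>, so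
  alternation and the Jacobi identity follow from the corresponding identities among basis vectors
  of the original algebra.\<close>

lemma ext_lie_algebra:
  "alg_closed_lie_algebra (ext_scale :: 'k alg_closure \<Rightarrow> _) (ext_bracket B structure_const)"
proof -
  interpret ext: vector_space "ext_scale :: 'k alg_closure \<Rightarrow> ('a \<Rightarrow> _) \<Rightarrow> _"
    by (rule vector_space_ext_scale)
  let ?br = "ext_bracket B structure_const"
  have nested: "?br f (?br g h) d
      = (\<Sum>a\<in>B. \<Sum>b\<in>B. \<Sum>e\<in>B. f a * g b * h e * coord (bracket a (bracket b e)) d)" for f g h d
    unfolding ext_bracket_nested by (intro sum.cong refl) (simp only: structure_const_nested)
  show ?thesis
  proof unfold_locales
    fix f g h :: "'a \<Rightarrow> 'k alg_closure" and c
    show "?br (f + g) h = ?br f h + ?br g h" "?br f (g + h) = ?br f g + ?br f h"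
      by (auto simp: fun_eq_iff ext_bracket_def sum.distrib algebra_simps)
    show "?br (ext_scale c f) g = ext_scale c (?br f g)" "?br f (ext_scale c g) = ext_scale c (?br f g)"
      by (auto simp: fun_eq_iff ext_bracket_def ext_scale_def sum_distrib_left mult_ac)
    show "?br f f = 0"
    proof
      fix d
      have anti: "f a * f b * structure_const a b d = - (f b * f a * structure_const b a d)"
        if "a \<in> B" "b \<in> B" for a b
      proof -
        have "representation B (bracket b a) d = - representation B (bracket a b) d"
          using that unfolding bracket_swap[of b a]
          by (subst representation_neg[OF B(2)]) (auto intro: bracket_in_span span_base)
        then show ?thesis by (simp only: to_ac_minus) (simp add: mult.commute)
      qed
      have "?br f f d = (\<Sum>b\<in>B. \<Sum>a\<in>B. f a * f b * structure_const a b d)"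
        unfolding ext_bracket_def by (rule sum.swap)
      also have "\<dots> = (\<Sum>b\<in>B. \<Sum>a\<in>B. - (f b * f a * structure_const b a d))"
        by (intro sum.cong refl anti)
      also have "\<dots> = - ?br f f d"
        by (simp add: ext_bracket_def sum_negf)
      \<comment> \<open>Exchanging the summation indices yields only antisymmetry; characteristic
        zero turns it into the alternating law.\<close>
      finally have "2 * ?br f f d = 0" by (metis add.right_inverse mult_2)
      then show "?br f f d = 0 d" by simp
    qed
    show "?br f (?br g h) + ?br g (?br h f) + ?br h (?br f g) = 0"
    proof
      fix d
      \<comment> \<open>The three cyclic terms are re-indexed so that they share this monomial; its
        coefficient is then the Jacobi identity for \<open>a\<close>, \<open>b\<close>,
        \<open>e\<close>.\<close>
      let ?F = "\<lambda>a b e. f a * g b * h e"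
      have 1: "?br g (?br h f) d = (\<Sum>a\<in>B. \<Sum>b\<in>B. \<Sum>e\<in>B. ?F a b e * coord (bracket b (bracket e a)) d)"
      proof -
        have "?br g (?br h f) d = (\<Sum>b\<in>B. \<Sum>e\<in>B. \<Sum>a\<in>B. ?F a b e * coord (bracket b (bracket e a)) d)"
          unfolding nested by (simp only: mult_ac)
        also have "\<dots> = (\<Sum>b\<in>B. \<Sum>a\<in>B. \<Sum>e\<in>B. ?F a b e * coord (bracket b (bracket e a)) d)"
          by (intro sum.cong refl sum.swap)
        finally show ?thesis by (subst sum.swap)
      qed
      have 2: "?br h (?br f g) d = (\<Sum>a\<in>B. \<Sum>b\<in>B. \<Sum>e\<in>B. ?F a b e * coord (bracket e (bracket a b)) d)"
      proof -
        have "?br h (?br f g) d = (\<Sum>e\<in>B. \<Sum>a\<in>B. \<Sum>b\<in>B. ?F a b e * coord (bracket e (bracket a b)) d)"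
          unfolding nested by (simp only: mult_ac)
        also have "\<dots> = (\<Sum>a\<in>B. \<Sum>e\<in>B. \<Sum>b\<in>B. ?F a b e * coord (bracket e (bracket a b)) d)"
          by (rule sum.swap)
        also have "\<dots> = (\<Sum>a\<in>B. \<Sum>b\<in>B. \<Sum>e\<in>B. ?F a b e * coord (bracket e (bracket a b)) d)"
          by (intro sum.cong refl sum.swap)
        finally show ?thesis .
      qed
      have jac: "coord (bracket a (bracket b e)) d + coord (bracket b (bracket e a)) d
          + coord (bracket e (bracket a b)) d = 0" if "a \<in> B" "b \<in> B" "e \<in> B" for a b e
      proof -
        have "representation B (bracket a (bracket b e) + bracket b (bracket e a) + bracket e (bracket a b)) d
            = representation B (bracket a (bracket b e)) d + representation B (bracket b (bracket e a)) d
              + representation B (bracket e (bracket a b)) d"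
          using that by (simp add: representation_add[OF B(2)] bracket_in_span span_base span_add)
        then show ?thesis
          unfolding jacobi representation_zero by (metis to_ac_0 to_ac_add)
      qed
      have "?br f (?br g h) d + ?br g (?br h f) d + ?br h (?br f g) d
          = (\<Sum>a\<in>B. \<Sum>b\<in>B. \<Sum>e\<in>B. ?F a b e * (coord (bracket a (bracket b e)) d
              + coord (bracket b (bracket e a)) d + coord (bracket e (bracket a b)) d))"
        unfolding 1 2 nested[of f g h] sum.distrib[symmetric] distrib_left[symmetric] ..
      also have "\<dots> = 0" by (intro sum.neutral ballI) (simp only: jac mult_zero_right)
      finally show "(?br f (?br g h) + ?br g (?br h f) + ?br h (?br f g)) d = 0 d" by simp
    qed
  qed
qed

text \<open>Both hypotheses survive the extension: the trace form is determined by its values on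
  \<open>B\<close>, and \<open>coord\<close> carries brackets to brackets, hence the derived algebra
  into the derived algebra. The extended algebra has the unit functions as a basis, so if it is zero
  then \<open>B\<close> is empty.\<close>

lemma killing_zero_perfect_trivial:
  assumes kill: "\<And>x y. x \<in> span B \<Longrightarrow> y \<in> span B \<Longrightarrow> trace_on B (\<lambda>z. bracket x (bracket y z)) = 0"
    and perf: "span B \<subseteq> derived_algebra (span B)"
  shows "span B = {0}"
proof -
  interpret X: alg_closed_lie_algebra "ext_scale :: 'k alg_closure \<Rightarrow> _" "ext_bracket B structure_const"
    by (rule ext_lie_algebra)
  let ?br = "ext_bracket B structure_const"
  let ?u = "unit_fun :: 'a \<Rightarrow> 'a \<Rightarrow> 'k alg_closure"
  \<comment> \<open>The function type also contains vectors with coordinates outside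
    \<open>B\<close>; \<open>supp\<close> is the actual scalar extension of
    \<open>span B\<close>.\<close>
  define supp where "supp = {f :: 'a \<Rightarrow> 'k alg_closure. \<forall>x. x \<notin> B \<longrightarrow> f x = 0}"
  have inj: "inj_on ?u B"
    by (rule inj_onI) (metis unit_fun_def zero_neq_one)
  have subspace_supp: "X.subspace supp"
    by (auto simp: X.subspace_def supp_def ext_scale_def)
  have in_span: "f \<in> X.span (?u ` B)" if "f \<in> supp" for f
  proof -
    have "f = (\<Sum>b\<in>B. ext_scale (f b) (?u b))"
      using that by (intro unit_fun_expansion B(1)) (simp add: supp_def)
    also have "\<dots> \<in> X.span (?u ` B)"
      by (intro X.span_sum X.span_scale X.span_base) simp
    finally show ?thesis .
  qed
  have "?u ` B \<subseteq> supp" by (auto simp: supp_def unit_fun_def)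
  then have span_u: "X.span (?u ` B) = supp"
    using X.span_minimal[OF _ subspace_supp] in_span by blast
  have ind: "X.independent (?u ` B)"
  proof (rule X.independent_if_scalars_zero)
    show "finite (?u ` B)" using B(1) by simp
    fix k w assume sum0: "(\<Sum>x\<in>?u ` B. ext_scale (k x) x) = 0" and w: "w \<in> ?u ` B"
    then obtain b where b: "b \<in> B" "w = ?u b" by blast
    define g where "g = (\<lambda>x. if x \<in> B then k (?u x) else 0)"
    have "g = (\<Sum>b\<in>B. ext_scale (g b) (?u b))"
      by (intro unit_fun_expansion B(1)) (simp add: g_def)
    also have "\<dots> = (\<Sum>x\<in>?u ` B. ext_scale (k x) x)"
      by (simp add: sum.reindex[OF inj] g_def)
    finally have "g = 0" using sum0 by simp
    then have "g b = 0" by simp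
    then show "k w = 0" using b by (simp add: g_def)
  qed
  have rep: "X.representation (?u ` B) f (?u b) = f b" if f: "f \<in> supp" and b: "b \<in> B" for f b
  proof -
    have "f = (\<Sum>b\<in>B. ext_scale (f b) (?u b))"
      using f by (intro unit_fun_expansion B(1)) (simp add: supp_def)
    then have "X.representation (?u ` B) f (?u b)
        = X.representation (?u ` B) (\<Sum>b\<in>B. ext_scale (f b) (?u b)) (?u b)" by simp
    also have "\<dots> = (\<Sum>b'\<in>B. f b' * X.representation (?u ` B) (?u b') (?u b))"
      by (simp add: X.representation_sum[OF ind] X.representation_scale[OF ind] X.span_scale X.span_base)
    also have "\<dots> = (\<Sum>b'\<in>B. if b = b' then f b' else 0)"
      using inj_onD[OF inj _ b] by (intro sum.cong refl) (auto simp: X.representation_basis[OF ind])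
    also have "\<dots> = f b" using B(1) b by simp
    finally show ?thesis .
  qed
  have br_supp: "?br f g \<in> supp" for f g
  proof -
    have "representation B (bracket a b) d = 0" if "d \<notin> B" for a b d
      using that representation_ne_zero[of B "bracket a b" d] by auto
    then show ?thesis by (simp add: supp_def ext_bracket_def)
  qed
  have coord_unit: "coord b = ?u b" if "b \<in> B" for b
    using that by (auto simp: fun_eq_iff unit_fun_def representation_basis[OF B(2)])
  have kill_X: "X.trace_on (?u ` B) (\<lambda>z. ?br f (?br g z)) = 0" for f g
  proof -
    have nested: "?br f (?br g (?u z)) z
        = (\<Sum>a\<in>B. \<Sum>b\<in>B. f a * g b * coord (bracket a (bracket b z)) z)" if z: "z \<in> B" for z
    proof -
      have "?br f (?br g (?u z)) z
          = (\<Sum>a\<in>B. \<Sum>b\<in>B. \<Sum>e\<in>B. f a * g b * ?u z e * coord (bracket a (bracket b e)) z)"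
        unfolding ext_bracket_nested by (intro sum.cong refl) (simp only: structure_const_nested)
      also have "\<dots> = (\<Sum>a\<in>B. \<Sum>b\<in>B. \<Sum>e\<in>B. if z = e then f a * g b * coord (bracket a (bracket b e)) z else 0)"
        by (intro sum.cong refl) (simp add: unit_fun_def)
      finally show ?thesis using B(1) z by simp
    qed
    have "X.trace_on (?u ` B) (\<lambda>z. ?br f (?br g z)) = (\<Sum>z\<in>B. ?br f (?br g (?u z)) z)"
      unfolding X.trace_on_def sum.reindex[OF inj] comp_def
      by (intro sum.cong refl rep br_supp)
    also have "\<dots> = (\<Sum>z\<in>B. \<Sum>a\<in>B. \<Sum>b\<in>B. f a * g b * coord (bracket a (bracket b z)) z)"
      by (intro sum.cong refl nested)
    also have "\<dots> = (\<Sum>a\<in>B. \<Sum>z\<in>B. \<Sum>b\<in>B. f a * g b * coord (bracket a (bracket b z)) z)"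
      by (rule sum.swap)
    also have "\<dots> = (\<Sum>a\<in>B. \<Sum>b\<in>B. \<Sum>z\<in>B. f a * g b * coord (bracket a (bracket b z)) z)"
      by (intro sum.cong refl sum.swap)
    also have "\<dots> = (\<Sum>a\<in>B. \<Sum>b\<in>B. f a * g b * to_ac (trace_on B (\<lambda>z. bracket a (bracket b z))))"
      by (simp add: trace_on_def to_ac_sum sum_distrib_left)
    also have "\<dots> = 0" by (simp add: kill span_base)
    finally show ?thesis .
  qed
  have coord_derived: "u \<in> span B \<and> coord u \<in> X.derived_algebra supp" if "u \<in> derived_algebra (span B)" for u
    using that unfolding derived_algebra_def
  proof (induction rule: span_induct_alt)
    case base
    then show ?case
      by (simp add: span_zero representation_zero X.derived_algebra_def X.span_zero flip: zero_fun_def)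
  next
    case (step c w y)
    then obtain u v where w: "w = bracket u v" "u \<in> span B" "v \<in> span B" by blast
    have wB: "w \<in> span B" using w bracket_in_span by blast
    have coord_supp: "coord u \<in> supp" for u
      using representation_ne_zero[of B u] by (auto simp: supp_def)
    have "coord w \<in> X.derived_algebra supp"
      unfolding w(1) coord_bracket[OF w(2,3)] X.derived_algebra_def
      using coord_supp by (intro X.span_base) blast
    moreover have "coord (c *s w + y) = ext_scale (to_ac c) (coord w) + coord y"
      using wB step(2)
      by (auto simp: fun_eq_iff representation_add[OF B(2)] representation_scale[OF B(2)] span_scale ext_scale_def)
    ultimately show ?case
      using wB step(2) unfolding X.derived_algebra_def
      by (metis (no_types, lifting) X.span_add X.span_scale span_add span_scale)
  qed
  have "X.span (?u ` B) = {0}"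
  proof (rule X.killing_zero_not_perfect)
    show "X.lie_subalgebra (X.span (?u ` B))"
      unfolding span_u X.lie_subalgebra_def using subspace_supp br_supp by blast
    have "?u ` B \<subseteq> X.derived_algebra supp"
    proof
      fix f assume "f \<in> ?u ` B"
      then obtain b where "b \<in> B" "f = ?u b" by blast
      then show "f \<in> X.derived_algebra supp"
        using coord_derived[of b] coord_unit[of b] perf span_base[of b B] by auto
    qed
    then show "X.span (?u ` B) \<subseteq> X.derived_algebra (X.span (?u ` B))"
      unfolding span_u[symmetric]
      by (rule X.span_minimal) (simp add: X.derived_algebra_def)
  qed (use B ind kill_X in auto)
  then have "?u b = 0" if "b \<in> B" for b
    using that X.span_base[of "?u b" "?u ` B"] by auto
  then have "B = {}"
    by (metis (no_types, lifting) all_not_in_conv unit_fun_def zero_fun_apply zero_neq_one)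
  then show ?thesis by simp
qed

end

end

section \<open>Ideals of semisimple Lie algebras\<close>

context lie_algebra
begin

lemma lie_ideal_subspace: "lie_ideal M I \<Longrightarrow> subspace I"
  and lie_ideal_subset: "lie_ideal M I \<Longrightarrow> I \<subseteq> M"
  and lie_ideal_bracket: "lie_ideal M I \<Longrightarrow> x \<in> M \<Longrightarrow> y \<in> I \<Longrightarrow> bracket x y \<in> I"
  by (auto simp: lie_ideal_def)

lemma lie_ideal_bracket': "lie_ideal M I \<Longrightarrow> x \<in> I \<Longrightarrow> y \<in> M \<Longrightarrow> bracket x y \<in> I"
  using bracket_swap[of x y] by (metis lie_ideal_bracket lie_ideal_subspace subspace_neg)

lemma lie_ideal_subalgebra: "lie_ideal M I \<Longrightarrow> lie_subalgebra I"
  by (auto simp: lie_ideal_def lie_subalgebra_def)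

lemma derived_algebra_subset: "lie_subalgebra M \<Longrightarrow> derived_algebra M \<subseteq> M"
  unfolding derived_algebra_def lie_subalgebra_def by (intro span_minimal) auto

lemma lie_ideal_derived:
  assumes "lie_ideal M I"
  shows "lie_ideal M (derived_algebra I)"
proof -
  have "bracket m y \<in> derived_algebra I" if "m \<in> M" "y \<in> derived_algebra I" for m y
    using that(2) unfolding derived_algebra_def
  proof (induction rule: span_induct_alt)
    case base
    then show ?case by (simp add: bracket_zero_right span_zero)
  next
    case (step c w y)
    then obtain u v where w: "w = bracket u v" and u: "u \<in> I" and v: "v \<in> I" by blast
    have "bracket m w = bracket (bracket m u) v + bracket u (bracket m v)"
      unfolding w by (rule bracket_derivation)
    also have "\<dots> \<in> span {bracket x y |x y. x \<in> I \<and> y \<in> I}"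
      using lie_ideal_bracket[OF assms that(1) u] lie_ideal_bracket[OF assms that(1) v] u v
      by (intro span_add span_base) blast+
    finally show ?case
      using step(2) by (simp add: bracket_add_right bracket_scale_right span_add span_scale)
  qed
  then show ?thesis
    using derived_algebra_subset[OF lie_ideal_subalgebra[OF assms]] lie_ideal_subset[OF assms]
    by (auto simp: lie_ideal_def derived_algebra_def)
qed

section \<open>The Killing form and orthogonal ideals\<close>

definition killing :: "'a set \<Rightarrow> 'a \<Rightarrow> 'a \<Rightarrow> 'k" where
  "killing B x y = trace_on B (\<lambda>z. bracket x (bracket y z))"

context
  fixes B :: "'a set"
  assumes B: "finite B" "independent B" and sub: "lie_subalgebra (span B)"
begin

lemma bracket_span: "u \<in> span B \<Longrightarrow> v \<in> span B \<Longrightarrow> bracket u v \<in> span B"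
  using sub by (simp add: lie_subalgebra_def)

lemma killing_sym:
  assumes "x \<in> span B" "y \<in> span B"
  shows "killing B x y = killing B y x"
  unfolding killing_def
  using assms
  by (intro trace_on_comm[OF B(2,1) B(2,1) linear_bracket _ linear_bracket])
     (auto intro: bracket_span span_base)

lemma killing_add_left:
  assumes "x \<in> span B" "x' \<in> span B" "y \<in> span B"
  shows "killing B (x + x') y = killing B x y + killing B x' y"
  unfolding killing_def bracket_add_left
  using assms by (intro trace_on_add[OF B(2)]) (auto intro: bracket_span span_base)

lemma killing_scale_left:
  assumes "x \<in> span B" "y \<in> span B"
  shows "killing B (c *s x) y = c * killing B x y"
  unfolding killing_def bracket_scale_left
  using assms by (intro trace_on_scale[OF B(2)]) (auto intro: bracket_span span_base)

lemma killing_zero_left: "killing B 0 y = 0"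
  using B(2) by (simp add: killing_def bracket_zero_left trace_on_def representation_zero)

lemma killing_diff_left:
  assumes "x \<in> span B" "x' \<in> span B" "y \<in> span B"
  shows "killing B (x - x') y = killing B x y - killing B x' y"
  using killing_add_left[of "x - x'" x' y] assms by (simp add: span_diff)

text \<open>Write ad [x, y] as a commutator and move ad y cyclically around the trace.\<close>

lemma killing_invariant:
  assumes x: "x \<in> span B" and y: "y \<in> span B" and z: "z \<in> span B"
  shows "killing B (bracket x y) z = killing B x (bracket y z)"
proof -
  have 1: "bracket (bracket u v) w = bracket u (bracket v w) - bracket v (bracket u w)" for u v w
    using bracket_derivation[of u v w] by (simp add: algebra_simps)
  have cyc: "trace_on B (\<lambda>w. bracket y (bracket x (bracket z w)))
      = trace_on B (\<lambda>w. bracket x (bracket z (bracket y w)))"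
    using Vector_Spaces.linear_compose[OF linear_bracket linear_bracket, of x z] x y z
    by (intro trace_on_comm[OF B(2,1) B(2,1) linear_bracket])
       (auto simp: comp_def intro: bracket_span span_base)
  have "killing B (bracket x y) z = trace_on B (\<lambda>w. bracket x (bracket y (bracket z w)))
      - trace_on B (\<lambda>w. bracket y (bracket x (bracket z w)))"
    unfolding killing_def 1
    using x y z by (intro trace_on_diff[OF B(2)]) (auto intro: bracket_span span_base)
  also have "\<dots> = trace_on B (\<lambda>w. bracket x (bracket y (bracket z w)) - bracket x (bracket z (bracket y w)))"
    unfolding cyc
    using x y z by (intro trace_on_diff[OF B(2), symmetric]) (auto intro: bracket_span span_base)
  also have "\<dots> = killing B x (bracket y z)"
    unfolding killing_def by (intro trace_on_cong) (simp add: 1 bracket_diff_right)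
  finally show ?thesis .
qed

text \<open>Complete a basis of the ideal to one of the whole algebra. Since ad x ad y maps
  everything into the ideal, the added vectors contribute no diagonal entries. Applying Cartan's
  criterion to an ideal depends on this.\<close>

lemma killing_ideal:
  assumes I: "lie_ideal (span B) (span C)" and C: "finite C" "independent C"
    and x: "x \<in> span C" and y: "y \<in> span C"
  shows "killing C x y = killing B x y"
proof -
  have sub': "span C \<subseteq> span B" by (rule lie_ideal_subset[OF I])
  have "C \<subseteq> span B" using sub' span_superset[of C] by simp
  then obtain B' where B': "C \<subseteq> B'" "B' \<subseteq> span B" "independent B'" "span B \<subseteq> span B'"
    using maximal_independent_subset_extend[of C "span B"] C(2) by blast
  have finB': "finite B'" using independent_span_bound[OF B(1) B'(3,2)] by simp
  have eq: "span B = span B'"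
    using B'(4) span_minimal[OF B'(2) subspace_span] by blast
  have lin: "Vector_Spaces.linear scale scale (\<lambda>z. bracket x (bracket y z))"
    using Vector_Spaces.linear_compose[OF linear_bracket linear_bracket, of x y] by (simp add: comp_def)
  have "x \<in> span B" "y \<in> span B" using x y sub' by auto
  have "killing B x y = trace_on B' (\<lambda>z. bracket x (bracket y z))"
    unfolding killing_def
  proof (rule trace_on_basis[OF B(2,1) B'(3) finB' eq lin])
    show "bracket x (bracket y z) \<in> span B" if "z \<in> B'" for z
      using that B'(2) \<open>x \<in> span B\<close> \<open>y \<in> span B\<close> by (intro bracket_span) auto
  qed
  also have "\<dots> = (\<Sum>b\<in>C. representation B' (bracket x (bracket y b)) b)"
    unfolding trace_on_def
  proof (rule sum.mono_neutral_right[OF finB' B'(1)], rule ballI)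
    fix b assume b: "b \<in> B' - C"
    have "b \<in> span B" using b B'(2) by blast
    then have "bracket y b \<in> span C" by (rule lie_ideal_bracket'[OF I y])
    then have "bracket x (bracket y b) \<in> span C"
      using lie_ideal_bracket[OF I \<open>x \<in> span B\<close>] by blast
    then have "representation B' (bracket x (bracket y b)) b = representation C (bracket x (bracket y b)) b"
      by (simp add: representation_extend[OF B'(3) _ B'(1)])
    also have "\<dots> = 0" using b representation_ne_zero[of C _ b] by blast
    finally show "representation B' (bracket x (bracket y b)) b = 0" .
  qed
  also have "\<dots> = killing C x y"
    unfolding killing_def trace_on_def
  proof (intro sum.cong refl)
    fix b assume "b \<in> C"
    then have "bracket y b \<in> span C"
      using span_base[of b C] lie_ideal_bracket[OF I \<open>y \<in> span B\<close>] by blast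
    then have "bracket x (bracket y b) \<in> span C"
      using lie_ideal_bracket[OF I \<open>x \<in> span B\<close>] by blast
    then show "representation B' (bracket x (bracket y b)) b = representation C (bracket x (bracket y b)) b"
      by (simp add: representation_extend[OF B'(3) _ B'(1)])
  qed
  finally show ?thesis ..
qed

lemma lie_ideal_killing_orthogonal:
  assumes I: "lie_ideal (span B) I"
  shows "lie_ideal (span B) {x \<in> span B. \<forall>y\<in>I. killing B x y = 0}"
proof -
  have IB: "y \<in> span B" if "y \<in> I" for y using lie_ideal_subset[OF I] that by blast
  have "subspace {x \<in> span B. \<forall>y\<in>I. killing B x y = 0}"
    unfolding subspace_def
    by (auto simp: span_zero killing_zero_left killing_add_left killing_scale_left IB intro: span_add span_scale)
  moreover have "killing B (bracket m x) y = 0"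
    if m: "m \<in> span B" and x: "x \<in> span B" "\<forall>y\<in>I. killing B x y = 0" and y: "y \<in> I" for m x y
  proof -
    have "killing B (bracket m x) y = killing B ((- 1) *s bracket x m) y"
      using bracket_swap[of m x] by simp
    also have "\<dots> = - killing B (bracket x m) y"
      using m x IB[OF y] by (subst killing_scale_left) (auto intro: bracket_span)
    also have "\<dots> = - killing B x (bracket m y)"
      using killing_invariant m x IB[OF y] by simp
    also have "\<dots> = 0" using x(2) lie_ideal_bracket[OF I m y] by simp
    finally show ?thesis .
  qed
  ultimately show ?thesis
    unfolding lie_ideal_def by (auto intro: bracket_span)
qed

text \<open>
  On \<open>I\<close> the Killing form is represented by the injective, hence surjective, endomorphism
  \<open>x \<mapsto> \<Sum>c\<in>C. killing B x c *s c\<close>.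
\<close>

lemma killing_orthogonal_complement:
  assumes I: "lie_ideal (span B) I"
    and nondeg: "I \<inter> {x \<in> span B. \<forall>y\<in>I. killing B x y = 0} = {0}"
    and m: "m \<in> span B"
  shows "\<exists>i\<in>I. \<forall>y\<in>I. killing B (m - i) y = 0"
proof -
  interpret vp: vector_space_pair scale scale by unfold_locales
  have IB: "y \<in> span B" if "y \<in> I" for y using lie_ideal_subset[OF I] that by blast
  obtain C where C: "finite C" "independent C" "span C = I"
    using obtain_basis[OF lie_ideal_subspace[OF I] lie_ideal_subset[OF I] B(1)] by blast
  have CI: "c \<in> I" if "c \<in> C" for c using span_base[OF that] C(3) by simp
  define G where "G = vp.construct C (\<lambda>x. \<Sum>c\<in>C. killing B x c *s c)"
  have lin: "Vector_Spaces.linear scale scale G"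
    unfolding G_def by (rule vp.linear_construct[OF C(2)])
  interpret G: Vector_Spaces.linear scale scale G by (rule lin)
  have G: "x \<in> span B \<and> G x = (\<Sum>c\<in>C. killing B x c *s c)" if "x \<in> span C" for x
    using that
  proof (induction rule: span_induct_alt)
    case base
    then show ?case by (simp add: G.zero killing_zero_left span_zero)
  next
    case (step k x y)
    have xB: "x \<in> span B" using IB CI step(1) by blast
    have "killing B (k *s x + y) c = k * killing B x c + killing B y c" if "c \<in> C" for c
      using step xB IB[OF CI[OF that]] by (simp add: killing_add_left killing_scale_left span_scale)
    then have "(\<Sum>c\<in>C. killing B (k *s x + y) c *s c)
        = k *s (\<Sum>c\<in>C. killing B x c *s c) + (\<Sum>c\<in>C. killing B y c *s c)"
      by (simp add: scale_left_distrib sum.distrib scale_sum_right)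
    moreover have "G x = (\<Sum>c\<in>C. killing B x c *s c)"
      unfolding G_def using step(1) by (rule vp.construct_basis[OF C(2)])
    ultimately show ?case
      using step xB by (simp add: G.add G.scale span_add span_scale)
  qed
  have zero_on_I: "\<forall>y\<in>I. killing B x y = 0" if x: "x \<in> span B" and "\<And>c. c \<in> C \<Longrightarrow> killing B x c = 0" for x
  proof
    fix y assume "y \<in> I"
    then have "y \<in> span C" using C(3) by simp
    then have "y \<in> span B \<and> killing B y x = 0"
    proof (induction rule: span_induct_alt)
      case base
      then show ?case by (simp add: killing_zero_left span_zero)
    next
      case (step k c y)
      then show ?case
        using that(2)[of c] IB[OF CI] x killing_sym[of c x]
        by (simp add: killing_add_left killing_scale_left span_add span_scale)
    qed
    then show "killing B x y = 0" using killing_sym x by metis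
  qed
  have surj: "G ` span C = span C"
  proof (rule linear_inj_on_span_surj[OF lin C(1,2)])
    show "G x \<in> span C" if "x \<in> span C" for x
      unfolding conjunct2[OF G[OF that]] by (intro span_sum span_scale span_base)
    show "x = 0" if x: "x \<in> span C" and "G x = 0" for x
    proof -
      have "(\<Sum>c\<in>C. killing B x c *s c) = 0" using G[OF x] that(2) by simp
      then have "killing B x c = 0" if "c \<in> C" for c
        using independentD[OF C(2,1) order.refl] that by blast
      then have "\<forall>y\<in>I. killing B x y = 0" using zero_on_I G[OF x] by blast
      then show ?thesis using nondeg G[OF x] x C(3) by blast
    qed
  qed
  \<comment> \<open>Surjectivity provides \<open>i\<close> in \<open>I\<close> with the same Killing
    products against \<open>C\<close> as \<open>m\<close>, so \<open>m - i\<close> is orthogonal to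
    \<open>I\<close>.\<close>
  have "(\<Sum>c\<in>C. killing B m c *s c) \<in> G ` span C"
    unfolding surj by (intro span_sum span_scale span_base)
  then obtain i where i: "i \<in> span C" "(\<Sum>c\<in>C. killing B m c *s c) = G i"
    by (elim imageE)
  have "(\<Sum>c\<in>C. killing B (m - i) c *s c) = (\<Sum>c\<in>C. killing B m c *s c) - (\<Sum>c\<in>C. killing B i c *s c)"
    unfolding sum_subtractf[symmetric] scale_left_diff_distrib[symmetric]
    using G[OF i(1)] m IB[OF CI] by (intro sum.cong refl) (simp add: killing_diff_left)
  also have "\<dots> = 0" using i G[OF i(1)] by simp
  finally have "killing B (m - i) c = 0" if "c \<in> C" for c
    using independentD[OF C(2,1) order.refl] that by blast
  then have "\<forall>y\<in>I. killing B (m - i) y = 0"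
    using zero_on_I[of "m - i"] G[OF i(1)] m span_diff by blast
  then show ?thesis using i(1) C(3) by blast
qed

end

section \<open>Semisimple algebras and direct sums of ideals\<close>

lemma semisimple_solvable_ideal:
  assumes "semisimple M" "lie_ideal M I" "solvable I"
  shows "I = {0}"
proof -
  have "I \<subseteq> lie_radical M"
    unfolding lie_radical_def using assms(2,3) span_superset[of "\<Union> {I. lie_ideal M I \<and> solvable I}"] by blast
  then show ?thesis
    using assms(1) subspace_0[OF lie_ideal_subspace[OF assms(2)]] by (auto simp: semisimple_def)
qed

lemma semisimpleI:
  assumes "\<And>I. lie_ideal M I \<Longrightarrow> solvable I \<Longrightarrow> I = {0}"
  shows "semisimple M"
proof -
  have "\<Union> {I. lie_ideal M I \<and> solvable I} \<subseteq> {0}" using assms by blast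
  then have "lie_radical M \<subseteq> {0}"
    unfolding lie_radical_def by (rule span_minimal) (rule subspace_single_0)
  then show ?thesis
    by (auto simp: semisimple_def lie_radical_def span_zero)
qed

lemma derived_algebra_abelian: "abelian I \<Longrightarrow> derived_algebra I = {0}"
proof -
  assume "abelian I"
  then have "{bracket x y |x y. x \<in> I \<and> y \<in> I} \<subseteq> {0}" by (auto simp: abelian_def)
  then have "derived_algebra I \<subseteq> {0}"
    unfolding derived_algebra_def by (rule span_minimal) (rule subspace_single_0)
  then show ?thesis by (auto simp: derived_algebra_def span_zero)
qed

lemma solvable_zero: "solvable {0}"
  unfolding solvable_def by (intro exI[of _ 0]) simp

lemma abelian_solvable: "abelian I \<Longrightarrow> solvable I"
  unfolding solvable_def by (intro exI[of _ 1]) (simp add: derived_algebra_abelian)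

lemma derived_solvable: "solvable (derived_algebra I) \<Longrightarrow> solvable I"
  unfolding solvable_def by (metis funpow_swap1 funpow.simps(2) comp_apply)

lemma direct_sum_commute:
  assumes "direct_sum_of_ideals M I J" "x \<in> I" "y \<in> J"
  shows "bracket x y = 0"
proof -
  have "lie_ideal M I" "lie_ideal M J" "I \<inter> J = {0}"
    using assms(1) by (auto simp: direct_sum_of_ideals_def)
  then have "bracket x y \<in> I \<inter> J"
    using lie_ideal_bracket'[of M I x y] lie_ideal_bracket[of M J x y] lie_ideal_subset assms(2,3) by blast
  then show ?thesis using \<open>I \<inter> J = {0}\<close> by blast
qed

text \<open>The other summand acts as zero on \<open>J\<close>, so stability under \<open>J\<close>
  is already stability under \<open>M\<close>.\<close>

lemma ideal_of_summand:
  assumes "direct_sum_of_ideals M I J" "lie_ideal J K"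
  shows "lie_ideal M K"
proof -
  have J: "lie_ideal M J" and M: "M = {x + y | x y. x \<in> I \<and> y \<in> J}"
    using assms(1) by (auto simp: direct_sum_of_ideals_def)
  have KJ: "K \<subseteq> J" by (rule lie_ideal_subset[OF assms(2)])
  have "bracket m k \<in> K" if mM: "m \<in> M" and kK: "k \<in> K" for m k
  proof -
    obtain x y where m: "m = x + y" "x \<in> I" "y \<in> J" using M mM by blast
    have "bracket x k = 0" using direct_sum_commute[OF assms(1) m(2)] KJ kK by blast
    then show ?thesis
      unfolding m(1) bracket_add_left using lie_ideal_bracket[OF assms(2) m(3) kK] by simp
  qed
  then show ?thesis
    using KJ lie_ideal_subset[OF J] lie_ideal_subspace[OF assms(2)] unfolding lie_ideal_def by blast
qed

lemma direct_sum_sym: "direct_sum_of_ideals M I J \<Longrightarrow> direct_sum_of_ideals M J I"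
  unfolding direct_sum_of_ideals_def by (auto simp: add.commute Int_commute) (metis add.commute)+

lemma independent_insert_summand:
  assumes ds: "direct_sum_of_ideals M I C" and C: "C = span (\<Union>T)"
    and indep: "\<And>J. J \<in> T \<Longrightarrow> J \<inter> span (\<Union>(T - {J})) = {0}" and J: "J \<in> insert I T"
  shows "J \<inter> span (\<Union>(insert I T - {J})) = {0}"
proof (cases "J = I")
  case True
  have "span (\<Union>(insert I T - {I})) \<subseteq> C"
    unfolding C by (intro span_mono) blast
  moreover have "I \<inter> C = {0}" using ds by (simp add: direct_sum_of_ideals_def)
  ultimately show ?thesis using True span_zero by blast
next
  case False
  have subI: "subspace I" and int: "I \<inter> C = {0}"
    using ds lie_ideal_subspace by (auto simp: direct_sum_of_ideals_def)
  have JT: "J \<in> T" using J False by blast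
  have "insert I T - {J} = insert I (T - {J})" using False by blast
  then have eq: "span (\<Union>(insert I T - {J})) = {x + y | x y. x \<in> I \<and> y \<in> span (\<Union>(T - {J}))}"
    using subI by (simp add: span_Un span_eq_iff[THEN iffD2])
  have JC: "J \<subseteq> C"
    using JT span_superset[of "\<Union>T"] unfolding C by blast
  have sC: "span (\<Union>(T - {J})) \<subseteq> C"
    unfolding C by (intro span_mono) blast
  have "v = 0" if v: "v \<in> J" "v = x + y" "x \<in> I" "y \<in> span (\<Union>(T - {J}))" for v x y
  proof -
    have "v - y \<in> C" using v(1,4) JC sC unfolding C by (intro span_diff) auto
    then have "x \<in> I \<inter> C" using v(2,3) by simp
    then have "v = y" using int v(2) by simp
    then show ?thesis using indep[OF JT] v(1,4) by blast
  qed
  moreover have "0 \<in> J" using indep[OF JT] by blast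
  ultimately show ?thesis using eq span_zero by blast
qed

lemma semisimple_summand:
  assumes "direct_sum_of_ideals M I J" "semisimple M"
  shows "semisimple J"
  by (rule semisimpleI, rule semisimple_solvable_ideal[OF assms(2) ideal_of_summand[OF assms(1)]])

end

locale fd_lie_algebra_char_0 = lie_algebra_char_0 scale bracket
  for scale :: "'k::field_char_0 \<Rightarrow> 'a::ab_group_add \<Rightarrow> 'a" (infixr \<open>*s\<close> 75)
    and bracket :: "'a \<Rightarrow> 'a \<Rightarrow> 'a" +
  assumes finite_dim: "\<exists>B. finite B \<and> span B = UNIV"
begin

lemma obtain_subspace_basis:
  assumes "subspace N"
  obtains C where "finite C" "independent C" "span C = N"
proof -
  obtain F where F: "finite F" "span F = UNIV" using finite_dim by blast
  from obtain_basis[OF assms _ F(1)] F(2) that show thesis by auto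
qed

lemma dim_psubspace:
  assumes "subspace N" "subspace N'" "N \<subset> N'"
  shows "dim N < dim N'"
proof -
  obtain F where F: "finite F" "span F = UNIV" using finite_dim by blast
  from dim_strict_mono[OF F(1) assms] F(2) show ?thesis by simp
qed

text \<open>By \<open>killing_ideal\<close> the form of \<open>J\<close> itself is zero, so a
  nonzero \<open>J\<close> is not perfect. The derived algebra of \<open>J\<close> is again an ideal
  of the ambient algebra, still isotropic and of smaller dimension.\<close>

lemma isotropic_ideal_solvable:
  assumes B: "finite B" "independent B" and sub: "lie_subalgebra (span B)"
    and "lie_ideal (span B) J" "\<And>x y. x \<in> J \<Longrightarrow> y \<in> J \<Longrightarrow> killing B x y = 0"
  shows "solvable J"
  using assms(4,5)
proof (induction "dim J" arbitrary: J rule: less_induct)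
  case less
  show ?case
  proof (cases "J = {0}")
    case True
    then show ?thesis by (simp add: solvable_zero)
  next
    case False
    obtain C where C: "finite C" "independent C" "span C = J"
      using obtain_subspace_basis[OF lie_ideal_subspace[OF less.prems(1)]] by blast
    have subJ: "lie_subalgebra J" by (rule lie_ideal_subalgebra[OF less.prems(1)])
    have "killing C x y = 0" if "x \<in> J" "y \<in> J" for x y
      using killing_ideal[OF B sub, of C x y] C less.prems that by simp
    then have "\<not> J \<subseteq> derived_algebra J"
      using killing_zero_perfect_trivial[OF C(1,2)] subJ False unfolding C(3) killing_def by blast
    then have "derived_algebra J \<subset> J"
      using derived_algebra_subset[OF subJ] by blast
    moreover have ideal: "lie_ideal (span B) (derived_algebra J)"
      by (rule lie_ideal_derived[OF less.prems(1)])
    ultimately have "solvable (derived_algebra J)"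
      using less.prems(2) dim_psubspace[OF lie_ideal_subspace[OF ideal] lie_ideal_subspace[OF less.prems(1)]]
      by (intro less.hyps) blast+
    then show ?thesis by (rule derived_solvable)
  qed
qed

theorem semisimple_complement:
  assumes M: "lie_subalgebra M" "semisimple M" and I: "lie_ideal M I"
  shows "\<exists>J. direct_sum_of_ideals M I J"
proof -
  obtain B where B: "finite B" "independent B" "span B = M"
    using obtain_subspace_basis M(1) unfolding lie_subalgebra_def by blast
  have sub: "lie_subalgebra (span B)" using M B by simp
  have I': "lie_ideal (span B) I" using I B by simp
  define J where "J = {x \<in> span B. \<forall>y\<in>I. killing B x y = 0}"
  have J: "lie_ideal (span B) J"
    unfolding J_def by (rule lie_ideal_killing_orthogonal[OF B(1,2) sub I'])
  have "solvable (I \<inter> J)"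
    using lie_ideal_Int[OF I' J] by (intro isotropic_ideal_solvable[OF B(1,2) sub]) (auto simp: J_def)
  \<comment> \<open>This is nondegeneracy of the Killing form on \<open>I\<close>, which the
    orthogonal projection below requires.\<close>
  then have int: "I \<inter> J = {0}"
    using semisimple_solvable_ideal[OF M(2)] lie_ideal_Int[OF I' J] B(3) by simp
  have "M \<subseteq> {x + y | x y. x \<in> I \<and> y \<in> J}"
  proof
    fix m assume "m \<in> M"
    then have m: "m \<in> span B" using B(3) by simp
    obtain i where i: "i \<in> I" "\<forall>y\<in>I. killing B (m - i) y = 0"
      using killing_orthogonal_complement[OF B(1,2) sub I' _ m] int unfolding J_def by blast
    then have "m - i \<in> J"
      using m lie_ideal_subset[OF I'] by (auto simp: J_def intro: span_diff)
    then show "m \<in> {x + y | x y. x \<in> I \<and> y \<in> J}"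
      using i(1) by (intro CollectI exI[of _ i] exI[of _ "m - i"]) simp
  qed
  moreover have "{x + y | x y. x \<in> I \<and> y \<in> J} \<subseteq> M"
    using lie_ideal_sum[OF sub I' J] B(3) lie_ideal_subset by blast
  ultimately show ?thesis
    using I J int B(3) unfolding direct_sum_of_ideals_def by blast
qed

text \<open>A nonzero ideal of least dimension is simple: its ideals are ideals of \<open>M\<close>
  because it is a direct summand, and it is not abelian because \<open>M\<close> has no nonzero
  solvable ideals. Its complement is semisimple of smaller dimension.\<close>

theorem semisimple_simple_components:
  assumes "lie_subalgebra M" "semisimple M"
  shows "\<exists>T. simple_components M T"
  using assms
proof (induction "dim M" arbitrary: M rule: less_induct)
  case less
  show ?case
  proof (cases "M = {0}")
    case True
    then show ?thesis by (intro exI[of _ "{}"]) (simp add: simple_components_def)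
  next
    case False
    then have "lie_ideal M M \<and> M \<noteq> {0}" using lie_ideal_self[OF less.prems(1)] by blast
    then obtain I where I: "lie_ideal M I" "I \<noteq> {0}"
      and min: "\<And>J. lie_ideal M J \<Longrightarrow> J \<noteq> {0} \<Longrightarrow> dim I \<le> dim J"
      using ex_has_least_nat[of "\<lambda>I. lie_ideal M I \<and> I \<noteq> {0}" M dim] by blast
    obtain C where ds: "direct_sum_of_ideals M I C"
      using semisimple_complement[OF less.prems I(1)] by blast
    have C: "lie_ideal M C" and int: "I \<inter> C = {0}" and sum: "M = {x + y | x y. x \<in> I \<and> y \<in> C}"
      using ds by (auto simp: direct_sum_of_ideals_def)
    have subI: "subspace I" and subC: "subspace C"
      using I(1) C lie_ideal_subspace by auto
    have "C \<subset> M"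
      using lie_ideal_subset[OF C] lie_ideal_subset[OF I(1)] int I(2) subspace_0[OF subI] by blast
    then have "dim C < dim M"
      using dim_psubspace subC lie_ideal_subspace[OF lie_ideal_self[OF less.prems(1)]] by blast
    then obtain T where T: "simple_components C T"
      using less.hyps lie_ideal_subalgebra[OF C] semisimple_summand[OF ds less.prems(2)] by blast
    have T': "finite T" "\<And>J. J \<in> T \<Longrightarrow> lie_ideal C J" "\<And>J. J \<in> T \<Longrightarrow> simple J" "C = span (\<Union>T)"
      "\<And>J. J \<in> T \<Longrightarrow> J \<inter> span (\<Union>(T - {J})) = {0}"
      using T unfolding simple_components_def by blast+
    have "simple I"
      unfolding simple_def
    proof (intro conjI allI impI)
      show "\<not> abelian I"
        using semisimple_solvable_ideal[OF less.prems(2) I(1)] abelian_solvable I(2) by blast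
      fix K assume K: "lie_ideal I K"
      have "lie_ideal M K" by (rule ideal_of_summand[OF direct_sum_sym[OF ds] K])
      then have "K = {0} \<or> dim I \<le> dim K" using min by blast
      then show "K = {0} \<or> K = I"
        using dim_psubspace[OF lie_ideal_subspace[OF K] subI] lie_ideal_subset[OF K] by (meson leD psubsetI)
    qed
    have span_I: "span I = I" using subI by (simp add: span_eq_iff)
    have "simple_components M (insert I T)"
      unfolding simple_components_def
    proof (intro conjI ballI)
      show "finite (insert I T)" using T'(1) by simp
      show "lie_ideal M J" if "J \<in> insert I T" for J
        using that I(1) T'(2) ideal_of_summand[OF ds] by blast
      show "simple J" if "J \<in> insert I T" for J
        using that \<open>simple I\<close> T'(3) by blast
      show "M = span (\<Union> (insert I T))"
        by (simp add: span_Un span_I T'(4)[symmetric] sum)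
      show "J \<inter> span (\<Union> (insert I T - {J})) = {0}" if "J \<in> insert I T" for J
        using independent_insert_summand[OF ds T'(4,5) that] .
    qed
    then show ?thesis by blast
  qed
qed

end

section \<open>The lattice of ideals\<close>

lemma cube_lattice_ops:
  shows cube_lattice_bounded: "bounded_lattice (cube_lattice n)"
    and cube_lattice_join: "U \<subseteq> {1..n} \<Longrightarrow> W \<subseteq> {1..n} \<Longrightarrow> U \<squnion>\<^bsub>cube_lattice n\<^esub> W = U \<union> W"
    and cube_lattice_meet: "U \<subseteq> {1..n} \<Longrightarrow> W \<subseteq> {1..n} \<Longrightarrow> U \<sqinter>\<^bsub>cube_lattice n\<^esub> W = U \<inter> W"
proof -
  have po: "partial_order (cube_lattice n)"
    by unfold_locales (auto simp: cube_lattice_def)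
  interpret partial_order "cube_lattice n"
    by (fact po)
  have join: "least (cube_lattice n) (U \<union> W) (Upper (cube_lattice n) {U, W})"
    if "U \<subseteq> {1..n}" "W \<subseteq> {1..n}" for U W
    using that unfolding least_def Upper_def cube_lattice_def by auto
  have meet: "greatest (cube_lattice n) (U \<inter> W) (Lower (cube_lattice n) {U, W})"
    if "U \<subseteq> {1..n}" "W \<subseteq> {1..n}" for U W
    using that unfolding greatest_def Lower_def cube_lattice_def by auto
  have "least (cube_lattice n) {} (carrier (cube_lattice n))"
    by (auto simp: least_def cube_lattice_def)
  moreover have "greatest (cube_lattice n) {1..n} (carrier (cube_lattice n))"
    by (auto simp: greatest_def cube_lattice_def)
  moreover have "\<exists>s. least (cube_lattice n) s (Upper (cube_lattice n) {U, W})"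
    if "U \<in> carrier (cube_lattice n)" "W \<in> carrier (cube_lattice n)" for U W
    using join[of U W] that by (auto simp: cube_lattice_def)
  moreover have "\<exists>s. greatest (cube_lattice n) s (Lower (cube_lattice n) {U, W})"
    if "U \<in> carrier (cube_lattice n)" "W \<in> carrier (cube_lattice n)" for U W
    using meet[of U W] that by (auto simp: cube_lattice_def)
  ultimately show bdd: "bounded_lattice (cube_lattice n)"
    by unfold_locales blast+
  interpret bounded_lattice "cube_lattice n" by (rule bdd)
  show "U \<squnion>\<^bsub>cube_lattice n\<^esub> W = U \<union> W" if "U \<subseteq> {1..n}" "W \<subseteq> {1..n}"
  proof (rule joinI)
    fix s assume "least (cube_lattice n) s (Upper (cube_lattice n) {U, W})"
    with join[OF that] show "s = U \<union> W" using least_unique by blast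
  qed (use that in \<open>simp_all add: cube_lattice_def\<close>)
  show "U \<sqinter>\<^bsub>cube_lattice n\<^esub> W = U \<inter> W" if "U \<subseteq> {1..n}" "W \<subseteq> {1..n}"
  proof (rule meetI)
    fix s assume "greatest (cube_lattice n) s (Lower (cube_lattice n) {U, W})"
    with meet[OF that] show "s = U \<inter> W" using greatest_unique by blast
  qed (use that in \<open>simp_all add: cube_lattice_def\<close>)
qed

context lie_algebra
begin

lemma carrier_ideal_lattice: "carrier (ideal_lattice M) = {I. lie_ideal M I}"
  by (simp add: ideal_lattice_def)

lemma complemented_iff:
  assumes M: "lie_subalgebra M"
  shows "complemented_lattice (ideal_lattice M) \<longleftrightarrow>
    (\<forall>I. lie_ideal M I \<longrightarrow> (\<exists>J. direct_sum_of_ideals M I J))"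
  unfolding complemented_lattice_def direct_sum_of_ideals_def carrier_ideal_lattice
    ideal_lattice_bottom[OF M] ideal_lattice_top[OF M]
  using ideal_lattice_bounded[OF M]
  by (auto simp: ideal_lattice_join[OF M] ideal_lattice_meet[OF M]) (metis+)?

lemma distributive_sum_Int:
  assumes M: "lie_subalgebra M" and "distributive_lattice (ideal_lattice M)"
    and "lie_ideal M I" "lie_ideal M J" "lie_ideal M K"
  shows "I \<inter> {x + y | x y. x \<in> J \<and> y \<in> K} = {x + y | x y. x \<in> I \<inter> J \<and> y \<in> I \<inter> K}"
proof -
  have "I \<sqinter>\<^bsub>ideal_lattice M\<^esub> (J \<squnion>\<^bsub>ideal_lattice M\<^esub> K)
      = (I \<sqinter>\<^bsub>ideal_lattice M\<^esub> J) \<squnion>\<^bsub>ideal_lattice M\<^esub> (I \<sqinter>\<^bsub>ideal_lattice M\<^esub> K)"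
    using assms(2-) unfolding distributive_lattice_def carrier_ideal_lattice by blast
  then show ?thesis
    unfolding ideal_lattice_join[OF M assms(4,5)] ideal_lattice_meet[OF M assms(3,4)]
      ideal_lattice_meet[OF M assms(3,5)] ideal_lattice_meet[OF M assms(3) lie_ideal_sum[OF M assms(4,5)]]
      ideal_lattice_join[OF M lie_ideal_Int[OF assms(3,4)] lie_ideal_Int[OF assms(3,5)]] .
qed

section \<open>The centre and complemented abelian ideals\<close>

lemma lie_ideal_centre:
  assumes "lie_subalgebra M"
  shows "lie_ideal M (lie_centre M)"
  using assms unfolding lie_ideal_def lie_centre_def lie_subalgebra_def subspace_def
  by (auto simp: bracket_zero_left bracket_add_left bracket_scale_left)
     (metis bracket_swap bracket_zero_left neg_equal_0_iff_equal)+

lemma lie_centre_subspace_ideal: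
  assumes "subspace N" "N \<subseteq> lie_centre M"
  shows "lie_ideal M N"
proof -
  have "bracket x y = 0" if "x \<in> M" "y \<in> N" for x y
    using that assms(2) bracket_swap[of x y] unfolding lie_centre_def by auto
  then show ?thesis
    using assms subspace_0[OF assms(1)] unfolding lie_ideal_def lie_centre_def by auto
qed

text \<open>The last nonzero term of the derived series works; every term is an ideal of
  \<open>M\<close>, not merely of \<open>I\<close>.\<close>

lemma solvable_ideal_contains_abelian:
  assumes "lie_ideal M I" "solvable I" "I \<noteq> {0}"
  shows "\<exists>N. lie_ideal M N \<and> abelian N \<and> N \<noteq> {0} \<and> N \<subseteq> I"
proof -
  obtain n where "(derived_algebra ^^ n) I = {0}" using assms(2) by (auto simp: solvable_def)
  then show ?thesis
    using assms(1,3)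
  proof (induction n arbitrary: I)
    case 0
    then show ?case by simp
  next
    case (Suc n)
    show ?case
    proof (cases "derived_algebra I = {0}")
      case True
      have "bracket x y \<in> derived_algebra I" if "x \<in> I" "y \<in> I" for x y
        unfolding derived_algebra_def using that by (intro span_base) blast
      then have "abelian I" using True by (auto simp: abelian_def)
      then show ?thesis using Suc.prems by blast
    next
      case False
      have "(derived_algebra ^^ n) (derived_algebra I) = {0}"
        using Suc.prems(1) by (simp add: funpow_swap1)
      from Suc.IH[OF this lie_ideal_derived[OF Suc.prems(2)] False]
      show ?thesis
        using derived_algebra_subset[OF lie_ideal_subalgebra[OF Suc.prems(2)]] by blast
    qed
  qed
qed

text \<open>Elements of \<open>N\<close> commute with \<open>N\<close> by assumption, and with the
  complement because brackets of the two land in their zero intersection.\<close>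

lemma complemented_abelian_ideal_central:
  assumes "direct_sum_of_ideals M N N'" "abelian N"
  shows "N \<subseteq> lie_centre M"
proof
  fix x assume x: "x \<in> N"
  have N: "lie_ideal M N" and M: "M = {x + y | x y. x \<in> N \<and> y \<in> N'}"
    using assms(1) by (auto simp: direct_sum_of_ideals_def)
  have "bracket x y = 0" if "y \<in> M" for y
  proof -
    obtain u v where y: "y = u + v" "u \<in> N" "v \<in> N'" using M \<open>y \<in> M\<close> by blast
    then show ?thesis
      using direct_sum_commute[OF assms(1) x y(3)] assms(2) x by (simp add: abelian_def bracket_add_right)
  qed
  then show "x \<in> lie_centre M"
    using x lie_ideal_subset[OF N] by (auto simp: lie_centre_def)
qed

text \<open>Take a complement \<open>S\<close> of the centre. A nonzero solvable ideal of
  \<open>S\<close> would contain a nonzero abelian ideal of \<open>M\<close>; being complemented,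
  that ideal is central, yet \<open>S\<close> meets the centre in zero.\<close>

lemma complemented_decomposition:
  assumes M: "lie_subalgebra M" and compl: "complemented_lattice (ideal_lattice M)"
  shows "\<exists>S. direct_sum_of_ideals M S (lie_centre M) \<and> semisimple S"
proof -
  obtain S where ds: "direct_sum_of_ideals M (lie_centre M) S"
    using compl lie_ideal_centre[OF M] unfolding complemented_iff[OF M] by blast
  have "semisimple S"
  proof (rule semisimpleI, rule ccontr)
    fix I assume I: "lie_ideal S I" "solvable I" "I \<noteq> {0}"
    have "lie_ideal M I" by (rule ideal_of_summand[OF ds I(1)])
    then obtain N where N: "lie_ideal M N" "abelian N" "N \<noteq> {0}" "N \<subseteq> I"
      using solvable_ideal_contains_abelian I(2,3) by blast
    obtain N' where "direct_sum_of_ideals M N N'"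
      using compl N(1) unfolding complemented_iff[OF M] by blast
    then have "N \<subseteq> lie_centre M \<inter> S"
      using complemented_abelian_ideal_central N(2,4) lie_ideal_subset[OF I(1)] by blast
    moreover have "lie_centre M \<inter> S = {0}" using ds by (simp add: direct_sum_of_ideals_def)
    ultimately show False
      using N(3) subspace_0[OF lie_ideal_subspace[OF N(1)]] by blast
  qed
  then show ?thesis using direct_sum_sym[OF ds] by blast
qed

section \<open>Ideals as sums of components\<close>

lemma span_Union_decomposition:
  assumes "finite T" "\<And>J. J \<in> T \<Longrightarrow> subspace J" "v \<in> span (\<Union>T)"
  shows "\<exists>x. (\<forall>J\<in>T. x J \<in> J) \<and> v = (\<Sum>J\<in>T. x J)"
  using assms
proof (induction T arbitrary: v rule: finite_induct)
  case empty
  then show ?case by simp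
next
  case (insert I T)
  have "span I = I" using insert.prems(1) by (simp add: span_eq_iff)
  then have "span (\<Union>(insert I T)) = {u + w | u w. u \<in> I \<and> w \<in> span (\<Union>T)}"
    unfolding Union_insert span_Un by (simp only:)
  then obtain u w where v: "v = u + w" "u \<in> I" "w \<in> span (\<Union>T)"
    using insert.prems(2) by auto
  obtain x where x: "\<forall>J\<in>T. x J \<in> J" "w = (\<Sum>J\<in>T. x J)"
    using insert.IH[of w] insert.prems(1) v(3) by auto
  have "(\<Sum>J\<in>T. (x(I := u)) J) = (\<Sum>J\<in>T. x J)"
    using insert.hyps(2) by (intro sum.cong) auto
  then show ?case
    using insert.hyps v x by (intro exI[of _ "x(I := u)"]) auto
qed

text \<open>
  If a component \<open>J\<close> is not contained in the ideal \<open>I\<close>, then \<open>I \<inter> J = {0}\<close>, so that the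
  \<open>J\<close>-part of an element of \<open>I\<close> is central in \<open>J\<close> and therefore vanishes.
\<close>

lemma semisimple_part_of_ideal:
  assumes ds: "direct_sum_of_ideals M A S" and T: "simple_components S T" and I: "lie_ideal M I"
    and a: "a \<in> A" and s: "s \<in> S" and as: "a + s \<in> I"
  shows "s \<in> span (\<Union>{J \<in> T. J \<subseteq> I})"
proof -
  have T': "finite T" "\<And>J. J \<in> T \<Longrightarrow> lie_ideal S J" "\<And>J. J \<in> T \<Longrightarrow> simple J" "S = span (\<Union>T)"
    "\<And>J. J \<in> T \<Longrightarrow> J \<inter> span (\<Union>(T - {J})) = {0}"
    using T unfolding simple_components_def by blast+
  have JM: "lie_ideal M J" if "J \<in> T" for J by (rule ideal_of_summand[OF ds T'(2)[OF that]])
  obtain x where x: "\<And>J. J \<in> T \<Longrightarrow> x J \<in> J" "s = (\<Sum>J\<in>T. x J)"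
    using span_Union_decomposition[OF T'(1) lie_ideal_subspace[OF T'(2)]] s unfolding T'(4) by blast
  have commute: "bracket (x K) y = 0" if "K \<in> T" "J \<in> T" "K \<noteq> J" "y \<in> J" for K J y
  proof -
    have "K \<subseteq> span (\<Union>(T - {J}))" using that(1,3) span_superset[of "\<Union>(T - {J})"] by blast
    then have "J \<inter> K \<subseteq> {0}" using T'(5)[OF that(2)] by blast
    moreover have "x K \<in> S" "y \<in> S"
      using x(1) that lie_ideal_subset[OF T'(2)] by blast+
    then have "bracket (x K) y \<in> J \<inter> K"
      using lie_ideal_bracket[OF T'(2)[OF that(2)] _ that(4)]
        lie_ideal_bracket'[OF T'(2)[OF that(1)] x(1)[OF that(1)]] by blast
    ultimately show ?thesis by blast
  qed
  have "x J \<in> span (\<Union>{J \<in> T. J \<subseteq> I})" if J: "J \<in> T" for J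
  proof (cases "J \<subseteq> I")
    case True
    then show ?thesis using J x(1) by (intro span_base) blast
  next
    case False
    have JS: "J \<subseteq> S" by (rule lie_ideal_subset[OF T'(2)[OF J]])
    have "lie_ideal J (I \<inter> J)"
      using lie_ideal_Int[OF I JM[OF J]] lie_ideal_subset[OF JM[OF J]] unfolding lie_ideal_def by blast
    then have int: "I \<inter> J = {0}"
      using T'(3)[OF J] False unfolding simple_def by blast
    have "bracket (x J) y = 0" if y: "y \<in> J" for y
    proof -
      interpret ad: Vector_Spaces.linear scale scale "\<lambda>x. bracket x y"
        by (rule linear_bracket_left)
      \<comment> \<open>Bracketing with an element of \<open>J\<close> annihilates \<open>a\<close>
        and every component of \<open>s\<close> other than \<open>x J\<close>, so this zero bracket
        isolates \<open>x J\<close>.\<close>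
      have "bracket (a + s) y \<in> I \<inter> J"
        using lie_ideal_bracket'[OF I as, of y] lie_ideal_bracket[OF JM[OF J] _ y, of "a + s"]
          lie_ideal_subset[OF I] as lie_ideal_subset[OF JM[OF J]] y by blast
      then have "bracket (a + s) y = 0" using int by blast
      moreover have "bracket a y = 0" using direct_sum_commute[OF ds a] y JS by blast
      ultimately have "bracket s y = 0" by (simp add: bracket_add_left)
      moreover have "bracket s y = (\<Sum>K\<in>T. bracket (x K) y)"
        unfolding x(2) by (rule ad.sum)
      moreover have "\<dots> = (\<Sum>K\<in>T. if K = J then bracket (x J) y else 0)"
        using commute[OF _ J _ y] by (intro sum.cong) auto
      ultimately show ?thesis using T'(1) J by simp
    qed
    then have "x J \<in> lie_centre J" using x(1)[OF J] by (simp add: lie_centre_def)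
    moreover have "lie_centre J \<noteq> J"
      using T'(3)[OF J] unfolding simple_def abelian_def lie_centre_def by blast
    then have "lie_centre J = {0}"
      using T'(3)[OF J] lie_ideal_centre[OF lie_ideal_subalgebra[OF JM[OF J]]] unfolding simple_def by blast
    ultimately show ?thesis by (simp add: span_zero)
  qed
  then show ?thesis unfolding x(2) by (rule span_sum)
qed

text \<open>Treats the simple components and their enlargement by a central line together; that line
  is abelian, so \<open>simple_components\<close> cannot describe it. Independence makes the
  subfamily of an ideal unique, and the last condition makes it determine the ideal.\<close>

definition generating_family :: "'a set \<Rightarrow> 'a set set \<Rightarrow> bool" where
  "generating_family M T \<longleftrightarrow> finite T \<and> (\<forall>J\<in>T. lie_ideal M J \<and> J \<noteq> {0} \<and> J \<inter> span (\<Union>(T - {J})) = {0})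
     \<and> (\<forall>I. lie_ideal M I \<longrightarrow> I \<subseteq> span (\<Union>{J \<in> T. J \<subseteq> I}))"

lemma generating_family_simple_components:
  assumes M: "lie_subalgebra M" and T: "simple_components M T"
  shows "generating_family M T"
proof -
  \<comment> \<open>With the summand \<open>{0}\<close> the statement about semisimple parts applies
    to all of \<open>M\<close>.\<close>
  have "direct_sum_of_ideals M {0} M"
    using lie_ideal_zero[OF M] lie_ideal_self[OF M] subspace_0[of M] M
    by (auto simp: direct_sum_of_ideals_def lie_subalgebra_def)
  from semisimple_part_of_ideal[OF this T, of _ 0]
  have "I \<subseteq> span (\<Union>{J \<in> T. J \<subseteq> I})" if "lie_ideal M I" for I
    using that lie_ideal_subset[OF that] by auto
  moreover have "J \<noteq> {0}" if "simple J" for J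
    using that by (auto simp: simple_def abelian_def bracket_zero_left)
  ultimately show ?thesis
    using T unfolding simple_components_def generating_family_def by blast
qed

text \<open>The first claim makes the enlarged family larger by exactly one, whence the exponent r +
  1. For the second, once the semisimple part of an element of \<open>I\<close> lies in
  \<open>I\<close>, so does its part in the line; if nonzero, that part generates the whole
  line.\<close>

lemma generating_family_insert:
  assumes z: "z \<noteq> 0" and ds: "direct_sum_of_ideals M (span {z}) S" and T: "simple_components S T"
  shows "span {z} \<notin> T" "generating_family M (insert (span {z}) T)"
proof -
  have T': "finite T" "\<And>J. J \<in> T \<Longrightarrow> lie_ideal S J" "\<And>J. J \<in> T \<Longrightarrow> simple J" "S = span (\<Union>T)"
    "\<And>J. J \<in> T \<Longrightarrow> J \<inter> span (\<Union>(T - {J})) = {0}"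
    using T unfolding simple_components_def by blast+
  have zspan: "z \<in> span {z}" by (simp add: span_base)
  have int: "span {z} \<inter> S = {0}" and sum: "M = {x + y | x y. x \<in> span {z} \<and> y \<in> S}"
    and A: "lie_ideal M (span {z})"
    using ds by (auto simp: direct_sum_of_ideals_def)
  show "span {z} \<notin> T"
    using int zspan z lie_ideal_subset[OF T'(2)] by blast
  have simple_ne: "J \<noteq> {0}" if "simple J" for J
    using that by (auto simp: simple_def abelian_def bracket_zero_left)
  have "I \<subseteq> span (\<Union>{J \<in> insert (span {z}) T. J \<subseteq> I})" if I: "lie_ideal M I" for I
  proof
    fix v assume v: "v \<in> I"
    then obtain a s where as: "v = a + s" "a \<in> span {z}" "s \<in> S"
      using lie_ideal_subset[OF I] sum by blast
    have s: "s \<in> span (\<Union>{J \<in> T. J \<subseteq> I})"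
      using semisimple_part_of_ideal[OF ds T I as(2,3)] v as(1) by simp
    have subI: "subspace I" by (rule lie_ideal_subspace[OF I])
    have "span (\<Union>{J \<in> T. J \<subseteq> I}) \<subseteq> I" using subI by (intro span_minimal) auto
    then have "a \<in> I" using s v as(1) subspace_diff[OF subI, of v s] by auto
    obtain c where c: "a = c *s z" using as(2) by (auto simp: span_singleton)
    have "a \<in> span (\<Union>{J \<in> insert (span {z}) T. J \<subseteq> I})"
    proof (cases "c = 0")
      case True
      then show ?thesis using c by (simp add: span_zero)
    next
      case False
      then have "z = inverse c *s a" using c by simp
      then have "z \<in> I" using \<open>a \<in> I\<close> subspace_scale[OF subI] by metis
      then have "span {z} \<subseteq> I" using subI by (intro span_minimal) auto
      then show ?thesis using as(2) by (intro span_base) blast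
    qed
    moreover have "span (\<Union>{J \<in> T. J \<subseteq> I}) \<subseteq> span (\<Union>{J \<in> insert (span {z}) T. J \<subseteq> I})"
      by (intro span_mono) blast
    ultimately show "v \<in> span (\<Union>{J \<in> insert (span {z}) T. J \<subseteq> I})"
      unfolding as(1) using s by (intro span_add) auto
  qed
  moreover have "lie_ideal M J \<and> J \<noteq> {0}" if "J \<in> insert (span {z}) T" for J
    using that A T'(2,3) simple_ne ideal_of_summand[OF ds] zspan z by blast
  ultimately show "generating_family M (insert (span {z}) T)"
    using T'(1) independent_insert_summand[OF ds T'(4,5)] unfolding generating_family_def by blast
qed

lemma lie_ideal_span_Union:
  assumes "lie_subalgebra M" "\<And>J. J \<in> U \<Longrightarrow> lie_ideal M J"
  shows "lie_ideal M (span (\<Union>U))"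
proof -
  have "span (\<Union>U) \<subseteq> {v. bracket m v \<in> span (\<Union>U)}" if "m \<in> M" for m
  proof (rule span_minimal[OF _ subspace_bracket_into[OF subspace_span]], rule subsetI)
    fix v assume "v \<in> \<Union>U"
    then obtain J where "J \<in> U" "v \<in> J" by blast
    then have "bracket m v \<in> \<Union>U" using lie_ideal_bracket[OF assms(2) \<open>m \<in> M\<close>] by blast
    then show "v \<in> {v. bracket m v \<in> span (\<Union>U)}" by (simp add: span_base)
  qed
  moreover have "span (\<Union>U) \<subseteq> M"
    using assms lie_ideal_subset by (intro span_minimal) (auto simp: lie_subalgebra_def)
  ultimately show ?thesis unfolding lie_ideal_def by auto
qed

context
  fixes M T assumes M: "lie_subalgebra M" and T: "generating_family M T"
begin

lemma generating_family_eq: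
  assumes "lie_ideal M I"
  shows "I = span (\<Union>{J \<in> T. J \<subseteq> I})"
proof
  show "I \<subseteq> span (\<Union>{J \<in> T. J \<subseteq> I})" using T assms unfolding generating_family_def by blast
  show "span (\<Union>{J \<in> T. J \<subseteq> I}) \<subseteq> I"
    using lie_ideal_subspace[OF assms] by (intro span_minimal) auto
qed

lemma generating_family_subset_iff:
  assumes "U \<subseteq> T" "J \<in> T"
  shows "J \<subseteq> span (\<Union>U) \<longleftrightarrow> J \<in> U"
proof
  assume J: "J \<subseteq> span (\<Union>U)"
  show "J \<in> U"
  proof (rule ccontr)
    assume "J \<notin> U"
    then have "span (\<Union>U) \<subseteq> span (\<Union>(T - {J}))" using assms(1) by (intro span_mono) blast
    with J have "J \<inter> span (\<Union>(T - {J})) = J" by (metis inf.absorb_iff1 order.trans)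
    moreover have "J \<inter> span (\<Union>(T - {J})) = {0}" "J \<noteq> {0}"
      using T assms(2) unfolding generating_family_def by simp_all
    ultimately show False by simp
  qed
next
  assume "J \<in> U"
  then show "J \<subseteq> span (\<Union>U)" using span_superset[of "\<Union>U"] by blast
qed

lemma generating_family_bij:
  "bij_betw (\<lambda>I. {J \<in> T. J \<subseteq> I}) {I. lie_ideal M I} (Pow T)"
proof (rule bij_betw_byWitness[where f' = "\<lambda>U. span (\<Union>U)"])
  show "\<forall>I\<in>{I. lie_ideal M I}. span (\<Union>{J \<in> T. J \<subseteq> I}) = I"
    using generating_family_eq by blast
  show "\<forall>U\<in>Pow T. {J \<in> T. J \<subseteq> span (\<Union>U)} = U"
    using generating_family_subset_iff by blast
  show "(\<lambda>U. span (\<Union>U)) ` Pow T \<subseteq> {I. lie_ideal M I}"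
    using T unfolding generating_family_def
    by (intro image_subsetI CollectI lie_ideal_span_Union[OF M]) blast
qed blast

lemma generating_family_card: "card {I. lie_ideal M I} = 2 ^ card T"
  using bij_betw_same_card[OF generating_family_bij] T
  by (simp add: card_Pow generating_family_def)

lemma generating_family_finite: "finite {I. lie_ideal M I}"
  using bij_betw_finite[OF generating_family_bij] T by (simp add: generating_family_def)

lemma generating_family_sum:
  assumes I: "lie_ideal M I" and I': "lie_ideal M I'"
  shows "{J \<in> T. J \<subseteq> {x + y | x y. x \<in> I \<and> y \<in> I'}} = {J \<in> T. J \<subseteq> I} \<union> {J \<in> T. J \<subseteq> I'}"
proof -
  let ?U = "{J \<in> T. J \<subseteq> I}" and ?U' = "{J \<in> T. J \<subseteq> I'}"
  have "{x + y | x y. x \<in> I \<and> y \<in> I'} = span (\<Union>?U \<union> \<Union>?U')"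
    using generating_family_eq[OF I] generating_family_eq[OF I'] unfolding span_Un by simp
  also have "\<Union>?U \<union> \<Union>?U' = \<Union>(?U \<union> ?U')" by blast
  finally have eq: "{x + y | x y. x \<in> I \<and> y \<in> I'} = span (\<Union>(?U \<union> ?U'))" .
  show ?thesis
    unfolding eq using generating_family_subset_iff[of "?U \<union> ?U'"] by blast
qed

lemma generating_family_cube: "lattice_isomorphic (ideal_lattice M) (cube_lattice (card T))"
proof -
  have "finite T" using T by (simp add: generating_family_def)
  then obtain h where h: "bij_betw h T {1..card T}"
    using finite_same_card_bij[of T "{1..card T}"] by auto
  define f where "f = (\<lambda>I. h ` {J \<in> T. J \<subseteq> I})"
  have bij: "bij_betw f (carrier (ideal_lattice M)) (carrier (cube_lattice (card T)))"
    using bij_betw_trans[OF generating_family_bij bij_betw_Pow[OF h]]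
    by (simp add: f_def comp_def carrier_ideal_lattice cube_lattice_def)
  have f_sub: "f I \<subseteq> {1..card T}" for I
    using bij_betw_imp_surj_on[OF h] by (auto simp: f_def)
  have lat: "Lattice.lattice (ideal_lattice M)" "Lattice.lattice (cube_lattice (card T))"
    using ideal_lattice_bounded[OF M] cube_lattice_bounded bounded_lattice.axioms(1) by blast+
  have "f (I \<squnion>\<^bsub>ideal_lattice M\<^esub> I') = f I \<squnion>\<^bsub>cube_lattice (card T)\<^esub> f I'"
    if "lie_ideal M I" "lie_ideal M I'" for I I'
    unfolding ideal_lattice_join[OF M that] cube_lattice_join[OF f_sub f_sub]
    unfolding f_def generating_family_sum[OF that] by blast
  moreover have "f (I \<sqinter>\<^bsub>ideal_lattice M\<^esub> I') = f I \<sqinter>\<^bsub>cube_lattice (card T)\<^esub> f I'"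
    if "lie_ideal M I" "lie_ideal M I'" for I I'
  proof -
    have "{J \<in> T. J \<subseteq> I \<inter> I'} = {J \<in> T. J \<subseteq> I} \<inter> {J \<in> T. J \<subseteq> I'}" by blast
    moreover have "h ` (U \<inter> W) = h ` U \<inter> h ` W" if "U \<subseteq> T" "W \<subseteq> T" for U W
      using inj_on_image_Int[OF bij_betw_imp_inj_on[OF h] that] .
    ultimately show ?thesis
      unfolding ideal_lattice_meet[OF M that] cube_lattice_meet[OF f_sub f_sub]
      unfolding f_def by simp
  qed
  ultimately have "join_pres (ideal_lattice M) (cube_lattice (card T)) f"
    "meet_pres (ideal_lattice M) (cube_lattice (card T)) f"
    using lat by (auto simp: join_pres_def meet_pres_def carrier_ideal_lattice)
  with bij show ?thesis unfolding lattice_isomorphic_def by blast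
qed

end

text \<open>Complements and distributivity are pulled back along the injective map \<open>f\<close>.
  An isomorphism is only required to preserve joins and meets, so the images of \<open>{0}\<close>
  and \<open>M\<close> have to be computed first.\<close>

lemma cube_isomorphic_boolean:
  assumes M: "lie_subalgebra M" and "lattice_isomorphic (ideal_lattice M) (cube_lattice n)"
  shows "boolean_lattice (ideal_lattice M)"
proof -
  interpret L: bounded_lattice "ideal_lattice M" by (rule ideal_lattice_bounded[OF M])
  let ?join = "\<lambda>I J. {x + y | x y. x \<in> I \<and> y \<in> J}"
  obtain f where bij: "bij_betw f {I. lie_ideal M I} (Pow {1..n})"
    and jp: "join_pres (ideal_lattice M) (cube_lattice n) f" and mp: "meet_pres (ideal_lattice M) (cube_lattice n) f"
    using assms(2) unfolding lattice_isomorphic_def carrier_ideal_lattice by (auto simp: cube_lattice_def)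
  have f: "f I \<subseteq> {1..n}" if "lie_ideal M I" for I
    using bij_betw_apply[OF bij] that by blast
  have join: "f (?join I J) = f I \<union> f J" if "lie_ideal M I" "lie_ideal M J" for I J
    using jp that cube_lattice_join[OF f f]
    by (simp add: join_pres_def carrier_ideal_lattice ideal_lattice_join[OF M that, symmetric])
  have meet: "f (I \<inter> J) = f I \<inter> f J" if "lie_ideal M I" "lie_ideal M J" for I J
    using mp that cube_lattice_meet[OF f f]
    by (simp add: meet_pres_def carrier_ideal_lattice ideal_lattice_meet[OF M that, symmetric])
  have inj: "I = J" if "lie_ideal M I" "lie_ideal M J" "f I = f J" for I J
    using inj_onD[OF bij_betw_imp_inj_on[OF bij] that(3)] that by simp
  have surj: "\<exists>I. lie_ideal M I \<and> f I = U" if "U \<subseteq> {1..n}" for U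
    using bij_betw_imp_surj_on[OF bij] that by (metis (no_types, lifting) Pow_iff imageE mem_Collect_eq)
  note zero = lie_ideal_zero[OF M] and self = lie_ideal_self[OF M]
  have f_zero: "f {0} = {}"
  proof -
    \<comment> \<open>A preimage of the bottom absorbs every meet on the cube side, while
      \<open>{0}\<close> absorbs it among ideals; comparing the two forces \<open>f {0}\<close> to
      be empty.\<close>
    obtain E where E: "lie_ideal M E" "f E = {}" using surj[of "{}"] by blast
    have "{0} \<inter> E = {0}" using subspace_0[OF lie_ideal_subspace[OF E(1)]] by blast
    then show ?thesis using meet[OF zero E(1)] E(2) by simp
  qed
  have f_self: "f M = {1..n}"
  proof -
    obtain E where E: "lie_ideal M E" "f E = {1..n}" using surj[of "{1..n}"] by blast
    have "M \<inter> E = E" using lie_ideal_subset[OF E(1)] by blast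
    then show ?thesis using meet[OF self E(1)] E(2) f[OF self] by auto
  qed
  have "complemented_lattice (ideal_lattice M)"
    unfolding complemented_iff[OF M]
  proof (intro allI impI)
    fix I assume I: "lie_ideal M I"
    obtain J where J: "lie_ideal M J" "f J = {1..n} - f I" using surj[of "{1..n} - f I"] by blast
    have "?join I J = M"
      using join[OF I J(1)] J(2) f[OF I] f_self by (intro inj lie_ideal_sum[OF M I J(1)] self) auto
    moreover have "I \<inter> J = {0}"
      using meet[OF I J(1)] J(2) f_zero by (intro inj lie_ideal_Int[OF I J(1)] zero) auto
    ultimately show "\<exists>J. direct_sum_of_ideals M I J"
      using I J(1) unfolding direct_sum_of_ideals_def by blast
  qed
  moreover have "I \<inter> ?join J K = ?join (I \<inter> J) (I \<inter> K)"
    if I: "lie_ideal M I" and J: "lie_ideal M J" and K: "lie_ideal M K" for I J K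
  proof (rule inj)
    show "f (I \<inter> ?join J K) = f (?join (I \<inter> J) (I \<inter> K))"
      unfolding meet[OF I lie_ideal_sum[OF M J K]] join[OF J K]
        join[OF lie_ideal_Int[OF I J] lie_ideal_Int[OF I K]] meet[OF I J] meet[OF I K] by blast
  qed (intro lie_ideal_Int lie_ideal_sum M I J K)+
  then have "distributive_lattice (ideal_lattice M)"
    using L.lattice_axioms unfolding distributive_lattice_def carrier_ideal_lattice
    by (simp add: ideal_lattice_join[OF M] ideal_lattice_meet[OF M] lie_ideal_sum[OF M] lie_ideal_Int)
  ultimately show ?thesis by (simp add: boolean_lattice_def)
qed

lemma lie_ideal_jacobson_radical:
  assumes "lie_subalgebra M"
  shows "lie_ideal M (jacobson_radical M)"
  using assms unfolding jacobson_radical_def maximal_ideal_def lie_ideal_def lie_subalgebra_def subspace_def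
  by auto

end

context lie_algebra
begin

lemma semisimple_zero: "semisimple {0}"
  by (rule semisimpleI) (auto simp: lie_ideal_def dest: subspace_0)

lemma lie_subalgebra_semisimple_part:
  assumes "lie_subalgebra M" "semisimple_part M S"
  shows "lie_subalgebra S"
  using assms lie_ideal_subalgebra unfolding semisimple_part_def direct_sum_of_ideals_def by blast

lemma semisimple_part_generating_family:
  assumes M: "lie_subalgebra M" and part: "semisimple_part M S" and T: "simple_components S T"
  shows "\<exists>T'. generating_family M T' \<and> (card T' = card T \<or> card T' = card T + 1)"
proof (cases "M = S")
  case True
  then show ?thesis using generating_family_simple_components M T by blast
next
  case False
  then obtain z where z: "z \<noteq> 0" "direct_sum_of_ideals M (span {z}) S"
    using part by (auto simp: semisimple_part_def)
  have "finite T" using T by (simp add: simple_components_def)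
  then have "card (insert (span {z}) T) = card T + 1"
    using generating_family_insert(1)[OF z T] by simp
  then show ?thesis using generating_family_insert(2)[OF z T] by blast
qed

text \<open>For independent \<open>x\<close> and \<open>y\<close> the lines through x + c y are
  pairwise distinct as c varies. Central lines are ideals, so a large centre yields as many ideals
  as there are scalars.\<close>

lemma span_pair_unique:
  assumes "x \<notin> span {y}" "x + c *s y \<in> span {x + d *s y}" "y \<noteq> 0"
  shows "c = d"
proof -
  obtain e where "x + c *s y = e *s (x + d *s y)"
    using assms(2) by (auto simp: span_singleton)
  then have eq: "(1 - e) *s x = (e * d - c) *s y"
    by (simp add: scale_left_diff_distrib scale_right_distrib algebra_simps)
  have "e = 1"
  proof (rule ccontr)
    assume "e \<noteq> 1"
    then have "x = inverse (1 - e) *s ((1 - e) *s x)" by simp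
    also have "\<dots> \<in> span {y}" unfolding eq by (intro span_scale span_base) simp
    finally show False using assms(1) by blast
  qed
  then show ?thesis using eq assms(3) by simp
qed

end

section \<open>Lattice conditions and the dimension of the centre\<close>

context fd_lie_algebra_char_0
begin

lemma dim_gt_1_obtain:
  assumes "subspace Z" "\<not> dim Z \<le> 1"
  obtains x y where "x \<in> Z" "y \<in> Z" "x \<notin> span {y}" "y \<noteq> 0"
proof -
  obtain C where C: "finite C" "independent C" "span C = Z"
    using obtain_subspace_basis[OF assms(1)] by blast
  have "dim Z = card C" using C dim_span_eq_card_independent by metis
  then obtain x y where xy: "x \<in> C" "y \<in> C" "x \<noteq> y"
    using assms(2) C(1) by (metis card_le_Suc0_iff_eq One_nat_def)
  have "x \<notin> span (C - {x})" using C(2) xy(1) unfolding dependent_def by blast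
  moreover have "span {y} \<subseteq> span (C - {x})" using xy by (intro span_mono) auto
  moreover have "y \<noteq> 0" using C(2) xy(2) dependent_zero by blast
  ultimately show thesis using that[of x y] xy C(3) span_base by blast
qed

lemma finite_ideals_centre_dim:
  assumes "lie_subalgebra M" "finite {I. lie_ideal M I}"
  shows "dim (lie_centre M) \<le> 1"
proof (rule ccontr)
  have Z: "subspace (lie_centre M)" by (rule lie_ideal_subspace[OF lie_ideal_centre[OF assms(1)]])
  assume "\<not> dim (lie_centre M) \<le> 1"
  then obtain x y where xy: "x \<in> lie_centre M" "y \<in> lie_centre M" "x \<notin> span {y}" "y \<noteq> 0"
    using dim_gt_1_obtain[OF Z] by blast
  \<comment> \<open>Characteristic zero makes the field infinite, so this family of central lines is
    infinite.\<close>
  have "inj (\<lambda>c. span {x + c *s y})"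
  proof (rule injI)
    fix c d assume "span {x + c *s y} = span {x + d *s y}"
    then have "x + c *s y \<in> span {x + d *s y}" by (metis insertI1 span_base)
    then show "c = d" using span_pair_unique xy(3,4) by blast
  qed
  moreover have "range (\<lambda>c. span {x + c *s y}) \<subseteq> {I. lie_ideal M I}"
  proof (intro image_subsetI CollectI lie_centre_subspace_ideal subspace_span)
    fix c show "span {x + c *s y} \<subseteq> lie_centre M"
      using xy(1,2) Z by (intro span_minimal) (auto intro: subspace_add subspace_scale)
  qed
  ultimately show False
    using assms(2) infinite_UNIV_char_0 finite_subset finite_imageD by blast
qed

text \<open>The lines of \<open>x\<close>, \<open>y\<close> and \<open>x + y\<close> form a diamond:
  the third lies in the sum of the other two but meets each of them only in zero.\<close>

lemma distributive_centre_dim: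
  assumes M: "lie_subalgebra M" and "distributive_lattice (ideal_lattice M)"
  shows "dim (lie_centre M) \<le> 1"
proof (rule ccontr)
  have Z: "subspace (lie_centre M)" by (rule lie_ideal_subspace[OF lie_ideal_centre[OF M]])
  assume "\<not> dim (lie_centre M) \<le> 1"
  then obtain x y where xy: "x \<in> lie_centre M" "y \<in> lie_centre M" "x \<notin> span {y}" "y \<noteq> 0"
    using dim_gt_1_obtain[OF Z] by blast
  have ideal: "lie_ideal M (span {v})" if "v \<in> lie_centre M" for v
    using that Z by (intro lie_centre_subspace_ideal subspace_span span_minimal) auto
  have xy_Z: "x + y \<in> lie_centre M" using xy Z by (simp add: subspace_add)
  have "x + y \<in> span {x + y} \<inter> {u + v | u v. u \<in> span {x} \<and> v \<in> span {y}}"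
    using span_base by blast
  then obtain u v where uv: "x + y = u + v" "u \<in> span {x + y}" "u \<in> span {x}"
    "v \<in> span {x + y}" "v \<in> span {y}"
    unfolding distributive_sum_Int[OF assms ideal[OF xy_Z] ideal[OF xy(1)] ideal[OF xy(2)]] by blast
  obtain c where c: "u = c *s x" using uv(3) by (auto simp: span_singleton)
  obtain e where e: "u = e *s (x + y)" using uv(2) by (auto simp: span_singleton)
  have "x \<in> span {y}" if "u \<noteq> 0"
  proof -
    have "e \<noteq> 0" using e that by auto
    \<comment> \<open>Written as the instance with coefficients 1 and 0 of
      \<open>span_pair_unique\<close>: the lines of \<open>x + y\<close> and \<open>x\<close> would
      coincide.\<close>
    have "x + 1 *s y = inverse e *s u" using e \<open>e \<noteq> 0\<close> by simp
    also have "\<dots> \<in> span {x + 0 *s y}" using uv(3) by (simp add: span_scale)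
    finally have "(1 :: 'k) = 0" by (rule span_pair_unique[OF xy(3) _ xy(4)])
    then show ?thesis by simp
  qed
  then have "u = 0" using xy(3) by blast
  then have "x = v - y" using uv(1) by (simp add: algebra_simps)
  also have "\<dots> \<in> span {y}" using uv(5) by (intro span_diff) (simp_all add: span_base)
  finally show False using xy(3) by blast
qed

section \<open>Maximal ideals and the Jacobson radical\<close>

lemma proper_ideal_in_maximal:
  assumes "lie_ideal M I" "I \<noteq> M"
  shows "\<exists>P. maximal_ideal M P \<and> I \<subseteq> P"
proof -
  obtain F where F: "finite F" "span F = UNIV" using finite_dim by blast
  have "lie_ideal M I \<and> I \<noteq> M \<and> I \<subseteq> I" using assms by blast
  then obtain P where P: "lie_ideal M P \<and> P \<noteq> M \<and> I \<subseteq> P"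
    and max: "\<And>K. lie_ideal M K \<and> K \<noteq> M \<and> I \<subseteq> K \<Longrightarrow> P \<subseteq> K \<Longrightarrow> K = P"
  proof (rule obtain_max_subspace[OF F(1), where P = "\<lambda>K. lie_ideal M K \<and> K \<noteq> M \<and> I \<subseteq> K"])
    show "subspace K \<and> K \<subseteq> span F" if "lie_ideal M K \<and> K \<noteq> M \<and> I \<subseteq> K" for K
      using that F(2) by (simp add: lie_ideal_def)
  qed (rule that)
  have "maximal_ideal M P"
    unfolding maximal_ideal_def using P max by blast
  then show ?thesis using P by blast
qed

text \<open>If a complement \<open>C\<close> of the radical were proper, a maximal ideal above
  \<open>C\<close> would contain the radical too, hence everything. So \<open>C\<close> is
  \<open>M\<close>, and the radical equals its zero intersection with \<open>C\<close>.\<close>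

lemma complemented_imp_jacobson_trivial:
  assumes M: "lie_subalgebra M" and compl: "complemented_lattice (ideal_lattice M)"
  shows "jacobson_radical M = {0}"
proof -
  note jac = lie_ideal_jacobson_radical[OF M]
  obtain C where "direct_sum_of_ideals M (jacobson_radical M) C"
    using compl jac unfolding complemented_iff[OF M] by blast
  then have C: "lie_ideal M C" "jacobson_radical M \<inter> C = {0}"
    "M = {x + y | x y. x \<in> jacobson_radical M \<and> y \<in> C}"
    by (simp_all add: direct_sum_of_ideals_def)
  have "C = M"
  proof (rule ccontr)
    assume "C \<noteq> M"
    then obtain P where P: "maximal_ideal M P" "C \<subseteq> P" using proper_ideal_in_maximal[OF C(1)] by blast
    have "jacobson_radical M \<subseteq> P" using P(1) by (auto simp: jacobson_radical_def)
    moreover have "subspace P" using P(1) by (simp add: maximal_ideal_def lie_ideal_def)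
    ultimately have "{x + y | x y. x \<in> jacobson_radical M \<and> y \<in> C} \<subseteq> P"
      using P(2) by (auto intro: subspace_add)
    then have "M \<subseteq> P" by (rule subset_trans[OF equalityD1[OF C(3)]])
    then show False using P(1) by (auto simp: maximal_ideal_def lie_ideal_def)
  qed
  then show ?thesis using C(2) lie_ideal_subset[OF jac] by blast
qed

text \<open>An ideal \<open>J\<close> of minimal dimension with \<open>I + J = M\<close> is a complement of \<open>I\<close>: a maximal ideal
  avoiding a nonzero element of \<open>I \<inter> J\<close> would cut \<open>J\<close> down to a smaller such ideal.\<close>

lemma jacobson_trivial_imp_complemented:
  assumes M: "lie_subalgebra M" and jac: "jacobson_radical M = {0}"
  shows "complemented_lattice (ideal_lattice M)"
  unfolding complemented_iff[OF M]
proof (intro allI impI)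
  fix I assume I: "lie_ideal M I"
  let ?supp = "\<lambda>J. lie_ideal M J \<and> M \<subseteq> {x + y | x y. x \<in> I \<and> y \<in> J}"
  have "?supp M"
    using lie_ideal_self[OF M] subspace_0[OF lie_ideal_subspace[OF I]] by force
  then obtain J where J: "lie_ideal M J" and sum: "M \<subseteq> {x + y | x y. x \<in> I \<and> y \<in> J}"
    and min: "\<And>K. ?supp K \<Longrightarrow> dim J \<le> dim K"
    using ex_has_least_nat[of ?supp M dim] by blast
  have subI: "subspace I" and subJ: "subspace J" using I J by (auto simp: lie_ideal_def)
  have "I \<inter> J \<subseteq> {0}"
  proof
    fix v assume v: "v \<in> I \<inter> J"
    show "v \<in> {0}"
    proof (rule ccontr)
      assume "v \<notin> {0}"
      then obtain P where P: "maximal_ideal M P" "v \<notin> P"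
        using jac v lie_ideal_subset[OF I] by (auto simp: jacobson_radical_def)
      have PM: "lie_ideal M P" using P(1) by (simp add: maximal_ideal_def)
      have subP: "subspace P" by (rule lie_ideal_subspace[OF PM])
      note IJ = lie_ideal_Int[OF I J]
      let ?Q = "{x + y | x y. x \<in> I \<inter> J \<and> y \<in> P}"
      have Q: "lie_ideal M ?Q" by (rule lie_ideal_sum[OF M IJ PM])
      have "P \<subseteq> ?Q"
        using subspace_0[OF lie_ideal_subspace[OF IJ]] by force
      moreover have "v \<in> ?Q"
        using v subspace_0[OF subP] by force
      \<comment> \<open>The ideal \<open>?Q\<close> contains \<open>P\<close> and also
        \<open>v\<close>, which is outside \<open>P\<close>, so maximality applies.\<close>
      ultimately have "?Q = M" using P Q unfolding maximal_ideal_def by blast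
      have "?supp (J \<inter> P)"
      proof (intro conjI subsetI)
        show "lie_ideal M (J \<inter> P)" by (rule lie_ideal_Int[OF J PM])
        fix m assume "m \<in> M"
        then obtain x y where m: "m = x + y" "x \<in> I" "y \<in> J" using sum by blast
        have "y \<in> ?Q" using \<open>?Q = M\<close> m(3) lie_ideal_subset[OF J] by blast
        \<comment> \<open>The modular law by hand: the part of \<open>y\<close> in
          \<open>I \<inter> J\<close> moves over to the \<open>I\<close> summand, and what is left
          lies in both \<open>J\<close> and \<open>P\<close>.\<close>
        then obtain w p where y: "y = w + p" "w \<in> I \<inter> J" "p \<in> P" by blast
        have "p \<in> J" using y m(3) subspace_diff[OF subJ, of y w] by simp
        moreover have "m = (x + w) + p" using m(1) y(1) by (simp add: add.assoc)
        moreover have "x + w \<in> I" using m(2) y(2) by (intro subspace_add[OF subI]) auto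
        ultimately show "m \<in> {x + y | x y. x \<in> I \<and> y \<in> J \<inter> P}" using y(3) by blast
      qed
      then have "dim J \<le> dim (J \<inter> P)" by (rule min)
      moreover have "J \<inter> P \<subset> J" using v P(2) by blast
      then have "dim (J \<inter> P) < dim J"
        using dim_psubspace subspace_inter[OF subJ subP] subJ by blast
      ultimately show False by simp
    qed
  qed
  then have "I \<inter> J = {0}"
    using subspace_0[OF subI] subspace_0[OF subJ] by blast
  moreover have "{x + y | x y. x \<in> I \<and> y \<in> J} \<subseteq> M"
    by (rule lie_ideal_subset[OF lie_ideal_sum[OF M I J]])
  ultimately show "\<exists>J. direct_sum_of_ideals M I J"
    using I J sum unfolding direct_sum_of_ideals_def by blast
qed

lemma semisimple_part_cube:
  assumes M: "lie_subalgebra M" and "semisimple_part M S"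
  shows "\<exists>n. lattice_isomorphic (ideal_lattice M) (cube_lattice n)"
    and "finite {I. lie_ideal M I}"
proof -
  obtain T where "simple_components S T"
    using semisimple_simple_components lie_subalgebra_semisimple_part[OF assms] assms(2)
    unfolding semisimple_part_def by blast
  then obtain T' where "generating_family M T'"
    using semisimple_part_generating_family[OF assms] by blast
  then show "\<exists>n. lattice_isomorphic (ideal_lattice M) (cube_lattice n)" "finite {I. lie_ideal M I}"
    using generating_family_cube[OF M] generating_family_finite[OF M] by blast+
qed

lemma complemented_centre_dim_semisimple_part:
  assumes M: "lie_subalgebra M" and "complemented_lattice (ideal_lattice M)" and "dim (lie_centre M) \<le> 1"
  shows "\<exists>S. semisimple_part M S"
proof -
  obtain S where S: "direct_sum_of_ideals M S (lie_centre M)" "semisimple S"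
    using complemented_decomposition[OF assms(1,2)] by blast
  note ds = direct_sum_sym[OF S(1)]
  obtain C where C: "finite C" "independent C" "span C = lie_centre M"
    using obtain_subspace_basis[OF lie_ideal_subspace[OF lie_ideal_centre[OF M]]] by blast
  have "card C \<le> 1" using assms(3) C dim_span_eq_card_independent by metis
  then consider "C = {}" | z where "C = {z}"
    using C(1) by (metis card_0_eq card_1_singletonE le_neq_implies_less less_one)
  then show ?thesis
  proof cases
    case 1
    then have "lie_centre M = {0}" using C(3) by simp
    then have "M = S" using ds unfolding direct_sum_of_ideals_def by simp
    then show ?thesis using S(2) unfolding semisimple_part_def by blast
  next
    case (2 z)
    then have "z \<noteq> 0" using C(2) by auto
    moreover have "direct_sum_of_ideals M (span {z}) S" using ds C(3) 2 by simp
    ultimately show ?thesis using S(2) unfolding semisimple_part_def by blast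
  qed
qed

text \<open>As \<open>{0}\<close> counts as semisimple, the zero algebra and the one-dimensional
  algebra are the cases with \<open>S = {0}\<close>.\<close>

lemma semisimple_part_UNIV_iff:
  "(\<exists>S. semisimple_part UNIV S) \<longleftrightarrow>
     (UNIV :: 'a set) = {0} \<or> (\<exists>z. z \<noteq> 0 \<and> UNIV = span {z}) \<or> semisimple UNIV \<or>
     (\<exists>z S. z \<noteq> 0 \<and> semisimple S \<and> direct_sum_of_ideals UNIV (span {z}) S)"
proof -
  have "direct_sum_of_ideals UNIV UNIV {0}"
    using lie_ideal_self[OF lie_subalgebra_UNIV] lie_ideal_zero[OF lie_subalgebra_UNIV]
    by (auto simp: direct_sum_of_ideals_def)
  then show ?thesis
    unfolding semisimple_part_def using semisimple_zero by metis
qed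

text \<open>The cycle runs from boolean to complemented with small centre, to a semisimple part, to
  a cube and back. Finiteness and the Jacobson radical are attached to its second stage: finiteness
  bounds the centre, and the radical expresses complementedness.\<close>

lemma boolean_equivalences:
  assumes M: "lie_subalgebra M"
  shows "boolean_lattice (ideal_lattice M) \<longleftrightarrow>
      finite (carrier (ideal_lattice M)) \<and> complemented_lattice (ideal_lattice M)"
    and "boolean_lattice (ideal_lattice M) \<longleftrightarrow>
      (\<exists>n. lattice_isomorphic (ideal_lattice M) (cube_lattice n))"
    and "boolean_lattice (ideal_lattice M) \<longleftrightarrow>
      jacobson_radical M = {0} \<and> dim (lie_centre M) \<le> 1"
    and "boolean_lattice (ideal_lattice M) \<longleftrightarrow> (\<exists>S. semisimple_part M S)"
proof -
  have jac: "complemented_lattice (ideal_lattice M) \<longleftrightarrow> jacobson_radical M = {0}"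
    using complemented_imp_jacobson_trivial[OF M] jacobson_trivial_imp_complemented[OF M] by blast
  have 1: "boolean_lattice (ideal_lattice M) \<Longrightarrow>
      complemented_lattice (ideal_lattice M) \<and> dim (lie_centre M) \<le> 1"
    using distributive_centre_dim[OF M] by (simp add: boolean_lattice_def)
  have 2: "finite (carrier (ideal_lattice M)) \<Longrightarrow> dim (lie_centre M) \<le> 1"
    using finite_ideals_centre_dim[OF M] by (simp add: carrier_ideal_lattice)
  have 3: "complemented_lattice (ideal_lattice M) \<Longrightarrow> dim (lie_centre M) \<le> 1 \<Longrightarrow> \<exists>S. semisimple_part M S"
    by (rule complemented_centre_dim_semisimple_part[OF M])
  have 4: "\<exists>S. semisimple_part M S \<Longrightarrow> \<exists>n. lattice_isomorphic (ideal_lattice M) (cube_lattice n)"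
    using semisimple_part_cube(1)[OF M] by blast
  have 5: "\<exists>n. lattice_isomorphic (ideal_lattice M) (cube_lattice n) \<Longrightarrow> boolean_lattice (ideal_lattice M)"
    using cube_isomorphic_boolean[OF M] by blast
  have 6: "\<exists>S. semisimple_part M S \<Longrightarrow> finite (carrier (ideal_lattice M))"
    using semisimple_part_cube(2)[OF M] by (auto simp: carrier_ideal_lattice)
  show "boolean_lattice (ideal_lattice M) \<longleftrightarrow>
      finite (carrier (ideal_lattice M)) \<and> complemented_lattice (ideal_lattice M)"
    using 1 2 3 4 5 6 by metis
  show "boolean_lattice (ideal_lattice M) \<longleftrightarrow>
      (\<exists>n. lattice_isomorphic (ideal_lattice M) (cube_lattice n))"
    using 1 3 4 5 by metis
  show "boolean_lattice (ideal_lattice M) \<longleftrightarrow>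
      jacobson_radical M = {0} \<and> dim (lie_centre M) \<le> 1"
    using 1 3 4 5 jac by metis
  show "boolean_lattice (ideal_lattice M) \<longleftrightarrow> (\<exists>S. semisimple_part M S)"
    using 1 3 4 5 by metis
qed

lemma semisimple_part_ideal_count:
  assumes M: "lie_subalgebra M" and S: "semisimple_part M S"
  shows "\<exists>T. simple_components S T"
    and "simple_components S T \<Longrightarrow> \<exists>n. (n = card T \<or> n = card T + 1) \<and> card {I. lie_ideal M I} = 2 ^ n"
proof -
  show "\<exists>T. simple_components S T"
    using semisimple_simple_components lie_subalgebra_semisimple_part[OF assms] S
    unfolding semisimple_part_def by blast
  assume "simple_components S T"
  then obtain T' where "generating_family M T'" "card T' = card T \<or> card T' = card T + 1"
    using semisimple_part_generating_family[OF assms] by blast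
  then show "\<exists>n. (n = card T \<or> n = card T + 1) \<and> card {I. lie_ideal M I} = 2 ^ n"
    using generating_family_card[OF M] by blast
qed

end

theorem corollary2p5:
  fixes scale :: "'k::field_char_0 \<Rightarrow> 'a::ab_group_add \<Rightarrow> 'a"
    and bracket :: "'a \<Rightarrow> 'a \<Rightarrow> 'a"
  assumes "finite_dim_lie_algebra scale bracket"
  shows
    "(complemented_lattice (lie_algebra.ideal_lattice scale bracket UNIV) \<longrightarrow>
        (\<exists>S A. lie_algebra.direct_sum_of_ideals scale bracket UNIV S A \<and>
               lie_algebra.semisimple scale bracket S \<and>
               lie_algebra.abelian bracket A \<and>
               A = lie_algebra.lie_centre bracket UNIV))
     \<and>
     (boolean_lattice (lie_algebra.ideal_lattice scale bracket UNIV) \<longleftrightarrow>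
        finite (carrier (lie_algebra.ideal_lattice scale bracket UNIV)) \<and>
        complemented_lattice (lie_algebra.ideal_lattice scale bracket UNIV))
     \<and>
     (boolean_lattice (lie_algebra.ideal_lattice scale bracket UNIV) \<longleftrightarrow>
        (\<exists>n. lattice_isomorphic (lie_algebra.ideal_lattice scale bracket UNIV) (cube_lattice n)))
     \<and>
     (boolean_lattice (lie_algebra.ideal_lattice scale bracket UNIV) \<longleftrightarrow>
        lie_algebra.jacobson_radical scale bracket UNIV = {0} \<and>
        vector_space.dim scale (lie_algebra.lie_centre bracket UNIV) \<le> 1)
     \<and>
     (boolean_lattice (lie_algebra.ideal_lattice scale bracket UNIV) \<longleftrightarrow>
        (UNIV :: 'a set) = {0} \<or>
        (\<exists>z. z \<noteq> 0 \<and> (UNIV :: 'a set) = module.span scale {z}) \<or>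
        lie_algebra.semisimple scale bracket UNIV \<or>
        (\<exists>z S. z \<noteq> 0 \<and> lie_algebra.semisimple scale bracket S \<and>
           lie_algebra.direct_sum_of_ideals scale bracket UNIV (module.span scale {z}) S))
     \<and>
     (boolean_lattice (lie_algebra.ideal_lattice scale bracket UNIV) \<longrightarrow>
        (\<forall>S. lie_algebra.semisimple_part scale bracket UNIV S \<longrightarrow>
           (\<exists>T. lie_algebra.simple_components scale bracket S T) \<and>
           (\<forall>T r. lie_algebra.simple_components scale bracket S T \<and> r = card T \<longrightarrow>
              (\<exists>n. (n = r \<or> n = r + 1) \<and>
                 card {I. lie_algebra.lie_ideal scale bracket UNIV I} = 2 ^ n))))"
proof -
  interpret finite_dim_lie_algebra scale bracket by fact
  interpret fd_lie_algebra_char_0 scale bracket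
    by unfold_locales (rule finite_dim)
  note M = lie_subalgebra_UNIV
  show ?thesis
    unfolding semisimple_part_UNIV_iff[symmetric]
  proof (intro conjI impI allI)
    assume "complemented_lattice (ideal_lattice UNIV)"
    then obtain S where "direct_sum_of_ideals UNIV S (lie_centre UNIV)" "semisimple S"
      using complemented_decomposition[OF M] by blast
    moreover have "abelian (lie_centre UNIV)"
      by (auto simp: abelian_def lie_centre_def)
    ultimately show "\<exists>S A. direct_sum_of_ideals UNIV S A \<and> semisimple S \<and> abelian A \<and> A = lie_centre UNIV"
      by blast
  next
    fix S T r
    assume "semisimple_part UNIV S"
    note count = semisimple_part_ideal_count[OF M this]
    show "\<exists>T. simple_components S T" by (rule count(1))
    assume "simple_components S T \<and> r = card T"
    then show "\<exists>n. (n = r \<or> n = r + 1) \<and> card {I. lie_ideal UNIV I} = 2 ^ n"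
      using count(2) by simp
  qed (rule boolean_equivalences[OF M])+
qed

end
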